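(* Let $\psi$ and $\varphi$ be pure entangled states on finite dimensional bipartite quantum systems, and let $P_\psi,P_\varphi$ be the distributions of their squared Schmidt coefficients. For $\nu\in(0,1)$, $$\mathcal R^{1,\mathcal Q}_{\psi,\varphi}(\nu)=\mathcal R^{1,\mathcal M}_{P_\psi,P_\varphi}(\nu).$$
   Context: All logarithms are to base $2$. $\mathcal S(\mathcal H)$ is the set of density operators on $\mathcal H$. LOCC means local operations and classical communication between the two parties of a bipartite system. $F(\rho,\sigma)=\mathrm{Tr}\,|\sqrt\rho\sqrt\sigma|$ is the quantum fidelity. For real $N\ge0$, an entanglement storage of size $N$ is the bipartite system $\mathbb C^K\otimes\mathbb C^K$ with $K=\lfloor2^N\rfloor$ (for integer $N$ this is $(\mathbb C^2\otimes\mathbb C^2)^{\otimes N}$). For $\psi$ on $\mathcal H$ and $\varphi$ on $\mathcal H'$, $$F^{\mathcal Q}(\psi\to\varphi|N)=\sup\{F(\Gamma'\circ\Gamma(\psi),\varphi)\},$$ the supremum over LOCC maps $\Gamma:\mathcal S(\mathcal H)\to\mathcal S(\mathbb C^K\otimes\mathbb C^K)$ and $\Gamma':\mathcal S(\mathbb C^K\otimes\mathbb C^K)\to\mathcal S(\mathcal H')$. For probability distributions $P,Q$ on finite sets $\mathcal X,\mathcal Y$: $F(Q,Q')=\sum_y\sqrt{Q(y)Q'(y)}$; $P^\downarrow_i$ is the $i$-th largest value of $P$ ($0$ beyond the size); $P\prec Q$ means $\sum_{i\le l}P^\downarrow_i\le\sum_{i\le l}Q^\downarrow_i$ for all $l$;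 with $K_N$ a set of $\lfloor 2^N\rfloor$ elements and $\mathcal P(\cdot)$ the set of distributions, $F^{\mathcal M}(P\to Q|N)=\sup\{F(P'',Q)\mid P''\in\mathcal P(\mathcal Y),\ \exists P'\in\mathcal P(K_N):\ P\prec P'\prec P''\}$. $\mathcal R^{1,\mathcal Q}_{\psi,\varphi}(\nu)$ (resp. $\mathcal R^{1,\mathcal M}_{P,Q}(\nu)$) is the set of $(s_1,t_1)$ with $s_1,t_1>0$ for which there exist $S_n=s_1n+o(n)$ (nonnegative reals) and $T_n=t_1n+o(n)$ (nonnegative integers) with $\liminf_{n\to\infty}F^{\mathcal Q}(\psi^{\otimes n}\to\varphi^{\otimes T_n}|S_n)\ge\nu$ (resp. $\liminf_{n\to\infty}F^{\mathcal M}(P^n\to Q^{T_n}|S_n)\ge\nu$), where $P^n$ is the $n$-fold i.i.d. product. *)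

theory Defs
  imports
    "HOL-Probability.Probability_Mass_Function"
    "HOL-Library.Landau_Symbols"
    "Jordan_Normal_Form.Schur_Decomposition"
begin

unbundle no vec_syntax
hide_const (open) Finite_Cartesian_Product.vec Finite_Cartesian_Product.mat

section \<open>Tensor products\<close>

text \<open>
  A bipartite system is given by a pair of dimensions \<open>(dA, dB)\<close>. The tensor product of the
  complex coordinate spaces of dimensions \<open>dA\<close> and \<open>dB\<close> is identified with the coordinate space
  of dimension \<open>dA * dB\<close> by the row-major numbering of
  the product basis: \<open>e_i \<otimes> e_j\<close> has index \<open>i * dB + j\<close>.
\<close>

definition vec_tensor :: "complex vec \<Rightarrow> complex vec \<Rightarrow> complex vec" where
  "vec_tensor a b =
     vec (dim_vec a * dim_vec b) (\<lambda>k. a $ (k div dim_vec b) * b $ (k mod dim_vec b))"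

definition mat_tensor :: "complex mat \<Rightarrow> complex mat \<Rightarrow> complex mat" where
  "mat_tensor A B =
     mat (dim_row A * dim_row B) (dim_col A * dim_col B)
       (\<lambda>(i, j). A $$ (i div dim_row B, j div dim_col B) * B $$ (i mod dim_row B, j mod dim_col B))"

text \<open>
  The n-fold tensor power of a vector of the bipartite system \<open>(dA, dB)\<close>, as a vector of the
  bipartite system \<open>(dA ^ n, dB ^ n)\<close>: all first factors belong to the first party, all second
  factors to the second party. A basis index of \<open>n\<close> copies of a d-dimensional system is the number
  whose digits to base \<open>d\<close> are the basis indices of the copies, so the amplitude at \<open>(i, j)\<close> is the
  product over the copies \<open>l\<close> of the amplitudes of \<open>\<psi>\<close> at (l-th digit of \<open>i\<close>, l-th digit of \<open>j\<close>).
\<close>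

definition digit :: "nat \<Rightarrow> nat \<Rightarrow> nat \<Rightarrow> nat" where
  "digit d l i = i div d ^ l mod d"

definition tensor_power :: "nat \<Rightarrow> nat \<Rightarrow> complex vec \<Rightarrow> nat \<Rightarrow> complex vec" where
  "tensor_power dA dB \<psi> n =
     vec (dA ^ n * dB ^ n)
       (\<lambda>k. \<Prod>l<n. \<psi> $ (digit dA l (k div dB ^ n) * dB + digit dB l (k mod dB ^ n)))"

section \<open>States and fidelity\<close>

definition mat_trace :: "complex mat \<Rightarrow> complex" where
  "mat_trace A = (\<Sum>i<dim_row A. A $$ (i, i))"

text \<open>The order on \<^typ>\<open>complex\<close> is that of Complex_Order: \<open>0 \<le> z\<close> means that \<open>z\<close> is a
  nonnegative real.\<close>

definition positive_mat :: "nat \<Rightarrow> complex mat \<Rightarrow> bool" where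
  "positive_mat d A \<longleftrightarrow>
     A \<in> carrier_mat d d \<and> (\<forall>v\<in>carrier_vec d. (0::complex) \<le> (A *\<^sub>v v) \<bullet>c v)"

definition mat_sqrt :: "complex mat \<Rightarrow> complex mat" where
  "mat_sqrt A = (THE B. positive_mat (dim_row A) B \<and> B * B = A)"

definition mat_abs :: "complex mat \<Rightarrow> complex mat" where
  "mat_abs A = mat_sqrt (mat_adjoint A * A)"

definition fidelity :: "complex mat \<Rightarrow> complex mat \<Rightarrow> real" where
  "fidelity \<rho> \<sigma> = Re (mat_trace (mat_abs (mat_sqrt \<rho> * mat_sqrt \<sigma>)))"

definition density_of :: "complex vec \<Rightarrow> complex mat" where
  "density_of \<psi> = mat (dim_vec \<psi>) (dim_vec \<psi>) (\<lambda>(i, j). \<psi> $ i * cnj (\<psi> $ j))"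

definition pure_state :: "nat \<Rightarrow> nat \<Rightarrow> complex vec \<Rightarrow> bool" where
  "pure_state dA dB \<psi> \<longleftrightarrow> \<psi> \<in> carrier_vec (dA * dB) \<and> \<psi> \<bullet>c \<psi> = 1"

definition entangled :: "nat \<Rightarrow> nat \<Rightarrow> complex vec \<Rightarrow> bool" where
  "entangled dA dB \<psi> \<longleftrightarrow>
     \<not> (\<exists>a\<in>carrier_vec dA. \<exists>b\<in>carrier_vec dB. \<psi> = vec_tensor a b)"

definition orthonormal_family :: "nat \<Rightarrow> nat \<Rightarrow> (nat \<Rightarrow> complex vec) \<Rightarrow> bool" where
  "orthonormal_family d r e \<longleftrightarrow>
     (\<forall>i<r. e i \<in> carrier_vec d) \<and> (\<forall>i<r. \<forall>j<r. e i \<bullet>c e j = (if i = j then 1 else 0))"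

text \<open>
  \<open>p\<close> is the distribution, on \<open>{..<r}\<close>, of the squared coefficients of a Schmidt decomposition
  of \<open>\<psi>\<close>. Coefficients equal to 0 may be listed or left out, and they may be listed in any order.
\<close>

definition schmidt_distribution ::
  "nat \<Rightarrow> nat \<Rightarrow> complex vec \<Rightarrow> nat \<Rightarrow> nat pmf \<Rightarrow> bool" where
  "schmidt_distribution dA dB \<psi> r p \<longleftrightarrow>
     set_pmf p \<subseteq> {..<r} \<and>
     (\<exists>a b. orthonormal_family dA r a \<and> orthonormal_family dB r b \<and>
       \<psi> = vec (dA * dB)
         (\<lambda>k. \<Sum>i<r. complex_of_real (sqrt (pmf p i)) * vec_tensor (a i) (b i) $ k))"

section \<open>LOCC maps\<close>

definition mat_sum :: "nat \<Rightarrow> complex mat list \<Rightarrow> complex mat" where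
  "mat_sum d As = foldr (+) As (0\<^sub>m d d)"

text \<open>The completely positive map with the given Kraus operators, with values in the d-by-d
  matrices.\<close>

definition kraus_map :: "nat \<Rightarrow> complex mat list \<Rightarrow> complex mat \<Rightarrow> complex mat" where
  "kraus_map d Ks \<rho> = mat_sum d (map (\<lambda>K. K * \<rho> * mat_adjoint K) Ks)"

text \<open>
  A quantum instrument on a d-dimensional system with finitely many outcomes: outcome \<open>(e, Ks)\<close> applies the completely
  positive map with Kraus operators \<open>Ks\<close> and leaves a system of dimension \<open>e\<close>, and the sum over all
  outcomes is trace preserving.
\<close>

type_synonym instrument = "(nat \<times> complex mat list) list"

definition is_instrument :: "nat \<Rightarrow> instrument \<Rightarrow> bool" where
  "is_instrument d I \<longleftrightarrow>
     (\<forall>(e, Ks)\<in>set I. 0 < e \<and> set Ks \<subseteq> carrier_mat e d) \<and>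
     mat_sum d (map (\<lambda>K. mat_adjoint K * K) (concat (map snd I))) = 1\<^sub>m d"

text \<open>
  LOCC maps with finitely many rounds of communication. In a round one party applies an instrument
  to its own system and announces the outcome; the rest of the protocol may depend on it. The sum
  over the outcomes is the resulting map, since the classical record is not part of the output.
  Local channels are instruments with one outcome, so ancillas (isometries) and partial traces are
  included. All these maps are completely positive and trace preserving, so they restrict to maps
  between the sets of density operators.
\<close>

inductive locc :: "nat \<times> nat \<Rightarrow> nat \<times> nat \<Rightarrow> (complex mat \<Rightarrow> complex mat) \<Rightarrow> bool" where
  locc_id: "locc D D (\<lambda>\<rho>. \<rho>)"
| locc_A: "is_instrument dA I \<Longrightarrow>
    (\<forall>i<length I. locc (fst (I ! i), dB) (dA', dB') (\<Lambda> i)) \<Longrightarrow>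
    locc (dA, dB) (dA', dB')
      (\<lambda>\<rho>. mat_sum (dA' * dB')
        (map (\<lambda>i. \<Lambda> i (kraus_map (fst (I ! i) * dB)
                 (map (\<lambda>K. mat_tensor K (1\<^sub>m dB)) (snd (I ! i))) \<rho>))
             [0..<length I]))"
| locc_B: "is_instrument dB I \<Longrightarrow>
    (\<forall>i<length I. locc (dA, fst (I ! i)) (dA', dB') (\<Lambda> i)) \<Longrightarrow>
    locc (dA, dB) (dA', dB')
      (\<lambda>\<rho>. mat_sum (dA' * dB')
        (map (\<lambda>i. \<Lambda> i (kraus_map (dA * fst (I ! i))
                 (map (\<lambda>K. mat_tensor (1\<^sub>m dA) K) (snd (I ! i))) \<rho>))
             [0..<length I]))"

section \<open>Conversion through a storage, quantum version\<close>

definition storage_dim :: "real \<Rightarrow> nat" where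
  "storage_dim N = nat \<lfloor>2 powr N\<rfloor>"

definition FQ ::
  "nat \<times> nat \<Rightarrow> complex mat \<Rightarrow> nat \<times> nat \<Rightarrow> complex mat \<Rightarrow> real \<Rightarrow> real" where
  "FQ D \<rho> D' \<sigma> N =
     Sup {fidelity (\<Gamma>' (\<Gamma> \<rho>)) \<sigma> | \<Gamma> \<Gamma>'.
       locc D (storage_dim N, storage_dim N) \<Gamma> \<and>
       locc (storage_dim N, storage_dim N) D' \<Gamma>'}"

definition RQ ::
  "nat \<Rightarrow> nat \<Rightarrow> complex vec \<Rightarrow> nat \<Rightarrow> nat \<Rightarrow> complex vec \<Rightarrow> real \<Rightarrow> (real \<times> real) set" where
  "RQ dA dB \<psi> dA' dB' \<phi> \<nu> =
     {(s, t). 0 < s \<and> 0 < t \<and>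
       (\<exists>(S :: nat \<Rightarrow> real) (T :: nat \<Rightarrow> nat).
         (\<forall>n. 0 \<le> S n) \<and>
         (\<lambda>n. S n - s * real n) \<in> o(\<lambda>n. real n) \<and>
         (\<lambda>n. real (T n) - t * real n) \<in> o(\<lambda>n. real n) \<and>
         ereal \<nu> \<le> liminf (\<lambda>n. ereal
           (FQ (dA ^ n, dB ^ n) (density_of (tensor_power dA dB \<psi> n))
               (dA' ^ T n, dB' ^ T n) (density_of (tensor_power dA' dB' \<phi> (T n)))
               (S n))))}"

section \<open>Conversion through a storage, majorization version\<close>

text \<open>
  The values of \<open>p\<close> in decreasing order, counted from index 0. Listing them over the (finite)
  support instead of over a larger carrier only drops zeros, and indices beyond the list give 0.
\<close>

definition decreasing_value :: "'a pmf \<Rightarrow> nat \<Rightarrow> real" where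
  "decreasing_value p i =
     (let xs = rev (sorted_list_of_multiset (image_mset (pmf p) (mset_set (set_pmf p))))
      in if i < length xs then xs ! i else 0)"

definition majorized_by :: "'a pmf \<Rightarrow> 'b pmf \<Rightarrow> bool" where
  "majorized_by p q \<longleftrightarrow>
     (\<forall>l. (\<Sum>i<l. decreasing_value p i) \<le> (\<Sum>i<l. decreasing_value q i))"

definition classical_fidelity :: "'a set \<Rightarrow> 'a pmf \<Rightarrow> 'a pmf \<Rightarrow> real" where
  "classical_fidelity Y q q' = (\<Sum>y\<in>Y. sqrt (pmf q y * pmf q' y))"

definition FM :: "'a pmf \<Rightarrow> 'b set \<Rightarrow> 'b pmf \<Rightarrow> real \<Rightarrow> real" where
  "FM p Y q N =
     Sup {classical_fidelity Y p'' q | p''.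
       set_pmf p'' \<subseteq> Y \<and>
       (\<exists>p' :: nat pmf. set_pmf p' \<subseteq> {..<storage_dim N} \<and>
          majorized_by p p' \<and> majorized_by p' p'')}"

definition RM :: "'a pmf \<Rightarrow> 'b set \<Rightarrow> 'b pmf \<Rightarrow> real \<Rightarrow> (real \<times> real) set" where
  "RM p Y q \<nu> =
     {(s, t). 0 < s \<and> 0 < t \<and>
       (\<exists>(S :: nat \<Rightarrow> real) (T :: nat \<Rightarrow> nat).
         (\<forall>n. 0 \<le> S n) \<and>
         (\<lambda>n. S n - s * real n) \<in> o(\<lambda>n. real n) \<and>
         (\<lambda>n. real (T n) - t * real n) \<in> o(\<lambda>n. real n) \<and>
         ereal \<nu> \<le> liminf (\<lambda>n. ereal
           (FM (replicate_pmf n p)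
               {ys. set ys \<subseteq> Y \<and> length ys = T n} (replicate_pmf (T n) q)
               (S n))))}"

end

theory Submission
  imports Defs "Jordan_Normal_Form.Spectral_Radius" "HOL-Combinatorics.Permutations"
begin

text \<open>
  For every storage size the two optimal fidelities agree: \<open>FQ = FM\<close>. The spectrum of a Schmidt
  decomposition and its partial sums obey Ky Fan's variational principle, so along the branches of an
  LOCC map, which may be taken pure, the average of the ordered Schmidt values can only go up in the
  majorization order. Averaging these values over the branches after the storage and after the
  recovery gives a chain \<open>P \<prec> P' \<prec> P''\<close> with \<open>P'\<close> on as many points as the storage has
  dimensions. By von Neumann's trace inequality and concavity the fidelity with the target is at most
  that of \<open>P''\<close> with \<open>Q\<close>. Conversely, Nielsen's protocol realizes every such chain by LOCC maps
  between states whose Schmidt bases are those of source, storage and target. The Schmidt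
  distribution of a tensor power is the i.i.d. product, and the rate regions coincide termwise.
\<close>

section \<open>Orthonormal families and the spectral theorem\<close>

text \<open>A protocol outputs mixed states, for which Schmidt values are not defined. The invariant
  is therefore attached to an ensemble: a list of unnormalised vectors whose rank-one operators add
  up to the state. Every Kraus operator opens a branch of its own, even inside one announced
  outcome; this refines the ensemble without changing the density matrix, so that the induction over
  \<open>locc\<close> only meets single local operators.

  What turns the branches back into one distribution is that the target is pure: the squared
  fidelity is then linear in the other state, hence additive over branches, and Cauchy and Schwarz
  merge the summands.

  Vectors are functions on the naturals, read below a dimension that is passed along. Systems of
  different sizes, transposes and bases indexed by words are then treated alike.\<close>

definition ip :: "nat \<Rightarrow> (nat \<Rightarrow> complex) \<Rightarrow> (nat \<Rightarrow> complex) \<Rightarrow> complex" where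
  "ip d f g = (\<Sum>k<d. f k * cnj (g k))"

definition nsq :: "nat \<Rightarrow> (nat \<Rightarrow> complex) \<Rightarrow> real" where
  "nsq d f = (\<Sum>k<d. (cmod (f k))\<^sup>2)"

text \<open>The index type stays arbitrary because the Schmidt bases of a tensor power are indexed
  by words.\<close>

definition onf :: "nat \<Rightarrow> 'i set \<Rightarrow> ('i \<Rightarrow> nat \<Rightarrow> complex) \<Rightarrow> bool" where
  "onf d I u \<longleftrightarrow> (\<forall>i\<in>I. \<forall>j\<in>I. ip d (u i) (u j) = (if i = j then 1 else 0))"

lemma cnj_ip: "cnj (ip d f g) = ip d g f"
  by (simp add: ip_def mult.commute)

lemma cmod_ip_commute: "cmod (ip d f g) = cmod (ip d g f)"
  by (metis cnj_ip complex_mod_cnj)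

lemma ip_self: "ip d f f = of_real (nsq d f)"
  by (simp add: ip_def nsq_def flip: complex_norm_square)

lemma nsq_nonneg [simp]: "0 \<le> nsq d f"
  by (simp add: nsq_def sum_nonneg)

lemma nsq_eq_0_D: "nsq d f = 0 \<Longrightarrow> k < d \<Longrightarrow> f k = 0"
  by (simp add: nsq_def sum_nonneg_eq_0_iff)

lemma ip_cong: "(\<And>k. k < d \<Longrightarrow> f k = f' k) \<Longrightarrow> (\<And>k. k < d \<Longrightarrow> g k = g' k) \<Longrightarrow> ip d f g = ip d f' g'"
  by (simp add: ip_def)

lemma nsq_cong: "(\<And>k. k < d \<Longrightarrow> f k = f' k) \<Longrightarrow> nsq d f = nsq d f'"
  by (simp add: nsq_def)

lemma ip_sum_left: "ip d (\<lambda>k. \<Sum>i\<in>I. c i * u i k) g = (\<Sum>i\<in>I. c i * ip d (u i) g)"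
proof -
  have "ip d (\<lambda>k. \<Sum>i\<in>I. c i * u i k) g = (\<Sum>k<d. \<Sum>i\<in>I. c i * (u i k * cnj (g k)))"
    by (simp add: ip_def sum_distrib_right mult.assoc)
  also have "\<dots> = (\<Sum>i\<in>I. \<Sum>k<d. c i * (u i k * cnj (g k)))"
    by (rule sum.swap)
  finally show ?thesis by (simp add: ip_def sum_distrib_left)
qed

lemma ip_sum_right: "ip d g (\<lambda>k. \<Sum>i\<in>I. c i * u i k) = (\<Sum>i\<in>I. cnj (c i) * ip d g (u i))"
proof -
  have "ip d g (\<lambda>k. \<Sum>i\<in>I. c i * u i k) = cnj (ip d (\<lambda>k. \<Sum>i\<in>I. c i * u i k) g)"
    by (rule cnj_ip [symmetric])
  also have "\<dots> = (\<Sum>i\<in>I. cnj (c i) * ip d g (u i))"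
    by (simp only: ip_sum_left cnj_sum complex_cnj_mult cnj_ip)
  finally show ?thesis .
qed

lemma ip_diff_left: "ip d (\<lambda>k. f k - g k) h = ip d f h - ip d g h"
  by (simp add: ip_def algebra_simps sum_subtractf)

lemma ip_diff_right: "ip d h (\<lambda>k. f k - g k) = ip d h f - ip d h g"
  by (simp add: ip_def algebra_simps sum_subtractf)

lemma ip_scale: "ip d (\<lambda>k. c * f k) (\<lambda>k. c' * g k) = c * cnj c' * ip d f g"
  by (simp add: ip_def sum_distrib_left mult_ac)

lemma nsq_scale: "nsq d (\<lambda>k. c * f k) = (cmod c)\<^sup>2 * nsq d f"
  by (simp add: nsq_def norm_mult power_mult_distrib sum_distrib_left)

lemma onf_coeff:
  assumes "onf d I u" "finite I" "j \<in> I"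
  shows "ip d (\<lambda>k. \<Sum>i\<in>I. c i * u i k) (u j) = c j"
proof -
  have "(\<Sum>i\<in>I. c i * ip d (u i) (u j)) = (\<Sum>i\<in>I. if i = j then c i else 0)"
    using assms by (intro sum.cong) (auto simp: onf_def)
  then show ?thesis using assms by (simp add: ip_sum_left)
qed

lemma onf_nsq:
  assumes "onf d I u" "finite I"
  shows "nsq d (\<lambda>k. \<Sum>i\<in>I. c i * u i k) = (\<Sum>i\<in>I. (cmod (c i))\<^sup>2)"
proof -
  have "complex_of_real (nsq d (\<lambda>k. \<Sum>i\<in>I. c i * u i k)) = of_real (\<Sum>i\<in>I. (cmod (c i))\<^sup>2)"
    unfolding ip_self [symmetric] ip_sum_right
    by (simp add: onf_coeff [OF assms] mult.commute flip: complex_norm_square)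
  then show ?thesis by (simp only: of_real_eq_iff)
qed

lemma onf_nsq_1: "onf d I u \<Longrightarrow> i \<in> I \<Longrightarrow> nsq d (u i) = 1"
  using ip_self [of d "u i"] by (auto simp: onf_def)

lemma onf_subset: "onf d I u \<Longrightarrow> J \<subseteq> I \<Longrightarrow> onf d J u"
  unfolding onf_def by blast

lemma onf_reindex: "onf d I u \<Longrightarrow> inj_on h J \<Longrightarrow> h ` J \<subseteq> I \<Longrightarrow> onf d J (\<lambda>j. u (h j))"
  unfolding onf_def by (metis image_subset_iff inj_onD)

lemma residual_orth:
  assumes "onf d I u" "finite I" "j \<in> I"
  shows "ip d (\<lambda>k. f k - (\<Sum>i\<in>I. ip d f (u i) * u i k)) (u j) = 0"
  by (simp add: ip_diff_left onf_coeff [OF assms])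

text \<open>The residual is orthogonal to the projection, so its square norm is its inner product
  with \<open>f\<close> itself. Nonnegativity gives Bessel's inequality; the case of a unit vector
  drives extension and completeness.\<close>

lemma residual_nsq:
  assumes "onf d I u" "finite I"
  shows "nsq d (\<lambda>k. f k - (\<Sum>i\<in>I. ip d f (u i) * u i k)) = nsq d f - (\<Sum>i\<in>I. (cmod (ip d f (u i)))\<^sup>2)"
    (is "nsq d ?g = _")
proof -
  have "complex_of_real (nsq d ?g) = ip d ?g f - ip d ?g (\<lambda>k. \<Sum>i\<in>I. ip d f (u i) * u i k)"
    by (simp only: ip_self [symmetric] ip_diff_right)
  also have "\<dots> = ip d ?g f"
    by (simp add: ip_sum_right residual_orth [OF assms])
  also have "\<dots> = ip d f f - (\<Sum>i\<in>I. ip d f (u i) * cnj (ip d f (u i)))"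
    by (simp add: ip_diff_left ip_sum_left cnj_ip)
  also have "\<dots> = of_real (nsq d f - (\<Sum>i\<in>I. (cmod (ip d f (u i)))\<^sup>2))"
    by (simp add: ip_self flip: complex_norm_square)
  finally show ?thesis by (simp only: of_real_eq_iff)
qed

lemma bessel:
  assumes "onf d I u" "finite I"
  shows "(\<Sum>i\<in>I. (cmod (ip d f (u i)))\<^sup>2) \<le> nsq d f"
  using residual_nsq [OF assms, of f] nsq_nonneg [of d "\<lambda>k. f k - (\<Sum>i\<in>I. ip d f (u i) * u i k)"]
  by linarith

definition unit_fun :: "nat \<Rightarrow> nat \<Rightarrow> complex" where
  "unit_fun m k = (if k = m then 1 else 0)"

lemma ip_unit_fun: "m < d \<Longrightarrow> ip d (unit_fun m) g = cnj (g m)"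
  by (simp add: ip_def unit_fun_def if_distrib [of "\<lambda>x. x * _"] cong: if_cong)

lemma nsq_unit_fun: "m < d \<Longrightarrow> nsq d (unit_fun m) = 1"
  using ip_self [of d "unit_fun m"] ip_unit_fun [of m d "unit_fun m"] by (simp add: unit_fun_def)

lemma onf_unit_fun: "J \<subseteq> {..<d} \<Longrightarrow> onf d J unit_fun"
  by (auto simp: onf_def ip_unit_fun subset_iff) (auto simp: unit_fun_def)

text \<open>In the array of the squared moduli of \<open>u i m\<close> each coordinate contributes
  at most 1 by Bessel, and each vector exactly 1. Counting the total both ways replaces arguments
  about spans: it bounds the size of a family, finds room for a further vector, and forces equality
  for a full family.\<close>

lemma onf_coord_le:
  assumes "onf d I u" "finite I" "m < d"
  shows "(\<Sum>i\<in>I. (cmod (u i m))\<^sup>2) \<le> 1"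
  using bessel [OF assms(1,2), of "unit_fun m"] assms(3) by (simp add: ip_unit_fun nsq_unit_fun)

lemma onf_coord_sum:
  assumes "onf d I u" "finite I"
  shows "(\<Sum>m<d. \<Sum>i\<in>I. (cmod (u i m))\<^sup>2) = card I"
proof -
  have "(\<Sum>m<d. \<Sum>i\<in>I. (cmod (u i m))\<^sup>2) = (\<Sum>i\<in>I. nsq d (u i))"
    unfolding nsq_def by (rule sum.swap)
  then show ?thesis by (simp add: onf_nsq_1 [OF assms(1)])
qed

lemma onf_card_le:
  assumes "onf d I u" "finite I"
  shows "card I \<le> d"
proof -
  have "real (card I) \<le> (\<Sum>m<d. 1)"
    unfolding onf_coord_sum [OF assms, symmetric] using onf_coord_le [OF assms] by (intro sum_mono) auto
  then show ?thesis by simp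
qed

text \<open>If every coordinate sum were 1, the count would give \<open>d\<close> vectors instead of
  \<open>n < d\<close>. So some unit vector has a nonzero residual, which is normalised.\<close>

lemma onf_extend_one:
  assumes u: "onf d {..<n} u" and n: "n < d"
  shows "\<exists>w. onf d {..<Suc n} (u(n := w))"
proof -
  have "\<exists>m<d. (\<Sum>i<n. (cmod (u i m))\<^sup>2) < 1"
  proof (rule ccontr)
    assume "\<not> ?thesis"
    then have "(\<Sum>m<d. (1::real)) \<le> (\<Sum>m<d. \<Sum>i<n. (cmod (u i m))\<^sup>2)"
      by (intro sum_mono) (meson lessThan_iff not_less)
    then show False using onf_coord_sum [OF u] n by simp
  qed
  then obtain m where m: "m < d" "(\<Sum>i<n. (cmod (u i m))\<^sup>2) < 1" by blast
  define g where "g k = unit_fun m k - (\<Sum>i<n. ip d (unit_fun m) (u i) * u i k)" for k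
  define c where "c = 1 / sqrt (nsq d g)"
  have pos: "nsq d g > 0"
    unfolding g_def residual_nsq [OF u finite_lessThan] using m by (simp add: ip_unit_fun nsq_unit_fun)
  have orth: "ip d g (u j) = 0" if "j < n" for j
    unfolding g_def using residual_orth [OF u finite_lessThan] that by blast
  have orth': "ip d (u j) g = 0" if "j < n" for j
    using orth [OF that] cnj_ip [of d g "u j"] by simp
  define w where "w = (\<lambda>k. of_real c * g k)"
  have "ip d w w = of_real (c * c * nsq d g)"
    unfolding w_def by (simp add: ip_scale ip_self)
  also have "c * c * nsq d g = 1" using pos by (simp add: c_def)
  finally have ww: "ip d w w = 1" by simp
  have wu: "ip d w (u j) = 0" if "j < n" for j
    using ip_scale [of d "of_real c" g 1 "u j"] orth [OF that] by (simp add: w_def)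
  have uw: "ip d (u j) w = 0" if "j < n" for j
    using wu [OF that] cnj_ip [of d w "u j"] by simp
  have "onf d {..<Suc n} (u(n := w))"
    using u by (auto simp: onf_def less_Suc_eq ww wu uw)
  then show ?thesis by blast
qed

lemma onf_extend:
  assumes "onf d {..<n} u"
  shows "\<exists>u'. onf d {..<d} u' \<and> (\<forall>i<n. u' i = u i)"
  using assms
proof (induction "d - n" arbitrary: n u)
  case 0
  have "n \<le> d" using onf_card_le [OF 0(2)] by simp
  with 0 show ?case by auto
next
  case (Suc x)
  then have "n < d" by simp
  from onf_extend_one [OF Suc(3) this] obtain w where w: "onf d {..<Suc n} (u(n := w))" by blast
  from Suc(1) [OF _ w] Suc(2) obtain u' where
    u': "onf d {..<d} u'" "\<forall>i<Suc n. u' i = (u(n := w)) i" by fastforce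
  then have "\<forall>i<n. u' i = u i" by auto
  with u' show ?case by blast
qed

text \<open>A family of \<open>d\<close> vectors leaves no slack in the count, so every coordinate
  sum is 1 and every unit vector has residual zero.\<close>

lemma onf_complete:
  assumes u: "onf d I u" "finite I" and card: "card I = d" and m: "m < d" "k < d"
  shows "(\<Sum>i\<in>I. cnj (u i m) * u i k) = (if k = m then 1 else 0)"
proof -
  have "(\<Sum>m<d. 1 - (\<Sum>i\<in>I. (cmod (u i m))\<^sup>2)) = 0"
    by (simp add: sum_subtractf onf_coord_sum [OF u] card)
  then have "1 - (\<Sum>i\<in>I. (cmod (u i m))\<^sup>2) = 0"
    using m(1) onf_coord_le [OF u] by (subst (asm) sum_nonneg_eq_0_iff) auto
  then have "nsq d (\<lambda>k. unit_fun m k - (\<Sum>i\<in>I. ip d (unit_fun m) (u i) * u i k)) = 0"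
    unfolding residual_nsq [OF u] using m by (simp add: ip_unit_fun nsq_unit_fun)
  from nsq_eq_0_D [OF this m(2)] show ?thesis using m
    by (simp add: ip_unit_fun unit_fun_def split: if_splits)
qed

lemma onf_expansion:
  assumes u: "onf d I u" "finite I" and card: "card I = d" and m: "m < d"
  shows "f m = (\<Sum>i\<in>I. ip d f (u i) * u i m)"
proof -
  have "(\<Sum>i\<in>I. ip d f (u i) * u i m) = (\<Sum>i\<in>I. \<Sum>k<d. f k * (cnj (u i k) * u i m))"
    by (simp add: ip_def sum_distrib_right mult.assoc)
  also have "\<dots> = (\<Sum>k<d. \<Sum>i\<in>I. f k * (cnj (u i k) * u i m))"
    by (rule sum.swap)
  also have "\<dots> = (\<Sum>k<d. f k * (if m = k then 1 else 0))"
    using onf_complete [OF u card _ m] by (simp flip: sum_distrib_left)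
  also have "\<dots> = f m" using m by (simp add: if_distrib [of "\<lambda>x. _ * x"] cong: if_cong)
  finally show ?thesis by simp
qed

text \<open>Provides the vectors from which Nielsen's protocol builds the operators that complete an
  instrument: they are orthogonal to all \<open>u i\<close>, and the resolution of the identity is
  written entrywise, as completeness of an instrument demands.\<close>

lemma onf_complement:
  assumes u: "onf d I u" "finite I"
  shows "\<exists>(n::nat) c. (\<forall>i\<in>I. \<forall>j<n. ip d (u i) (c j) = 0) \<and> (\<forall>m<d. \<forall>k<d.
    (\<Sum>i\<in>I. cnj (u i m) * u i k) + (\<Sum>j<n. cnj (c j m) * c j k) = (if k = m then 1 else 0))"
proof -
  obtain h where h: "bij_betw h {..<card I} I"
    using ex_bij_betw_nat_finite [OF u(2)] by (auto simp: atLeast0LessThan)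
  have 1: "onf d {..<card I} (\<lambda>j. u (h j))"
    using onf_reindex [OF u(1), of h "{..<card I}"] h by (auto simp: bij_betw_def)
  obtain u' where u': "onf d {..<d} u'" "\<And>i. i < card I \<Longrightarrow> u' i = u (h i)"
    using onf_extend [OF 1] by blast
  have le: "card I \<le> d" by (rule onf_card_le [OF u])
  define c where "c j = u' (card I + j)" for j
  show ?thesis
  proof (intro exI [of _ "d - card I"] exI [of _ c] conjI ballI allI impI)
    show "ip d (u i) (c j) = 0" if "i \<in> I" "j < d - card I" for i j
    proof -
      have "i \<in> h ` {..<card I}" using h that(1) by (simp add: bij_betw_def)
      then obtain i' where i': "i' < card I" "i = h i'" by blast
      have "ip d (u' i') (u' (card I + j)) = 0" using u'(1) i'(1) that(2) le by (auto simp: onf_def)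
      then show ?thesis by (simp add: c_def i' u'(2))
    qed
    show "(\<Sum>i\<in>I. cnj (u i m) * u i k) + (\<Sum>j<d - card I. cnj (c j m) * c j k) = (if k = m then 1 else 0)"
      if "m < d" "k < d" for m k
    proof -
      have "(\<Sum>i\<in>I. cnj (u i m) * u i k) = (\<Sum>i<card I. cnj (u' i m) * u' i k)"
        by (subst sum.reindex_bij_betw [OF h, symmetric]) (simp add: u'(2))
      moreover have "(\<Sum>j<d - card I. cnj (c j m) * c j k) = (\<Sum>i\<in>{card I..<d}. cnj (u' i m) * u' i k)"
        unfolding c_def
        by (rule sum.reindex_bij_witness [of _ "\<lambda>i. i - card I" "\<lambda>j. card I + j"]) (use le in auto)
      moreover have "{..<d} = {..<card I} \<union> {card I..<d}" using le by auto
      moreover have "{..<card I} \<inter> {card I..<d} = {}" by auto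
      ultimately have "(\<Sum>i\<in>I. cnj (u i m) * u i k) + (\<Sum>j<d - card I. cnj (c j m) * c j k)
          = (\<Sum>i<d. cnj (u' i m) * u' i k)"
        by (simp add: sum.union_disjoint)
      then show ?thesis using onf_complete [OF u'(1) _ _ that] by simp
    qed
  qed
qed

section \<open>Spectral theorem for Hermitian matrices\<close>

definition app :: "nat \<Rightarrow> (nat \<Rightarrow> nat \<Rightarrow> complex) \<Rightarrow> (nat \<Rightarrow> complex) \<Rightarrow> nat \<Rightarrow> complex" where
  "app d H f k = (\<Sum>l<d. H k l * f l)"

lemma ip_app_hermitian:
  assumes "\<And>i j. i < d \<Longrightarrow> j < d \<Longrightarrow> H i j = cnj (H j i)"
  shows "ip d (app d H f) g = ip d f (app d H g)"
proof -
  have "ip d (app d H f) g = (\<Sum>k<d. \<Sum>l<d. H k l * f l * cnj (g k))"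
    by (simp add: ip_def app_def sum_distrib_right)
  also have "\<dots> = (\<Sum>l<d. \<Sum>k<d. H k l * f l * cnj (g k))" by (rule sum.swap)
  also have "\<dots> = (\<Sum>l<d. \<Sum>k<d. f l * cnj (H l k * g k))"
  proof (intro sum.cong refl)
    fix k l assume "k \<in> {..<d}" "l \<in> {..<d}"
    then show "H k l * f l * cnj (g k) = f l * cnj (H l k * g k)"
      using assms [of k l] by simp
  qed
  finally show ?thesis by (simp add: ip_def app_def sum_distrib_left)
qed

lemma app_sum: "app d H (\<lambda>k. \<Sum>i\<in>I. c i * u i k) k = (\<Sum>i\<in>I. c i * app d H (u i) k)"
proof -
  have "app d H (\<lambda>k. \<Sum>i\<in>I. c i * u i k) k = (\<Sum>l<d. \<Sum>i\<in>I. c i * (H k l * u i l))"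
    by (simp add: app_def sum_distrib_left mult_ac)
  also have "\<dots> = (\<Sum>i\<in>I. \<Sum>l<d. c i * (H k l * u i l))" by (rule sum.swap)
  finally show ?thesis by (simp add: app_def sum_distrib_left)
qed

text \<open>Induction on the dimension. A complex matrix has an eigenvector \<open>e\<close>; it is
  completed to an orthonormal basis \<open>f\<close>, and the compression \<open>H'\<close> of
  \<open>H\<close> to the remaining basis vectors is Hermitian again. Its eigenvectors lift along
  these basis vectors to eigenvectors of \<open>H\<close>, because \<open>H\<close> maps the
  complement of \<open>e\<close> into itself.\<close>

theorem hermitian_spectral:
  assumes "\<And>i j. i < d \<Longrightarrow> j < d \<Longrightarrow> H i j = cnj (H j i)"
  shows "\<exists>u lam. onf d {..<d} u \<and>
    (\<forall>i<d. \<forall>k<d. app d H (u i) k = of_real (lam i) * u i k)"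
  using assms
proof (induction d arbitrary: H)
  case 0
  then show ?case by (simp add: onf_def)
next
  case (Suc d)
  let ?n = "Suc d"
  define A where "A = mat ?n ?n (\<lambda>(i, j). H i j)"
  have A: "A \<in> carrier_mat ?n ?n" by (simp add: A_def)
  obtain c v where "eigenvector A v c"
    using spectrum_non_empty [OF A] by (auto simp: spectrum_def eigenvalue_def)
  then have v: "v \<in> carrier_vec ?n" "v \<noteq> 0\<^sub>v ?n" "A *\<^sub>v v = c \<cdot>\<^sub>v v"
    using A by (auto simp: eigenvector_def)
  have v_eig: "app ?n H (\<lambda>k. v $ k) k = c * v $ k" if k: "k < ?n" for k
  proof -
    have "(A *\<^sub>v v) $ k = app ?n H (\<lambda>k. v $ k) k"
      using k v(1) by (auto simp: A_def app_def scalar_prod_def atLeast0LessThan intro!: sum.cong)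
    then show ?thesis using v k by simp
  qed
  have "nsq ?n (\<lambda>k. v $ k) \<noteq> 0"
  proof
    assume "nsq ?n (\<lambda>k. v $ k) = 0"
    then have "v = 0\<^sub>v ?n" using nsq_eq_0_D [of ?n "\<lambda>k. v $ k"] v(1) by (intro eq_vecI) auto
    with v show False by simp
  qed
  then have pos: "nsq ?n (\<lambda>k. v $ k) > 0" using nsq_nonneg [of ?n "\<lambda>k. v $ k"] by linarith
  define r where "r = complex_of_real (1 / sqrt (nsq ?n (\<lambda>k. v $ k)))"
  define e where "e k = r * v $ k" for k
  have "nsq ?n e = (cmod r)\<^sup>2 * nsq ?n (\<lambda>k. v $ k)" unfolding e_def by (rule nsq_scale)
  also have "\<dots> = 1" using pos by (simp add: r_def norm_divide power_divide)
  finally have ee: "ip ?n e e = 1" by (simp add: ip_self)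
  have e_eig: "app ?n H e k = c * e k" if "k < ?n" for k
  proof -
    have "app ?n H e k = r * app ?n H (\<lambda>k. v $ k) k"
      by (simp add: app_def e_def sum_distrib_left mult_ac del: sum.lessThan_Suc)
    then show ?thesis using v_eig [OF that] by (simp add: e_def)
  qed
  \<comment> \<open>The quadratic form of a Hermitian matrix is real, so the eigenvalue equals its
    conjugate.\<close>
  have "c = ip ?n (app ?n H e) e"
    using ip_cong [of ?n "app ?n H e" "\<lambda>k. c * e k" e "\<lambda>k. 1 * e k"] e_eig ip_scale [of ?n c e 1 e] ee by simp
  also have "\<dots> = ip ?n e (app ?n H e)" by (rule ip_app_hermitian [OF Suc.prems])
  also have "\<dots> = cnj (ip ?n (app ?n H e) e)" by (simp add: cnj_ip)
  also have "\<dots> = cnj c"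
    using ip_cong [of ?n "app ?n H e" "\<lambda>k. c * e k" e "\<lambda>k. 1 * e k"] e_eig ip_scale [of ?n c e 1 e] ee by simp
  finally have c_real: "c = of_real (Re c)" by (metis Reals_cnj_iff of_real_Re)
  have "onf ?n {..<Suc 0} (\<lambda>_. e)" using ee by (simp add: onf_def)
  from onf_extend [OF this] obtain f where f: "onf ?n {..<?n} f" "f 0 = e" by auto
  define H' where "H' i j = ip ?n (app ?n H (f (Suc j))) (f (Suc i))" for i j
  have "H' i j = cnj (H' j i)" for i j
    unfolding H'_def cnj_ip by (rule ip_app_hermitian [OF Suc.prems])
  from Suc.IH [OF this]
  obtain w where "\<exists>lam. onf d {..<d} w \<and>
      (\<forall>i<d. \<forall>k<d. app d H' (w i) k = of_real (lam i) * w i k)" ..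
  then obtain lam where wl: "onf d {..<d} w \<and>
      (\<forall>i<d. \<forall>k<d. app d H' (w i) k = of_real (lam i) * w i k)" ..
  then have w: "onf d {..<d} w" "\<And>i k. i < d \<Longrightarrow> k < d \<Longrightarrow> app d H' (w i) k = of_real (lam i) * w i k"
    by simp_all
  define y where "y i k = (\<Sum>j<d. w i j * f (Suc j) k)" for i k
  have fS: "onf ?n {..<d} (\<lambda>j. f (Suc j))"
    by (rule onf_reindex [OF f(1)]) auto
  have f0: "ip ?n (f (Suc j)) (f 0) = 0" if "j < d" for j
    using f(1) that by (auto simp: onf_def)
  have ye: "ip ?n (y i) e = 0" for i
    unfolding y_def ip_sum_left using f0 f(2) by simp
  have ey: "ip ?n e (y i) = 0" for i using ye [of i] cnj_ip [of ?n "y i" e] by simp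
  have yy: "ip ?n (y i) (y j) = ip d (w i) (w j)" for i j
  proof -
    have "ip ?n (y i) (y j) = (\<Sum>k<d. cnj (w j k) * ip ?n (y i) (f (Suc k)))"
      unfolding y_def [of j, abs_def] by (rule ip_sum_right)
    also have "\<dots> = (\<Sum>k<d. cnj (w j k) * w i k)"
      unfolding y_def using onf_coeff [OF fS] by simp
    finally show ?thesis by (simp add: ip_def mult.commute)
  qed
  have y_eig: "app ?n H (y i) k = of_real (lam i) * y i k" if i: "i < d" and k: "k < ?n" for i k
  proof -
    \<comment> \<open>No component along \<open>e\<close> can arise, since moving \<open>H\<close>
      to the other side only rescales \<open>e\<close>. Hence the compression loses nothing.\<close>
    have 0: "ip ?n (app ?n H (y i)) (f 0) = 0"
    proof -
      have "ip ?n (app ?n H (y i)) e = ip ?n (y i) (app ?n H e)"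
        by (rule ip_app_hermitian [OF Suc.prems])
      also have "\<dots> = cnj c * ip ?n (y i) e"
        using ip_cong [of ?n "y i" "\<lambda>k. 1 * y i k" "app ?n H e" "\<lambda>k. c * e k"] e_eig
          ip_scale [of ?n 1 "y i" c e] by simp
      finally show ?thesis by (simp add: ye f(2))
    qed
    have S: "ip ?n (app ?n H (y i)) (f (Suc m)) = of_real (lam i) * w i m" if m: "m < d" for m
    proof -
      have "app ?n H (y i) = (\<lambda>k. \<Sum>j<d. w i j * app ?n H (f (Suc j)) k)"
        unfolding y_def by (intro ext) (rule app_sum)
      then have "ip ?n (app ?n H (y i)) (f (Suc m)) = (\<Sum>j<d. w i j * H' m j)"
        by (simp add: ip_sum_left H'_def)
      also have "\<dots> = app d H' (w i) m" by (simp add: app_def mult.commute)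
      finally show ?thesis using w(2) i m by simp
    qed
    have "app ?n H (y i) k = (\<Sum>m<?n. ip ?n (app ?n H (y i)) (f m) * f m k)"
      by (rule onf_expansion [OF f(1)]) (use k in auto)
    also have "\<dots> = (\<Sum>m<d. ip ?n (app ?n H (y i)) (f (Suc m)) * f (Suc m) k)"
      using 0 by (subst sum.lessThan_Suc_shift) simp
    also have "\<dots> = of_real (lam i) * y i k"
      by (simp add: S y_def sum_distrib_left mult.assoc)
    finally show ?thesis .
  qed
  define u where "u i = (case i of 0 \<Rightarrow> e | Suc i \<Rightarrow> y i)" for i
  define mu where "mu i = (case i of 0 \<Rightarrow> Re c | Suc i \<Rightarrow> lam i)" for i
  have "onf ?n {..<?n} u"
    using w(1) ee ye ey yy by (auto simp: onf_def u_def split: nat.splits)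
  moreover have "app ?n H (u i) k = of_real (mu i) * u i k" if "i < ?n" "k < ?n" for i k
    using e_eig [OF that(2)] y_eig [OF _ that(2)] that c_real by (cases i) (auto simp: u_def mu_def)
  ultimately show ?case by blast
qed

section \<open>Majorization\<close>

text \<open>Weights in the unit interval of total at most \<open>n\<close> do best on the
  \<open>n\<close> largest values. Measured against the threshold \<open>p n\<close>, a term before
  \<open>n\<close> gains most at weight 1, and a term from \<open>n\<close> on is never
  positive.\<close>

lemma decreasing_weighted_sum_le:
  fixes p c :: "nat \<Rightarrow> real"
  assumes dec: "antimono p" and nonneg: "\<And>i. 0 \<le> p i"
    and c: "\<And>i. i < m \<Longrightarrow> 0 \<le> c i" "\<And>i. i < m \<Longrightarrow> c i \<le> 1" and le: "(\<Sum>i<m. c i) \<le> real n"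
  shows "(\<Sum>i<m. p i * c i) \<le> (\<Sum>i<n. p i)"
proof -
  have "(p i - p n) * c i \<le> (if i < n then p i - p n else 0)" if i: "i < m" for i
  proof (cases "i < n")
    case True
    then have "0 \<le> p i - p n" using antimonoD [OF dec, of i n] by simp
    then show ?thesis using True mult_left_le [OF c(2) [OF i]] by simp
  next
    case False
    then have "p i - p n \<le> 0" using antimonoD [OF dec, of n i] by simp
    then show ?thesis using False mult_nonpos_nonneg [OF _ c(1) [OF i]] by simp
  qed
  then have "(\<Sum>i<m. (p i - p n) * c i) \<le> (\<Sum>i<m. if i < n then p i - p n else 0)"
    by (intro sum_mono) simp
  also have "\<dots> = (\<Sum>i\<in>{..<m} \<inter> {..<n}. p i - p n)"
    by (subst sum.inter_restrict) (simp_all add: lessThan_iff)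
  also have "\<dots> \<le> (\<Sum>i<n. p i - p n)"
    using antimonoD [OF dec] by (intro sum_mono2) auto
  finally have 1: "(\<Sum>i<m. (p i - p n) * c i) \<le> (\<Sum>i<n. p i) - n * p n"
    by (simp add: sum_subtractf)
  have "(\<Sum>i<m. p i * c i) = (\<Sum>i<m. (p i - p n) * c i) + p n * (\<Sum>i<m. c i)"
    by (simp add: algebra_simps sum_subtractf sum_distrib_left)
  also have "\<dots> \<le> (\<Sum>i<m. (p i - p n) * c i) + p n * n"
    using le nonneg by (intro add_left_mono mult_left_mono) auto
  finally show ?thesis using 1 by (simp add: mult.commute)
qed

text \<open>Summation by parts: the induction carries a stronger lower bound, namely
  \<open>t n\<close> times the partial sum of \<open>h\<close>.\<close>

lemma abel_sum_nonneg:
  fixes t h :: "nat \<Rightarrow> real"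
  assumes dec: "antimono t" and nonneg: "\<And>i. 0 \<le> t i" and h: "\<And>l. 0 \<le> (\<Sum>j<l. h j)"
  shows "0 \<le> (\<Sum>j<n. t j * h j)"
proof -
  have "t n * (\<Sum>j<n. h j) \<le> (\<Sum>j<n. t j * h j)"
  proof (induction n)
    case (Suc n)
    have "t (Suc n) * (\<Sum>j<Suc n. h j) \<le> t n * (\<Sum>j<Suc n. h j)"
      using antimonoD [OF dec, of n "Suc n"] h [of "Suc n"] by (intro mult_right_mono) auto
    also have "\<dots> \<le> (\<Sum>j<Suc n. t j * h j)" using Suc by (simp add: algebra_simps)
    finally show ?case .
  qed simp
  moreover have "0 \<le> t n * (\<Sum>j<n. h j)" using nonneg h by simp
  ultimately show ?thesis by linarith
qed

text \<open>Merges the branches of a protocol: with \<open>t\<close> running over branches, the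
  squared overlaps together stay below the squared fidelity of the averaged distribution. After
  expanding the squares this is the inequality of Cauchy and Schwarz for each pair \<open>i\<close>,
  \<open>j\<close>.\<close>

lemma sum_square_sum_sqrt_le:
  fixes x :: "'t \<Rightarrow> 'i \<Rightarrow> real"
  assumes T: "finite T" and x: "\<And>t i. t \<in> T \<Longrightarrow> i \<in> I \<Longrightarrow> 0 \<le> x t i"
  shows "(\<Sum>t\<in>T. (\<Sum>i\<in>I. sqrt (x t i))\<^sup>2) \<le> (\<Sum>i\<in>I. sqrt (\<Sum>t\<in>T. x t i))\<^sup>2"
proof -
  have cs: "(\<Sum>t\<in>T. sqrt (x t i) * sqrt (x t j)) \<le> sqrt (\<Sum>t\<in>T. x t i) * sqrt (\<Sum>t\<in>T. x t j)"
    if "i \<in> I" "j \<in> I" for i j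
  proof -
    have "(\<Sum>t\<in>T. sqrt (x t i) * sqrt (x t j))\<^sup>2
        \<le> (\<Sum>t\<in>T. (sqrt (x t i))\<^sup>2) * (\<Sum>t\<in>T. (sqrt (x t j))\<^sup>2)"
      by (rule Cauchy_Schwarz_ineq_sum)
    also have "\<dots> = (\<Sum>t\<in>T. x t i) * (\<Sum>t\<in>T. x t j)" using x that by simp
    finally show ?thesis unfolding real_sqrt_mult [symmetric] by (rule real_le_rsqrt)
  qed
  have "(\<Sum>t\<in>T. (\<Sum>i\<in>I. sqrt (x t i))\<^sup>2) = (\<Sum>t\<in>T. \<Sum>i\<in>I. \<Sum>j\<in>I. sqrt (x t i) * sqrt (x t j))"
    by (simp add: power2_eq_square sum_product)
  also have "\<dots> = (\<Sum>i\<in>I. \<Sum>j\<in>I. \<Sum>t\<in>T. sqrt (x t i) * sqrt (x t j))"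
    by (simp only: sum.swap [of _ _ T])
  also have "\<dots> \<le> (\<Sum>i\<in>I. \<Sum>j\<in>I. sqrt (\<Sum>t\<in>T. x t i) * sqrt (\<Sum>t\<in>T. x t j))"
    by (intro sum_mono cs)
  finally show ?thesis by (simp add: power2_eq_square sum_product)
qed

lemma decreasing_enumeration:
  fixes f :: "'a \<Rightarrow> real"
  assumes "finite J"
  obtains h where "bij_betw h {..<card J} J"
    "\<And>i j. i \<le> j \<Longrightarrow> j < card J \<Longrightarrow> f (h j) \<le> f (h i)"
proof -
  obtain xs0 where xs0: "set xs0 = J" "distinct xs0" using finite_distinct_list [OF assms] by blast
  define xs where "xs = sort_key (\<lambda>x. - f x) xs0"
  have xs: "set xs = J" "distinct xs" "length xs = card J"
    using xs0 distinct_card [of xs0] by (auto simp: xs_def)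
  have "sorted (map (\<lambda>x. - f x) xs)" by (simp add: xs_def)
  then have "f (xs ! j) \<le> f (xs ! i)" if "i \<le> j" "j < card J" for i j
    using that xs sorted_nth_mono [of "map (\<lambda>x. - f x) xs" i j] by simp
  moreover have "bij_betw ((!) xs) {..<card J} J"
    by (rule bij_betw_nth) (use xs in auto)
  ultimately show ?thesis using that by blast
qed

lemma ex_pmf_finite:
  assumes A: "finite A" and f: "\<And>a. a \<in> A \<Longrightarrow> 0 \<le> f a" "(\<Sum>a\<in>A. f a) = 1"
  obtains p where "set_pmf p \<subseteq> A" "\<And>a. a \<in> A \<Longrightarrow> pmf p a = f a"
proof -
  define g where "g a = (if a \<in> A then f a else 0)" for a
  have g: "0 \<le> g a" for a using f by (simp add: g_def)
  have "(\<integral>\<^sup>+ x. ennreal (g x) \<partial>count_space UNIV) = (\<Sum>a\<in>A. ennreal (g a))"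
    by (rule nn_integral_count_space') (use A in \<open>auto simp: g_def\<close>)
  also have "\<dots> = ennreal (\<Sum>a\<in>A. g a)" using g by (intro sum_ennreal) auto
  also have "(\<Sum>a\<in>A. g a) = 1" using f by (simp add: g_def)
  finally have "pmf (embed_pmf g) a = g a" for a using g by (intro pmf_embed_pmf) auto
  then show ?thesis by (intro that [of "embed_pmf g"]) (auto simp: g_def set_pmf_eq split: if_splits)
qed

text \<open>
  The theorem of Hardy, Littlewood and Polya. One transposition moves the amount \<open>\<delta>\<close> between
  neighbouring places of disagreement of opposite sign and settles at least one of them.
\<close>

lemma majorization_imp_convex_permutations:
  fixes p q :: "nat \<Rightarrow> real"
  assumes dec_p: "\<And>i j. i \<le> j \<Longrightarrow> j < R \<Longrightarrow> p j \<le> p i"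
    and "\<And>i j. i \<le> j \<Longrightarrow> j < R \<Longrightarrow> q j \<le> q i"
    and "\<And>l. l \<le> R \<Longrightarrow> (\<Sum>i<l. p i) \<le> (\<Sum>i<l. q i)" and "(\<Sum>i<R. p i) = (\<Sum>i<R. q i)"
  shows "\<exists>w. (\<forall>\<pi>. 0 \<le> w \<pi>) \<and> (\<Sum>\<pi> | \<pi> permutes {..<R}. w \<pi>) = 1 \<and>
    (\<forall>i<R. p i = (\<Sum>\<pi> | \<pi> permutes {..<R}. w \<pi> * q (\<pi> i)))"
  using assms(2-)
proof (induction "card {i. i < R \<and> p i \<noteq> q i}" arbitrary: q rule: less_induct)
  case less
  note dec_q = less.prems(1) and maj = less.prems(2) and total = less.prems(3)
  have fin: "finite {\<pi>. \<pi> permutes {..<R}}" by (simp add: finite_permutations)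
  show ?case
  proof (cases "\<forall>i<R. p i \<le> q i")
    case True
    \<comment> \<open>A pointwise inequality with equal totals is an equality, so the identity
      permutation alone serves.\<close>
    have "(\<Sum>i<R. q i - p i) = 0" using total by (simp add: sum_subtractf)
    then have eq: "p i = q i" if "i < R" for i
      using that True by (subst (asm) sum_nonneg_eq_0_iff) auto
    define w where "w \<pi> = (if \<pi> = id then 1 else 0 :: real)" for \<pi> :: "nat \<Rightarrow> nat"
    have "(\<Sum>\<pi> | \<pi> permutes {..<R}. w \<pi>) = 1"
      using fin by (simp add: w_def permutes_id)
    moreover have "(\<Sum>\<pi> | \<pi> permutes {..<R}. w \<pi> * q (\<pi> i)) = q i" for i
      using fin by (simp add: w_def permutes_id if_distrib [of "\<lambda>x. x * _"] cong: if_cong)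
    ultimately show ?thesis using eq by (intro exI [of _ w]) (auto simp: w_def)
  next
    case False
    \<comment> \<open>\<open>j\<close> is the first place where \<open>q\<close> falls short of
      \<open>p\<close>, and \<open>i\<close> below is the last place before \<open>j\<close> where
      it exceeds \<open>p\<close>. Strictly between them the two agree.\<close>
    define j where "j = (LEAST j. j < R \<and> q j < p j)"
    have j: "j < R" "q j < p j"
      using False LeastI_ex [of "\<lambda>j. j < R \<and> q j < p j"] by (auto simp: j_def not_le)
    have before_j: "p k \<le> q k" if "k < j" for k
      using not_less_Least [of k "\<lambda>j. j < R \<and> q j < p j"] that j(1) by (auto simp: j_def)
    have "\<exists>i<j. p i < q i"
    proof (rule ccontr)
      assume "\<not> ?thesis"
      then have "(\<Sum>i<j. q i) \<le> (\<Sum>i<j. p i)" by (intro sum_mono) (meson lessThan_iff not_less)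
      then show False using maj [of "Suc j"] j by simp
    qed
    define i where "i = Max {i. i < j \<and> p i < q i}"
    have "i \<in> {i. i < j \<and> p i < q i}" unfolding i_def
      by (rule Max_in) (use \<open>\<exists>i<j. p i < q i\<close> in auto)
    then have i: "i < j" "p i < q i" by auto
    have after_i: "q k \<le> p k" if "i < k" "k < j" for k
    proof (rule ccontr)
      assume "\<not> q k \<le> p k"
      then have "k \<le> i" unfolding i_def using that by (intro Max_ge) auto
      with that show False by simp
    qed
    have between: "q k = p k" if "i < k" "k < j" for k
      using after_i before_j that by (simp add: order_antisym)
    \<comment> \<open>The largest amount that can move from \<open>i\<close> to \<open>j\<close>
      without overshooting \<open>p\<close> at either place.\<close>
    define \<delta> where "\<delta> = min (q i - p i) (p j - q j)"
    have "p j \<le> p i" using dec_p [of i j] i j by simp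
    then have gap: "\<delta> \<le> q i - q j" "0 < q i - q j" using i j by (auto simp: \<delta>_def)
    \<comment> \<open>By \<open>q j < p j \<le> p i < q i\<close> the amount is at most the distance
      of the two values, so the move is a convex mixture of \<open>q\<close> with its transposed
      copy.\<close>
    define t where "t = \<delta> / (q i - q j)"
    have t: "0 \<le> t" "t \<le> 1" "t * (q i - q j) = \<delta>" using gap i j by (auto simp: t_def \<delta>_def)
    define \<tau> where "\<tau> = Transposition.transpose i j"
    define q' where "q' y = (1 - t) * q y + t * q (\<tau> y)" for y
    have q'i: "q' i = q i - \<delta>" and q'j: "q' j = q j + \<delta>"
      using t(3) by (auto simp: q'_def \<tau>_def algebra_simps)
    have q'_other: "q' k = q k" if "k \<noteq> i" "k \<noteq> j" for k
      using that by (simp add: q'_def \<tau>_def Transposition.transpose_def algebra_simps)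
    have bounds: "p i \<le> q' i" "q' i \<le> q i" "q' j \<le> p j" "q j \<le> q' j"
      using i j by (auto simp: q'i q'j \<delta>_def)
    \<comment> \<open>The order survives: \<open>q' i\<close> and \<open>q' j\<close> have moved
      towards each other but stay on the outer sides of \<open>p i\<close> and \<open>p j\<close>,
      and between them \<open>q'\<close> equals the decreasing \<open>p\<close>.\<close>
    have dec_q': "q' b \<le> q' a" if ab: "a \<le> b" "b < R" for a b
    proof -
      have c1: ?thesis if "b \<noteq> i" "b \<noteq> j" "a \<noteq> i" "a \<noteq> j"
        using dec_q [OF ab] that by (simp add: q'_other)
      have c2: ?thesis if "a = i" "b \<noteq> i" "b \<noteq> j"
      proof (cases "b < j")
        case True
        then have "q' b = p b" using that ab between [of b] by (simp add: q'_other)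
        then show ?thesis using dec_p [OF ab] bounds that by simp
      next
        case False
        then have "q' b \<le> q j" using that ab dec_q [of j b] by (simp add: q'_other)
        then show ?thesis using \<open>p j \<le> p i\<close> bounds that by simp
      qed
      have c3: ?thesis if "a = i" "b = j" using \<open>p j \<le> p i\<close> bounds that by simp
      have c4: ?thesis if "a = j" "b \<noteq> j"
      proof -
        have "b \<noteq> i" using that ab i by simp
        then show ?thesis using that dec_q [OF ab] bounds by (simp add: q'_other)
      qed
      have c5: ?thesis if "b = i" "a \<noteq> i"
      proof -
        have "a \<noteq> j" using that ab i by simp
        then show ?thesis using that dec_q [OF ab] bounds by (simp add: q'_other)
      qed
      have c6: ?thesis if "b = j" "a \<noteq> i" "a \<noteq> j"
      proof (cases "a < i")
        case True
        then have "q i \<le> q a" using dec_q [of a i] i j by simp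
        then show ?thesis using that \<open>p j \<le> p i\<close> bounds by (simp add: q'_other)
      next
        case False
        then have "q' a = p a" using that ab between [of a] by (simp add: q'_other)
        then show ?thesis using dec_p [OF ab] bounds that by simp
      qed
      show ?thesis using c1 c2 c3 c4 c5 c6 by (cases "a = b") auto
    qed
    have sum_q': "(\<Sum>y<l. q' y) = (\<Sum>y<l. q y) - (if i < l then \<delta> else 0) + (if j < l then \<delta> else 0)" for l
    proof -
      have "q' y = q y - (if y = i then \<delta> else 0) + (if y = j then \<delta> else 0)" for y
        using i(1) by (auto simp: q'i q'j q'_other)
      then show ?thesis by (simp add: sum.distrib sum_subtractf)
    qed
    \<comment> \<open>Only prefixes that contain \<open>i\<close> but not \<open>j\<close> lose
      \<open>\<delta>\<close>. There the places strictly between cancel, and the surplus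
      \<open>q i - p i\<close> pays for the loss.\<close>
    have maj': "(\<Sum>y<l. p y) \<le> (\<Sum>y<l. q' y)" if l: "l \<le> R" for l
    proof (cases "i < l \<and> l \<le> j")
      case True
      have "(\<Sum>y<l. q y - p y) = (\<Sum>y<Suc i. q y - p y)"
        by (rule sum.mono_neutral_right) (use True between in auto)
      also have "\<dots> = (\<Sum>y<i. q y - p y) + (q i - p i)" by simp
      also have "\<dots> \<ge> \<delta>" using maj [of i] i j by (simp add: sum_subtractf \<delta>_def)
      finally show ?thesis using True by (simp add: sum_q' sum_subtractf)
    next
      case False
      then show ?thesis using maj [OF l] i(1) by (auto simp: sum_q')
    qed
    have total': "(\<Sum>y<R. p y) = (\<Sum>y<R. q' y)" using total i j by (simp add: sum_q')
    have "{k. k < R \<and> p k \<noteq> q' k} \<subset> {k. k < R \<and> p k \<noteq> q k}"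
    proof
      show "{k. k < R \<and> p k \<noteq> q' k} \<subseteq> {k. k < R \<and> p k \<noteq> q k}"
      proof
        fix k assume "k \<in> {k. k < R \<and> p k \<noteq> q' k}"
        then show "k \<in> {k. k < R \<and> p k \<noteq> q k}"
          using i j q'_other [of k] by (cases "k = i"; cases "k = j") auto
      qed
      have "p i = q' i \<or> p j = q' j" by (auto simp: q'i q'j \<delta>_def min_def)
      then show "{k. k < R \<and> p k \<noteq> q' k} \<noteq> {k. k < R \<and> p k \<noteq> q k}"
      proof
        assume "p i = q' i"
        then have "i \<notin> {k. k < R \<and> p k \<noteq> q' k}" "i \<in> {k. k < R \<and> p k \<noteq> q k}" using i j by auto
        then show ?thesis by blast
      next
        assume "p j = q' j"
        then have "j \<notin> {k. k < R \<and> p k \<noteq> q' k}" "j \<in> {k. k < R \<and> p k \<noteq> q k}" using i j by auto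
        then show ?thesis by blast
      qed
    qed
    then have "card {k. k < R \<and> p k \<noteq> q' k} < card {k. k < R \<and> p k \<noteq> q k}"
      by (intro psubset_card_mono) auto
    from less.hyps [OF this dec_q' maj' total'] obtain w where
      "(\<forall>\<pi>. 0 \<le> w \<pi>) \<and> (\<Sum>\<pi> | \<pi> permutes {..<R}. w \<pi>) = 1 \<and>
        (\<forall>x<R. p x = (\<Sum>\<pi> | \<pi> permutes {..<R}. w \<pi> * q' (\<pi> x)))" ..
    then have w: "\<And>\<pi>. 0 \<le> w \<pi>" "(\<Sum>\<pi> | \<pi> permutes {..<R}. w \<pi>) = 1"
        "\<And>x. x < R \<Longrightarrow> p x = (\<Sum>\<pi> | \<pi> permutes {..<R}. w \<pi> * q' (\<pi> x))"
      by simp_all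
    have \<tau>_perm: "\<tau> permutes {..<R}" unfolding \<tau>_def using i j by (intro permutes_swap_id) auto
    have \<tau>\<tau>: "\<tau> \<circ> (\<tau> \<circ> \<pi>) = \<pi>" for \<pi> :: "nat \<Rightarrow> nat" by (auto simp: \<tau>_def)
    have reindex: "(\<Sum>\<pi> | \<pi> permutes {..<R}. f (\<tau> \<circ> \<pi>)) = (\<Sum>\<pi> | \<pi> permutes {..<R}. f \<pi>)"
      for f :: "(nat \<Rightarrow> nat) \<Rightarrow> real"
      by (rule sum.reindex_bij_witness [of _ "\<lambda>\<pi>. \<tau> \<circ> \<pi>" "\<lambda>\<pi>. \<tau> \<circ> \<pi>"])
        (auto simp: \<tau>\<tau> intro: permutes_compose [OF _ \<tau>_perm])
    \<comment> \<open>Applying \<open>\<tau>\<close> to the values amounts to composing each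
      permutation with \<open>\<tau>\<close>. As \<open>\<tau>\<close> is an involution, this only
      moves weights between permutations.\<close>
    define w' where "w' \<pi> = (1 - t) * w \<pi> + t * w (\<tau> \<circ> \<pi>)" for \<pi>
    have "(\<Sum>\<pi> | \<pi> permutes {..<R}. w' \<pi>) = (1 - t) * 1 + t * 1"
      unfolding w'_def sum.distrib sum_distrib_left [symmetric] reindex [of w] w(2) ..
    then have "(\<Sum>\<pi> | \<pi> permutes {..<R}. w' \<pi>) = 1" by simp
    moreover have "0 \<le> w' \<pi>" for \<pi> using w(1) t by (simp add: w'_def)
    moreover have "p x = (\<Sum>\<pi> | \<pi> permutes {..<R}. w' \<pi> * q (\<pi> x))" if x: "x < R" for x
    proof -
      have "(\<Sum>\<pi> | \<pi> permutes {..<R}. w' \<pi> * q (\<pi> x))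
          = (1 - t) * (\<Sum>\<pi> | \<pi> permutes {..<R}. w \<pi> * q (\<pi> x))
            + t * (\<Sum>\<pi> | \<pi> permutes {..<R}. w (\<tau> \<circ> \<pi>) * q (\<pi> x))"
        unfolding w'_def by (simp add: distrib_right sum.distrib sum_distrib_left mult.assoc)
      also have "(\<Sum>\<pi> | \<pi> permutes {..<R}. w (\<tau> \<circ> \<pi>) * q (\<pi> x))
          = (\<Sum>\<pi> | \<pi> permutes {..<R}. w \<pi> * q (\<tau> (\<pi> x)))"
        using reindex [of "\<lambda>\<pi>. w (\<tau> \<circ> \<pi>) * q (\<pi> x)"] by (simp add: \<tau>\<tau>)
      finally show ?thesis
        unfolding w(3) [OF x] q'_def by (simp add: distrib_left sum.distrib sum_distrib_left mult_ac)
    qed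
    ultimately show ?thesis by blast
  qed
qed

section \<open>Schmidt decompositions\<close>

text \<open>\<open>p\<close> is a total decreasing function with zeros from \<open>m\<close> on, so
  that spectra of different lengths compare by partial sums. Zeros may also occur below
  \<open>m\<close>.\<close>

definition schmidt :: "nat \<Rightarrow> nat \<Rightarrow> (nat \<Rightarrow> nat \<Rightarrow> complex) \<Rightarrow> nat \<Rightarrow> (nat \<Rightarrow> real) \<Rightarrow>
    (nat \<Rightarrow> nat \<Rightarrow> complex) \<Rightarrow> (nat \<Rightarrow> nat \<Rightarrow> complex) \<Rightarrow> bool" where
  "schmidt a b X m p u v \<longleftrightarrow> antimono p \<and> (\<forall>i. 0 \<le> p i) \<and> (\<forall>i\<ge>m. p i = 0) \<and>
     onf a {..<m} u \<and> onf b {..<m} v \<and>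
     (\<forall>k<a. \<forall>l<b. X k l = (\<Sum>i<m. of_real (sqrt (p i)) * u i k * v i l))"

lemma schmidt_transpose: "schmidt a b X m p u v \<Longrightarrow> schmidt b a (\<lambda>l k. X k l) m p v u"
  by (simp add: schmidt_def mult_ac)

text \<open>Diagonalise the Gram matrix \<open>H\<close> of the rows of \<open>X\<close>. The
  components \<open>w i\<close> of \<open>X\<close> along the eigenvectors are then mutually
  orthogonal, and their square norms are the squared Schmidt coefficients. Vanishing components are
  dropped before sorting and normalising.\<close>

lemma schmidt_exists: "\<exists>m p u v. schmidt a b X m p u v"
proof -
  define H where "H k k' = ip b (X k) (X k')" for k k'
  have "H i j = cnj (H j i)" for i j by (simp add: H_def cnj_ip)
  from hermitian_spectral [OF this]
  obtain u where "\<exists>lam. onf a {..<a} u \<and> (\<forall>i<a. \<forall>k<a. app a H (u i) k = of_real (lam i) * u i k)" ..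
  then obtain lam where
    ul: "onf a {..<a} u \<and> (\<forall>i<a. \<forall>k<a. app a H (u i) k = of_real (lam i) * u i k)" ..
  then have u: "onf a {..<a} u"
    and lam: "\<And>i k. i < a \<Longrightarrow> k < a \<Longrightarrow> app a H (u i) k = of_real (lam i) * u i k"
    by simp_all
  define w where "w i l = (\<Sum>k<a. cnj (u i k) * X k l)" for i l
  have orth: "ip b (w i) (w j) = 0" if ij: "i < a" "j < a" "i \<noteq> j" for i j
  proof -
    have "ip b (w i) (w j) = (\<Sum>k<a. cnj (u i k) * ip b (X k) (w j))"
      unfolding w_def by (rule ip_sum_left)
    also have "\<dots> = (\<Sum>k<a. cnj (u i k) * app a H (u j) k)"
      unfolding w_def [of j, abs_def] ip_sum_right by (simp add: app_def H_def mult.commute)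
    also have "\<dots> = (\<Sum>k<a. of_real (lam j) * (u j k * cnj (u i k)))"
      using ij lam by (simp add: mult_ac)
    also have "\<dots> = of_real (lam j) * ip a (u j) (u i)"
      by (simp add: ip_def sum_distrib_left)
    finally show ?thesis using u ij by (auto simp: onf_def)
  qed
  have X: "X k l = (\<Sum>i<a. u i k * w i l)" if k: "k < a" for k l
  proof -
    have "X k l = (\<Sum>i<a. ip a (\<lambda>k. X k l) (u i) * u i k)"
      by (rule onf_expansion [OF u]) (use k in auto)
    then show ?thesis by (simp add: w_def ip_def mult.commute)
  qed
  define I where "I = {i. i < a \<and> nsq b (w i) \<noteq> 0}"
  have "finite I" by (simp add: I_def)
  then obtain h where h: "bij_betw h {..<card I} I"
    and dec: "\<And>i j. i \<le> j \<Longrightarrow> j < card I \<Longrightarrow> nsq b (w (h j)) \<le> nsq b (w (h i))"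
    using decreasing_enumeration [of I "\<lambda>i. nsq b (w i)"] by blast
  have hI: "h i < a" "nsq b (w (h i)) > 0" if "i < card I" for i
    using bij_betwE [OF h] that nsq_nonneg [of b "w (h i)"] by (auto simp: I_def less_le)
  have h_inj: "h i = h j \<longleftrightarrow> i = j" if "i < card I" "j < card I" for i j
    using h that by (auto simp: bij_betw_def inj_on_def)
  define p where "p i = (if i < card I then nsq b (w (h i)) else 0)" for i
  define v where "v i l = of_real (1 / sqrt (p i)) * w (h i) l" for i l
  have "antimono p" using dec by (auto simp: antimono_def p_def)
  moreover have "onf a {..<card I} (\<lambda>i. u (h i))"
    using onf_reindex [OF u, of h "{..<card I}"] bij_betw_imp_inj_on [OF h] hI(1)
    by (simp add: image_subset_iff)
  moreover have "onf b {..<card I} v"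
    unfolding onf_def
  proof (intro ballI)
    fix i j assume ij: "i \<in> {..<card I}" "j \<in> {..<card I}"
    have "ip b (v i) (v j) = of_real (1 / sqrt (p i)) * of_real (1 / sqrt (p j)) * ip b (w (h i)) (w (h j))"
      unfolding v_def ip_scale by simp
    also have "\<dots> = (if i = j then 1 else 0)"
    proof (cases "i = j")
      case True
      have "1 / sqrt (p i) * (1 / sqrt (p i)) * p i = 1" using hI(2) [of i] ij by (simp add: p_def)
      moreover have "ip b (w (h i)) (w (h j)) = of_real (p i)" using True ij by (simp add: ip_self p_def)
      ultimately show ?thesis using True by (simp only: of_real_mult [symmetric] of_real_1 simp_thms if_True)
    next
      case False
      then show ?thesis using ij orth [of "h i" "h j"] hI h_inj [of i j] by simp
    qed
    finally show "ip b (v i) (v j) = (if i = j then 1 else 0)" .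
  qed
  moreover have "X k l = (\<Sum>i<card I. of_real (sqrt (p i)) * u (h i) k * v i l)" if "k < a" "l < b" for k l
  proof -
    have "(\<Sum>i<card I. of_real (sqrt (p i)) * u (h i) k * v i l) = (\<Sum>i<card I. u (h i) k * w (h i) l)"
    proof (intro sum.cong refl)
      fix i assume "i \<in> {..<card I}"
      then have "p i > 0" using hI by (simp add: p_def)
      then have "of_real (sqrt (p i)) * of_real (1 / sqrt (p i)) = (1::complex)"
        by (simp flip: of_real_mult)
      then show "of_real (sqrt (p i)) * u (h i) k * v i l = u (h i) k * w (h i) l"
        by (simp add: v_def mult_ac del: of_real_divide)
    qed
    also have "\<dots> = (\<Sum>i\<in>I. u i k * w i l)" by (rule sum.reindex_bij_betw [OF h])
    also have "\<dots> = (\<Sum>i<a. u i k * w i l)"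
      by (rule sum.mono_neutral_left) (use nsq_eq_0_D that in \<open>auto simp: I_def\<close>)
    finally show ?thesis using X that by simp
  qed
  moreover have "0 \<le> p i" for i by (simp add: p_def)
  moreover have "p i = 0" if "i \<ge> card I" for i using that by (simp add: p_def)
  ultimately have "schmidt a b X (card I) p (\<lambda>i. u (h i)) v" by (simp add: schmidt_def)
  then show ?thesis by blast
qed

lemma schmidt_rank_le:
  assumes "schmidt a b X m p u v"
  shows "m \<le> a" "m \<le> b"
  using assms onf_card_le [of a "{..<m}" u] onf_card_le [of b "{..<m}" v] by (auto simp: schmidt_def)

lemma schmidt_contract_right:
  assumes X: "schmidt a b X m p u v" and k: "k < a"
  shows "(\<Sum>l<b. X k l * cnj (g l)) = (\<Sum>i<m. (of_real (sqrt (p i)) * ip b (v i) g) * u i k)"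
proof -
  have "(\<Sum>l<b. X k l * cnj (g l)) = ip b (\<lambda>l. \<Sum>i<m. (of_real (sqrt (p i)) * u i k) * v i l) g"
    using X k by (simp add: ip_def schmidt_def)
  also have "\<dots> = (\<Sum>i<m. (of_real (sqrt (p i)) * ip b (v i) g) * u i k)"
    unfolding ip_sum_left by (simp add: mult_ac)
  finally show ?thesis .
qed

lemma schmidt_nsq_contract_right:
  assumes X: "schmidt a b X m p u v"
  shows "nsq a (\<lambda>k. \<Sum>l<b. X k l * cnj (g l)) = (\<Sum>i<m. p i * (cmod (ip b (v i) g))\<^sup>2)"
proof -
  have "nsq a (\<lambda>k. \<Sum>l<b. X k l * cnj (g l))
      = nsq a (\<lambda>k. \<Sum>i<m. (of_real (sqrt (p i)) * ip b (v i) g) * u i k)"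
    by (rule nsq_cong) (rule schmidt_contract_right [OF X])
  also have "\<dots> = (\<Sum>i<m. (cmod (of_real (sqrt (p i)) * ip b (v i) g))\<^sup>2)"
    by (rule onf_nsq) (use X in \<open>auto simp: schmidt_def\<close>)
  finally show ?thesis using X by (simp add: norm_mult power_mult_distrib schmidt_def)
qed

text \<open>\<open>c i\<close> is the square norm of the projection of \<open>v i\<close> to the
  span of \<open>g\<close>. It is at most 1, and the \<open>c i\<close> add up to at most
  \<open>n\<close>, both by Bessel, so the \<open>n\<close> largest values bound the weighted
  sum.\<close>

lemma schmidt_ky_fan:
  assumes X: "schmidt a b X m p u v" and g: "onf b {..<n} g"
  shows "(\<Sum>j<n. nsq a (\<lambda>k. \<Sum>l<b. X k l * cnj (g j l))) \<le> (\<Sum>i<n. p i)"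
proof -
  have v: "onf b {..<m} v" using X by (simp add: schmidt_def)
  define c where "c i = (\<Sum>j<n. (cmod (ip b (v i) (g j)))\<^sup>2)" for i
  have "(\<Sum>j<n. nsq a (\<lambda>k. \<Sum>l<b. X k l * cnj (g j l))) = (\<Sum>i<m. p i * c i)"
    unfolding schmidt_nsq_contract_right [OF X] c_def sum_distrib_left by (rule sum.swap)
  also have "\<dots> \<le> (\<Sum>i<n. p i)"
  proof (rule decreasing_weighted_sum_le)
    show "c i \<le> 1" if "i < m" for i
      using bessel [OF g finite_lessThan, of "v i"] onf_nsq_1 [OF v] that by (simp add: c_def)
    have "(\<Sum>i<m. c i) = (\<Sum>j<n. \<Sum>i<m. (cmod (ip b (g j) (v i)))\<^sup>2)"
      unfolding c_def by (subst sum.swap) (simp add: cmod_ip_commute)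
    also have "\<dots> \<le> (\<Sum>j<n. 1)"
      using bessel [OF v finite_lessThan] onf_nsq_1 [OF g] by (intro sum_mono) (metis lessThan_iff)
    finally show "(\<Sum>i<m. c i) \<le> real n" by simp
  qed (use X in \<open>auto simp: schmidt_def c_def intro: sum_nonneg\<close>)
  finally show ?thesis .
qed

lemma schmidt_sum:
  assumes X: "schmidt a b X m p u v"
  shows "(\<Sum>k<a. \<Sum>l<b. (cmod (X k l))\<^sup>2) = (\<Sum>i<m. p i)"
proof -
  have u: "onf a {..<m} u" and v: "onf b {..<m} v" using X by (auto simp: schmidt_def)
  have "(\<Sum>k<a. \<Sum>l<b. (cmod (X k l))\<^sup>2)
      = (\<Sum>k<a. nsq b (\<lambda>l. \<Sum>i<m. (of_real (sqrt (p i)) * u i k) * v i l))"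
    using X by (simp add: nsq_def schmidt_def)
  also have "\<dots> = (\<Sum>k<a. \<Sum>i<m. p i * (cmod (u i k))\<^sup>2)"
    using X by (simp add: onf_nsq [OF v] norm_mult power_mult_distrib schmidt_def)
  also have "\<dots> = (\<Sum>i<m. p i * nsq a (u i))"
    unfolding nsq_def sum_distrib_left by (rule sum.swap)
  finally show ?thesis by (simp add: onf_nsq_1 [OF u])
qed

text \<open>The overlap is a double sum over pairs of Schmidt vectors, whose moduli are bounded by
  the array \<open>D\<close>. Rows and columns of \<open>D\<close> sum to at most 1, and such an
  array cannot pair two decreasing sequences better than the identity does.\<close>

lemma von_neumann_trace_inequality:
  assumes X: "schmidt a b X m p u v" and Y: "schmidt a b Y n q f g"
  shows "cmod (\<Sum>k<a. \<Sum>l<b. X k l * cnj (Y k l)) \<le> (\<Sum>j<n. sqrt (p j * q j))"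
proof -
  have u: "onf a {..<m} u" and v: "onf b {..<m} v" and f: "onf a {..<n} f" and g: "onf b {..<n} g"
    and p: "antimono p" "\<And>i. 0 \<le> p i" and q: "antimono q" "\<And>i. 0 \<le> q i"
    using X Y by (auto simp: schmidt_def)
  \<comment> \<open>The product of two overlaps is at most the mean of their squares, and the mean
    inherits Bessel's bounds from both sides.\<close>
  define D where "D i j = ((cmod (ip a (u i) (f j)))\<^sup>2 + (cmod (ip b (v i) (g j)))\<^sup>2) / 2" for i j
  define s where "s i = sqrt (p i)" for i
  define t where "t i = sqrt (q i)" for i
  have s: "antimono s" "\<And>i. 0 \<le> s i" and t: "antimono t" "\<And>i. 0 \<le> t i"
    using p q by (auto simp: antimono_def s_def t_def)
  have col: "(\<Sum>i<m. D i j) \<le> 1" if "j < n" for j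
    using bessel [OF u finite_lessThan, of "f j"] bessel [OF v finite_lessThan, of "g j"]
      onf_nsq_1 [OF f] onf_nsq_1 [OF g] that
    by (simp add: D_def sum.distrib cmod_ip_commute [of _ "f j"] cmod_ip_commute [of _ "g j"]
        flip: sum_divide_distrib)
  have row: "(\<Sum>j<n. D i j) \<le> 1" if "i < m" for i
    using bessel [OF f finite_lessThan, of "u i"] bessel [OF g finite_lessThan, of "v i"]
      onf_nsq_1 [OF u] onf_nsq_1 [OF v] that
    by (simp add: D_def sum.distrib flip: sum_divide_distrib)
  have D: "0 \<le> D i j" for i j by (simp add: D_def)
  have overlap: "(\<Sum>k<a. \<Sum>l<b. X k l * cnj (Y k l))
      = (\<Sum>j<n. \<Sum>i<m. of_real (s i) * of_real (t j) * (ip a (u i) (f j) * ip b (v i) (g j)))"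
  proof -
    have "(\<Sum>k<a. \<Sum>l<b. X k l * cnj (Y k l))
        = (\<Sum>k<a. \<Sum>l<b. \<Sum>j<n. of_real (t j) * cnj (f j k) * (X k l * cnj (g j l)))"
      using Y by (intro sum.cong refl) (simp add: schmidt_def t_def sum_distrib_left mult_ac)
    also have "\<dots> = (\<Sum>j<n. \<Sum>k<a. \<Sum>l<b. of_real (t j) * cnj (f j k) * (X k l * cnj (g j l)))"
      by (simp only: sum.swap [of _ "{..<n}"])
    also have "\<dots> = (\<Sum>j<n. of_real (t j) * ip a (\<lambda>k. \<Sum>l<b. X k l * cnj (g j l)) (f j))"
      by (simp add: ip_def sum_distrib_left mult_ac)
    also have "\<dots> = (\<Sum>j<n. of_real (t j) *
        ip a (\<lambda>k. \<Sum>i<m. (of_real (s i) * ip b (v i) (g j)) * u i k) (f j))"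
      unfolding s_def
      by (intro sum.cong refl arg_cong2 [where f = "(*)"] ip_cong schmidt_contract_right [OF X])
         simp_all
    also have "\<dots> = (\<Sum>j<n. \<Sum>i<m. of_real (s i) * of_real (t j) * (ip a (u i) (f j) * ip b (v i) (g j)))"
      unfolding ip_sum_left by (simp add: sum_distrib_left mult_ac)
    finally show ?thesis .
  qed
  define e where "e j = (\<Sum>i<m. s i * D i j)" for j
  have "cmod (\<Sum>k<a. \<Sum>l<b. X k l * cnj (Y k l)) \<le> (\<Sum>j<n. \<Sum>i<m. s i * t j * D i j)"
    unfolding overlap
  proof (intro order_trans [OF norm_sum] sum_mono)
    fix i j
    have "cmod (ip a (u i) (f j)) * cmod (ip b (v i) (g j)) \<le> D i j"
      using sum_squares_bound [of "cmod (ip a (u i) (f j))" "cmod (ip b (v i) (g j))"] by (simp add: D_def)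
    then show "cmod (of_real (s i) * of_real (t j) * (ip a (u i) (f j) * ip b (v i) (g j))) \<le> s i * t j * D i j"
      using s(2) [of i] t(2) [of j] by (simp add: norm_mult mult_left_mono)
  qed
  also have "\<dots> = (\<Sum>j<n. t j * e j)" by (simp add: e_def sum_distrib_left mult_ac)
  also have "\<dots> \<le> (\<Sum>j<n. t j * s j)"
  proof -
    \<comment> \<open>\<open>e\<close> is cut off at \<open>n\<close> because summation by parts
      asks for all prefixes, while column bounds exist only below \<open>n\<close>.\<close>
    define h where "h j = s j - (if j < n then e j else 0)" for j
    have "0 \<le> (\<Sum>j<n. t j * h j)"
    proof (rule abel_sum_nonneg [OF t])
      fix l
      let ?l = "min l n"
      have "(\<Sum>j<l. if j < n then e j else 0) = (\<Sum>j\<in>{..<l} \<inter> {..<n}. e j)"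
        by (subst sum.inter_restrict) (simp_all add: lessThan_iff)
      also have "{..<l} \<inter> {..<n} = {..<?l}" by auto
      also have "(\<Sum>j<?l. e j) = (\<Sum>i<m. s i * (\<Sum>j<?l. D i j))"
        unfolding e_def sum_distrib_left by (rule sum.swap)
      also have "\<dots> \<le> (\<Sum>i<?l. s i)"
      proof (rule decreasing_weighted_sum_le [OF s])
        show "(\<Sum>j<?l. D i j) \<le> 1" if "i < m" for i
          by (rule order_trans [OF sum_mono2 row [OF that]]) (auto simp: D)
        have "(\<Sum>i<m. \<Sum>j<?l. D i j) = (\<Sum>j<?l. \<Sum>i<m. D i j)" by (rule sum.swap)
        also have "\<dots> \<le> (\<Sum>j<?l. 1)" by (intro sum_mono col) simp
        finally show "(\<Sum>i<m. \<Sum>j<?l. D i j) \<le> real ?l" by simp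
      qed (simp add: D sum_nonneg)
      also have "\<dots> \<le> (\<Sum>i<l. s i)" by (rule sum_mono2) (use s in auto)
      finally show "0 \<le> (\<Sum>j<l. h j)" by (simp add: h_def sum_subtractf)
    qed
    then show ?thesis by (simp add: h_def algebra_simps sum_subtractf)
  qed
  finally show ?thesis by (simp add: s_def t_def real_sqrt_mult mult.commute)
qed

text \<open>A choice suffices: Schmidt values are compared only through Ky Fan sums, where any
  decomposition serves.\<close>

definition sv :: "nat \<Rightarrow> nat \<Rightarrow> (nat \<Rightarrow> nat \<Rightarrow> complex) \<Rightarrow> nat \<Rightarrow> real" where
  "sv a b X = (SOME p. \<exists>m u v. schmidt a b X m p u v)"

lemma schmidt_sv: "\<exists>m u v. schmidt a b X m (sv a b X) u v"
  unfolding sv_def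
  by (rule someI_ex [where P = "\<lambda>p. \<exists>m u v. schmidt a b X m p u v"]) (use schmidt_exists in metis)

lemma sv_antimono: "antimono (sv a b X)"
  and sv_nonneg: "0 \<le> sv a b X i"
  and sv_eq_0: "i \<ge> a \<or> i \<ge> b \<Longrightarrow> sv a b X i = 0"
proof -
  obtain m u v where *: "schmidt a b X m (sv a b X) u v" using schmidt_sv by blast
  then show "antimono (sv a b X)" "0 \<le> sv a b X i" by (auto simp: schmidt_def)
  show "sv a b X i = 0" if "i \<ge> a \<or> i \<ge> b"
    using * schmidt_rank_le [OF *] that by (auto simp: schmidt_def)
qed

lemma sv_sum: "(\<Sum>i<a. sv a b X i) = (\<Sum>k<a. \<Sum>l<b. (cmod (X k l))\<^sup>2)"
proof -
  obtain m u v where *: "schmidt a b X m (sv a b X) u v" using schmidt_sv by blast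
  have "(\<Sum>i<a. sv a b X i) = (\<Sum>i<m. sv a b X i)"
    by (rule sum.mono_neutral_right) (use * schmidt_rank_le [OF *] in \<open>auto simp: schmidt_def\<close>)
  then show ?thesis by (simp add: schmidt_sum [OF *])
qed

lemma sv_ky_fan:
  assumes "onf b {..<n} g"
  shows "(\<Sum>j<n. nsq a (\<lambda>k. \<Sum>l<b. X k l * cnj (g j l))) \<le> (\<Sum>i<n. sv a b X i)"
  using schmidt_sv schmidt_ky_fan [OF _ assms] by blast

text \<open>Equality holds although \<open>sv\<close> is a choice: exchanging the two bases shows
  that both sides choose from the same predicate.\<close>

lemma sv_transpose: "sv b a (\<lambda>l k. X k l) = sv a b X"
proof -
  have "(\<exists>m u v. schmidt b a (\<lambda>l k. X k l) m p u v) \<longleftrightarrow> (\<exists>m u v. schmidt a b X m p u v)" for p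
  proof
    assume "\<exists>m u v. schmidt b a (\<lambda>l k. X k l) m p u v"
    then obtain m u v where "schmidt b a (\<lambda>l k. X k l) m p u v" by (elim exE)
    from schmidt_transpose [OF this] show "\<exists>m u v. schmidt a b X m p u v" by (intro exI)
  next
    assume "\<exists>m u v. schmidt a b X m p u v"
    then obtain m u v where "schmidt a b X m p u v" by (elim exE)
    from schmidt_transpose [OF this] show "\<exists>m u v. schmidt b a (\<lambda>l k. X k l) m p u v" by (intro exI)
  qed
  then show ?thesis by (simp add: sv_def)
qed

text \<open>Ky Fan's bound is attained at the Schmidt vectors themselves. There are only
  \<open>m\<close> of them, whence the minimum.\<close>

lemma schmidt_partial_sum:
  assumes X: "schmidt a b X m p u v"
  shows "(\<Sum>i<l. p i) = (\<Sum>i<min l m. nsq a (\<lambda>k. \<Sum>l<b. X k l * cnj (v i l)))"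
proof -
  have v: "onf b {..<m} v" using X by (simp add: schmidt_def)
  have "(\<Sum>i<l. p i) = (\<Sum>i<min l m. p i)"
    by (rule sum.mono_neutral_right) (use X in \<open>auto simp: schmidt_def\<close>)
  also have "\<dots> = (\<Sum>i<min l m. nsq a (\<lambda>k. \<Sum>l<b. X k l * cnj (v i l)))"
  proof (intro sum.cong refl)
    fix j assume j: "j \<in> {..<min l m}"
    have "(\<Sum>i<m. p i * (cmod (ip b (v i) (v j)))\<^sup>2) = (\<Sum>i<m. if i = j then p i else 0)"
      using v j by (intro sum.cong) (auto simp: onf_def)
    then show "p j = nsq a (\<lambda>k. \<Sum>l<b. X k l * cnj (v j l))"
      unfolding schmidt_nsq_contract_right [OF X] using j by simp
  qed
  finally show ?thesis .
qed

section \<open>Schmidt values under local Kraus operators\<close>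

definition kraus_complete :: "nat \<Rightarrow> 'z set \<Rightarrow> ('z \<Rightarrow> nat) \<Rightarrow> ('z \<Rightarrow> nat \<Rightarrow> nat \<Rightarrow> complex) \<Rightarrow> bool" where
  "kraus_complete d Z e K \<longleftrightarrow> finite Z \<and>
     (\<forall>i<d. \<forall>j<d. (\<Sum>z\<in>Z. \<Sum>k<e z. cnj (K z k i) * K z k j) = (if i = j then 1 else 0))"

lemma kraus_complete_nsq:
  assumes K: "kraus_complete d Z e K"
  shows "(\<Sum>z\<in>Z. nsq (e z) (\<lambda>k. \<Sum>i<d. K z k i * f i)) = nsq d f"
proof -
  have "complex_of_real (\<Sum>z\<in>Z. nsq (e z) (\<lambda>k. \<Sum>i<d. K z k i * f i))
      = (\<Sum>z\<in>Z. \<Sum>k<e z. \<Sum>j<d. \<Sum>i<d. cnj (f i) * f j * (cnj (K z k i) * K z k j))"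
    unfolding of_real_sum ip_self [symmetric] ip_def
    by (simp add: cnj_sum sum_product mult_ac)
  also have "\<dots> = (\<Sum>j<d. \<Sum>i<d. \<Sum>z\<in>Z. \<Sum>k<e z. cnj (f i) * f j * (cnj (K z k i) * K z k j))"
    by (simp only: sum.swap [of _ "{..<d}" "{..<e _}"] sum.swap [of _ "{..<d}" Z])
  also have "\<dots> = (\<Sum>j<d. \<Sum>i<d. cnj (f i) * f j * (if i = j then 1 else 0))"
    using K by (simp add: kraus_complete_def flip: sum_distrib_left)
  also have "\<dots> = of_real (nsq d f)"
    by (simp add: ip_self [symmetric] ip_def mult.commute if_distrib [of "\<lambda>x. _ * x"] cong: if_cong)
  finally show ?thesis by (simp only: of_real_eq_iff)
qed

text \<open>The largest Schmidt values are read off on the side on which no operation takes place.\<close>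

lemma sv_majorized_kraus_A:
  assumes K: "kraus_complete a Z e K"
  shows "(\<Sum>i<n. sv a b X i) \<le> (\<Sum>z\<in>Z. \<Sum>i<n. sv (e z) b (\<lambda>k l. \<Sum>i<a. K z k i * X i l) i)"
proof -
  obtain m u v where X: "schmidt a b X m (sv a b X) u v" using schmidt_sv by blast
  have v: "onf b {..<min n m} v"
    by (rule onf_subset [of b "{..<m}"]) (use X in \<open>auto simp: schmidt_def\<close>)
  \<comment> \<open>The operators act on the side opposite to \<open>v\<close>, so they commute with
    the contraction against \<open>v j\<close>. Completeness conserves its square norm in total over
    the branches, and Ky Fan's bound in each branch gives the rest.\<close>
  have "(\<Sum>i<n. sv a b X i)
      = (\<Sum>j<min n m. \<Sum>z\<in>Z. nsq (e z) (\<lambda>k. \<Sum>i<a. K z k i * (\<Sum>l<b. X i l * cnj (v j l))))"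
    unfolding schmidt_partial_sum [OF X] kraus_complete_nsq [OF K] ..
  also have "\<dots> = (\<Sum>z\<in>Z. \<Sum>j<min n m. nsq (e z) (\<lambda>k. \<Sum>l<b. (\<Sum>i<a. K z k i * X i l) * cnj (v j l)))"
    by (subst sum.swap) (simp add: sum_distrib_left sum_distrib_right mult.assoc sum.swap [of _ "{..<b}" "{..<a}"])
  also have "\<dots> \<le> (\<Sum>z\<in>Z. \<Sum>i<min n m. sv (e z) b (\<lambda>k l. \<Sum>i<a. K z k i * X i l) i)"
    by (intro sum_mono sv_ky_fan [OF v])
  also have "\<dots> \<le> (\<Sum>z\<in>Z. \<Sum>i<n. sv (e z) b (\<lambda>k l. \<Sum>i<a. K z k i * X i l) i)"
    by (intro sum_mono sum_mono2) (auto simp: sv_nonneg)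
  finally show ?thesis .
qed

lemma sv_majorized_kraus_B:
  assumes K: "kraus_complete b Z e K"
  shows "(\<Sum>i<n. sv a b X i) \<le> (\<Sum>z\<in>Z. \<Sum>i<n. sv a (e z) (\<lambda>k l. \<Sum>i<b. K z l i * X k i) i)"
  using sv_majorized_kraus_A [OF K, of a "\<lambda>l k. X k l" n]
  unfolding sv_transpose [of b a X]
    sv_transpose [of "e z" a "\<lambda>k l. \<Sum>i<b. K z l i * X k i" for z] .

section \<open>Matrices and square roots\<close>

lemma complex_of_real_nonneg_iff: "(0::complex) \<le> complex_of_real x \<longleftrightarrow> 0 \<le> x"
  by (simp add: less_eq_complex_def)

lemma smult_smult_mat: "(a::complex) \<cdot>\<^sub>m (b \<cdot>\<^sub>m A) = (a * b) \<cdot>\<^sub>m A"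
  by (rule eq_matI) auto

lemma one_smult_mat: "(1::complex) \<cdot>\<^sub>m A = A"
  by (rule eq_matI) auto

abbreviation entries :: "complex mat \<Rightarrow> nat \<Rightarrow> nat \<Rightarrow> complex" where
  "entries A \<equiv> \<lambda>i j. A $$ (i, j)"

lemma dim_mat_adjoint [simp]: "dim_row (mat_adjoint A) = dim_col A" "dim_col (mat_adjoint A) = dim_row A"
  by (simp_all add: mat_adjoint_def)

lemma mat_adjoint_carrier [simp]: "A \<in> carrier_mat m n \<Longrightarrow> mat_adjoint A \<in> carrier_mat n m"
  by (intro carrier_matI) auto

lemma mat_adjoint_index [simp]:
  fixes A :: "complex mat"
  shows "i < dim_col A \<Longrightarrow> j < dim_row A \<Longrightarrow> mat_adjoint A $$ (i, j) = cnj (A $$ (j, i))"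
  by (simp add: mat_adjoint_def mat_of_rows_index)

lemma mat_mult_index:
  assumes "A \<in> carrier_mat m n" "B \<in> carrier_mat n k" "i < m" "j < k"
  shows "(A * B) $$ (i, j) = (\<Sum>l<n. A $$ (i, l) * B $$ (l, j))"
  using assms by (auto simp: scalar_prod_def atLeast0LessThan intro!: sum.cong)

lemma mat_adjoint_mult:
  fixes A B :: "complex mat"
  assumes "A \<in> carrier_mat m n" "B \<in> carrier_mat n k"
  shows "mat_adjoint (A * B) = mat_adjoint B * mat_adjoint A"
proof (rule eq_matI)
  fix i j assume "i < dim_row (mat_adjoint B * mat_adjoint A)" "j < dim_col (mat_adjoint B * mat_adjoint A)"
  then have ij: "i < k" "j < m" using assms by auto
  have "mat_adjoint (A * B) $$ (i, j) = cnj ((A * B) $$ (j, i))"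
    using ij assms by simp
  also have "\<dots> = (\<Sum>l<n. cnj (A $$ (j, l)) * cnj (B $$ (l, i)))"
    using ij by (simp add: mat_mult_index [OF assms] del: index_mult_mat)
  also have "\<dots> = (mat_adjoint B * mat_adjoint A) $$ (i, j)"
    using ij assms
    by (subst mat_mult_index [of _ k n _ m]) (auto simp: mult.commute intro!: sum.cong)
  finally show "mat_adjoint (A * B) $$ (i, j) = (mat_adjoint B * mat_adjoint A) $$ (i, j)" .
qed (use assms in auto)

lemma inner_eq_ip:
  assumes "v \<in> carrier_vec d" "w \<in> carrier_vec d"
  shows "v \<bullet>c w = ip d (($) v) (($) w)"
  using assms by (auto simp: scalar_prod_def ip_def atLeast0LessThan intro!: sum.cong)

lemma mult_mat_vec_index:
  assumes "A \<in> carrier_mat m d" "v \<in> carrier_vec d" "k < m"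
  shows "(A *\<^sub>v v) $ k = (\<Sum>l<d. A $$ (k, l) * v $ l)"
  using assms by (auto simp: scalar_prod_def atLeast0LessThan intro!: sum.cong)

lemma app_cong: "(\<And>l. l < d \<Longrightarrow> H k l = H' k l) \<Longrightarrow> (\<And>l. l < d \<Longrightarrow> f l = g l) \<Longrightarrow> app d H f k = app d H' g k"
  by (simp add: app_def)

lemma app_mult:
  assumes "A \<in> carrier_mat d d" "B \<in> carrier_mat d d" "k < d"
  shows "app d (entries (A * B)) f k = app d (entries A) (app d (entries B) f) k"
proof -
  have "app d (entries (A * B)) f k = (\<Sum>l<d. \<Sum>m<d. A $$ (k, m) * (B $$ (m, l) * f l))"
    unfolding app_def using mat_mult_index [OF assms(1,2,3)]
    by (intro sum.cong refl) (simp add: sum_distrib_right mult.assoc del: index_mult_mat)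
  also have "\<dots> = (\<Sum>m<d. \<Sum>l<d. A $$ (k, m) * (B $$ (m, l) * f l))" by (rule sum.swap)
  finally show ?thesis by (simp add: app_def sum_distrib_left)
qed

lemma positive_mat_iff:
  "positive_mat d A \<longleftrightarrow> A \<in> carrier_mat d d \<and> (\<forall>f. 0 \<le> ip d (app d (entries A) f) f)"
proof -
  have 1: "(A *\<^sub>v v) \<bullet>c v = ip d (app d (entries A) (($) v)) (($) v)"
    if "A \<in> carrier_mat d d" "v \<in> carrier_vec d" for v
    unfolding inner_eq_ip [OF mult_mat_vec_carrier [OF that] that(2)]
    by (intro ip_cong refl) (simp add: mult_mat_vec_index [OF that] app_def del: index_mult_mat_vec)
  have 2: "ip d (app d (entries A) f) f = ip d (app d (entries A) (($) (vec d f))) (($) (vec d f))" for f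
    by (intro ip_cong app_cong) auto
  show ?thesis unfolding positive_mat_def
    using 1 2 by (metis vec_carrier)
qed

section \<open>Positive square roots\<close>

lemma app_linear: "app d H (\<lambda>k. f k + c * g k) k = app d H f k + c * app d H g k"
  by (simp add: app_def algebra_simps sum.distrib sum_distrib_left)

text \<open>The core of uniqueness: an eigenvector of the square of a positive operator is an
  eigenvector of the operator. For positive \<open>\<mu>\<close> the defect \<open>w\<close>
  satisfies the eigenvalue equation for \<open>- \<mu>\<close>, which positivity excludes unless
  \<open>w\<close> vanishes.\<close>

lemma positive_sqrt_eigenvector:
  assumes pos: "\<And>f. 0 \<le> ip d (app d H f) f" and \<mu>: "0 \<le> \<mu>"
    and v: "\<And>k. k < d \<Longrightarrow> app d H (app d H v) k = of_real (\<mu> * \<mu>) * v k" and k: "k < d"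
  shows "app d H v k = of_real \<mu> * v k"
proof (cases "\<mu> = 0")
  case True
  define w where "w = app d H v"
  have Hw: "app d H w k = 0" if "k < d" for k using v [OF that] True by (simp add: w_def)
  \<comment> \<open>\<open>H\<close> is not given as Hermitian, so \<open>w = 0\<close> is read off
    an imaginary part: since \<open>H\<close> annihilates \<open>w\<close>, the form at
    \<open>v + \<i> w\<close> has imaginary part minus the square norm of \<open>w\<close>, yet it
    must be real.\<close>
  have "ip d (app d H (\<lambda>k. v k + \<i> * w k)) (\<lambda>k. v k + \<i> * w k) = ip d w (\<lambda>k. v k + \<i> * w k)"
    by (rule ip_cong) (simp_all only: app_linear Hw, simp add: w_def)
  also have "\<dots> = ip d w v - \<i> * ip d w w"
    by (simp add: ip_def algebra_simps sum_subtractf sum_distrib_left)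
  finally have "Im (ip d w v - \<i> * ip d w w) = 0"
    using pos [of "\<lambda>k. v k + \<i> * w k"] by (simp add: less_eq_complex_def)
  moreover have "Im (ip d w v) = 0" using pos [of v] by (simp add: w_def less_eq_complex_def)
  ultimately have "nsq d w = 0" by (simp add: ip_self)
  then show ?thesis using nsq_eq_0_D [of d w k] k True by (simp add: w_def)
next
  case False
  define w where "w k = app d H v k + (- of_real \<mu>) * v k" for k
  have "app d H w k = - of_real \<mu> * w k" if "k < d" for k
    unfolding w_def app_linear using v [OF that] by (simp add: algebra_simps)
  then have "ip d (app d H w) w = ip d (\<lambda>k. - of_real \<mu> * w k) (\<lambda>k. 1 * w k)"
    by (intro ip_cong) auto
  also have "\<dots> = of_real (- \<mu> * nsq d w)" unfolding ip_scale by (simp add: ip_self)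
  finally have "0 \<le> - \<mu> * nsq d w" using pos [of w] by (simp add: less_eq_complex_def)
  then have "nsq d w = 0" using \<mu> False nsq_nonneg [of d w]
    by (metis antisym_conv2 mult_minus_left mult_pos_pos neg_0_le_iff_le not_less)
  then show ?thesis using nsq_eq_0_D [of d w k] k by (simp add: w_def)
qed

lemma app_rank_one_sum:
  "app d (\<lambda>k l. \<Sum>i\<in>I. c i * u i k * cnj (u i l)) f k = (\<Sum>i\<in>I. (c i * ip d f (u i)) * u i k)"
proof -
  have "app d (\<lambda>k l. \<Sum>i\<in>I. c i * u i k * cnj (u i l)) f k
      = (\<Sum>l<d. \<Sum>i\<in>I. c i * u i k * (f l * cnj (u i l)))"
    by (simp add: app_def sum_distrib_right sum_distrib_left mult_ac)
  also have "\<dots> = (\<Sum>i\<in>I. \<Sum>l<d. c i * u i k * (f l * cnj (u i l)))" by (rule sum.swap)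
  finally show ?thesis by (simp add: ip_def sum_distrib_left mult_ac)
qed

lemma ip_rank_one_sum:
  "ip d (app d (\<lambda>k l. \<Sum>i\<in>I. of_real (c i) * u i k * cnj (u i l)) f) f
    = of_real (\<Sum>i\<in>I. c i * (cmod (ip d f (u i)))\<^sup>2)"
proof -
  have "ip d (app d (\<lambda>k l. \<Sum>i\<in>I. of_real (c i) * u i k * cnj (u i l)) f) f
      = ip d (\<lambda>k. \<Sum>i\<in>I. (of_real (c i) * ip d f (u i)) * u i k) f"
    by (rule ip_cong) (rule app_rank_one_sum, rule refl)
  also have "\<dots> = (\<Sum>i\<in>I. of_real (c i) * (ip d f (u i) * cnj (ip d f (u i))))"
    unfolding ip_sum_left by (simp add: cnj_ip mult.assoc)
  finally show ?thesis by (simp flip: complex_norm_square)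
qed

definition hermitian_mat :: "nat \<Rightarrow> complex mat \<Rightarrow> bool" where
  "hermitian_mat d A \<longleftrightarrow> A \<in> carrier_mat d d \<and> (\<forall>i<d. \<forall>j<d. A $$ (i, j) = cnj (A $$ (j, i)))"

lemma hermitian_mat_carrier: "hermitian_mat d A \<Longrightarrow> A \<in> carrier_mat d d"
  by (simp add: hermitian_mat_def)

lemma hermitian_mat_index: "hermitian_mat d A \<Longrightarrow> i < d \<Longrightarrow> j < d \<Longrightarrow> A $$ (i, j) = cnj (A $$ (j, i))"
  unfolding hermitian_mat_def by blast

lemma hermitian_mat_adjoint:
  assumes "hermitian_mat d A"
  shows "mat_adjoint A = A"
proof (rule eq_matI)
  fix i j assume "i < dim_row A" "j < dim_col A"
  then show "mat_adjoint A $$ (i, j) = A $$ (i, j)"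
    using hermitian_mat_carrier [OF assms] hermitian_mat_index [OF assms, of i j] by auto
qed (use hermitian_mat_carrier [OF assms] in auto)

lemma mat_eq_if_app_eq:
  assumes "A \<in> carrier_mat d d" "B \<in> carrier_mat d d"
    and u: "onf d {..<d} u"
    and eq: "\<And>i k. i < d \<Longrightarrow> k < d \<Longrightarrow> app d (entries A) (u i) k = app d (entries B) (u i) k"
  shows "A = B"
proof (rule eq_matI)
  fix k m assume "k < dim_row B" "m < dim_col B"
  then have k: "k < d" "m < d" using assms by auto
  have *: "C $$ (k, m) = (\<Sum>i<d. ip d (unit_fun m) (u i) * app d (entries C) (u i) k)"
    if "C \<in> carrier_mat d d" for C
  proof -
    have "C $$ (k, m) = app d (entries C) (unit_fun m) k"
      using k by (simp add: app_def unit_fun_def if_distrib [of "\<lambda>x. _ * x"] cong: if_cong)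
    also have "\<dots> = app d (entries C) (\<lambda>l. \<Sum>i<d. ip d (unit_fun m) (u i) * u i l) k"
      by (intro app_cong refl onf_expansion [OF u]) auto
    finally show ?thesis by (simp only: app_sum)
  qed
  show "A $$ (k, m) = B $$ (k, m)"
    unfolding * [OF assms(1)] * [OF assms(2)] using eq k by simp
qed (use assms in auto)

lemma positive_spectral:
  assumes A: "hermitian_mat d A" "positive_mat d A"
  obtains u lam where "onf d {..<d} u" "\<And>i. i < d \<Longrightarrow> 0 \<le> lam i"
    "\<And>i k. i < d \<Longrightarrow> k < d \<Longrightarrow> app d (entries A) (u i) k = of_real (lam i) * u i k"
proof -
  have herm: "\<And>i j. i < d \<Longrightarrow> j < d \<Longrightarrow> entries A i j = cnj (entries A j i)"
    by (rule hermitian_mat_index [OF A(1)])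
  from hermitian_spectral [OF herm]
  obtain u where "\<exists>lam. onf d {..<d} u \<and> (\<forall>i<d. \<forall>k<d. app d (entries A) (u i) k = of_real (lam i) * u i k)" ..
  then obtain lam where
    ul: "onf d {..<d} u \<and> (\<forall>i<d. \<forall>k<d. app d (entries A) (u i) k = of_real (lam i) * u i k)" ..
  then have u: "onf d {..<d} u"
    and lam: "\<And>i k. i < d \<Longrightarrow> k < d \<Longrightarrow> app d (entries A) (u i) k = of_real (lam i) * u i k"
    by simp_all
  have lam_nonneg: "0 \<le> lam i" if i: "i < d" for i
  proof -
    have "ip d (app d (entries A) (u i)) (u i) = ip d (\<lambda>k. of_real (lam i) * u i k) (\<lambda>k. 1 * u i k)"
      by (intro ip_cong) (auto simp: lam i)
    also have "\<dots> = of_real (lam i)" unfolding ip_scale using u i by (simp add: onf_def)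
    finally show ?thesis using A(2) unfolding positive_mat_iff
      by (metis complex_of_real_nonneg_iff)
  qed
  show thesis using that [OF u lam_nonneg lam] .
qed

text \<open>Justifies the definite description in \<open>mat_sqrt\<close>: on an eigenbasis of
  \<open>A\<close> every positive root acts by the roots of the eigenvalues.\<close>

lemma positive_sqrt_unique:
  assumes A: "hermitian_mat d A" "positive_mat d A"
    and B: "positive_mat d B" "B * B = A" and C: "positive_mat d C" "C * C = A"
  shows "B = C"
proof -
  obtain u lam where u: "onf d {..<d} u" and lam_nonneg: "\<And>i. i < d \<Longrightarrow> 0 \<le> lam i"
    and lam: "\<And>i k. i < d \<Longrightarrow> k < d \<Longrightarrow> app d (entries A) (u i) k = of_real (lam i) * u i k"
    by (rule positive_spectral [OF A]) (rule that)
  have *: "app d (entries D) (u i) k = of_real (sqrt (lam i)) * u i k"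
    if D: "positive_mat d D" "D * D = A" and i: "i < d" "k < d" for D i k
  proof (rule positive_sqrt_eigenvector)
    have D': "D \<in> carrier_mat d d" using D(1) by (simp add: positive_mat_def)
    show "app d (entries D) (app d (entries D) (u i)) k = of_real (sqrt (lam i) * sqrt (lam i)) * u i k"
      if "k < d" for k
      unfolding app_mult [OF D' D' that, symmetric] D(2) using lam i that lam_nonneg by simp
  qed (use D(1) i lam_nonneg in \<open>auto simp: positive_mat_iff\<close>)
  show ?thesis
    by (rule mat_eq_if_app_eq [OF _ _ u]) (use B C * in \<open>auto simp: positive_mat_def\<close>)
qed

lemma positive_sqrt_exists:
  assumes A: "hermitian_mat d A" "positive_mat d A"
  shows "\<exists>B. positive_mat d B \<and> hermitian_mat d B \<and> B * B = A"
proof -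
  obtain u lam where u: "onf d {..<d} u" and lam_nonneg: "\<And>i. i < d \<Longrightarrow> 0 \<le> lam i"
    and lam: "\<And>i k. i < d \<Longrightarrow> k < d \<Longrightarrow> app d (entries A) (u i) k = of_real (lam i) * u i k"
    by (rule positive_spectral [OF A]) (rule that)
  define H where "H = (\<lambda>k l. \<Sum>i<d. of_real (sqrt (lam i)) * u i k * cnj (u i l))"
  define B where "B = mat d d (\<lambda>(k, l). H k l)"
  have B: "B \<in> carrier_mat d d" by (simp add: B_def)
  have app_B: "app d (entries B) f k = app d H f k" if "k < d" for f k
    by (rule app_cong) (use that in \<open>auto simp: B_def\<close>)
  have app_u: "app d H (u i) k = of_real (sqrt (lam i)) * u i k" if i: "i < d" for i k
  proof -
    have "app d H (u i) k = (\<Sum>j<d. if j = i then of_real (sqrt (lam i)) * u i k else 0)"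
      unfolding H_def app_rank_one_sum using u i by (intro sum.cong) (auto simp: onf_def)
    then show ?thesis using i by simp
  qed
  have "positive_mat d B"
    unfolding positive_mat_iff
  proof (intro conjI allI B)
    fix f
    have "ip d (app d (entries B) f) f = ip d (app d H f) f"
      by (rule ip_cong) (simp_all add: app_B)
    then show "0 \<le> ip d (app d (entries B) f) f"
      unfolding H_def ip_rank_one_sum using lam_nonneg
      by (auto simp: complex_of_real_nonneg_iff simp del: of_real_sum intro!: sum_nonneg mult_nonneg_nonneg)
  qed
  moreover have "hermitian_mat d B"
    unfolding hermitian_mat_def using B by (auto simp: B_def H_def mult_ac)
  moreover have "B * B = A"
  proof (rule mat_eq_if_app_eq [OF _ _ u])
    fix i k assume i: "i < d" "k < d"
    have "app d (entries (B * B)) (u i) k = app d (entries B) (app d (entries B) (u i)) k"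
      by (rule app_mult [OF B B i(2)])
    also have "\<dots> = app d H (\<lambda>l. 0 + of_real (sqrt (lam i)) * u i l) k"
      unfolding app_B [OF i(2)] by (rule app_cong) (use i app_u app_B in auto)
    also have "\<dots> = app d (entries A) (u i) k"
      unfolding app_linear app_u [OF i(1)] lam [OF i] using lam_nonneg [OF i(1)]
      by (simp add: app_def flip: of_real_mult mult.assoc)
    finally show "app d (entries (B * B)) (u i) k = app d (entries A) (u i) k" .
  qed (use hermitian_mat_carrier [OF A(1)] B in auto)
  ultimately show ?thesis by blast
qed

lemma mat_sqrt_eqI:
  assumes "hermitian_mat d A" "positive_mat d A" "positive_mat d B" "B * B = A"
  shows "mat_sqrt A = B"
proof -
  have d: "dim_row A = d" using hermitian_mat_carrier [OF assms(1)] by auto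
  show ?thesis unfolding mat_sqrt_def d
  proof (rule the_equality)
    show "positive_mat d B \<and> B * B = A" using assms(3,4) ..
    show "C = B" if "positive_mat d C \<and> C * C = A" for C
      using that by (intro positive_sqrt_unique [OF assms(1,2) _ _ assms(3,4)]) simp_all
  qed
qed

lemma mat_sqrt:
  assumes "hermitian_mat d A" "positive_mat d A"
  shows "hermitian_mat d (mat_sqrt A)" "mat_sqrt A * mat_sqrt A = A"
proof -
  obtain B where B: "positive_mat d B" "hermitian_mat d B" "B * B = A"
    using positive_sqrt_exists [OF assms] by (elim exE conjE)
  have "mat_sqrt A = B" by (rule mat_sqrt_eqI [OF assms B(1,3)])
  with B show "hermitian_mat d (mat_sqrt A)" "mat_sqrt A * mat_sqrt A = A" by simp_all
qed

section \<open>Fidelity with a pure state\<close>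

lemma density_of_carrier [simp]: "v \<in> carrier_vec d \<Longrightarrow> density_of v \<in> carrier_mat d d"
  by (auto simp: density_of_def)

lemma density_of_index: "v \<in> carrier_vec d \<Longrightarrow> i < d \<Longrightarrow> j < d \<Longrightarrow> density_of v $$ (i, j) = v $ i * cnj (v $ j)"
  by (auto simp: density_of_def)

lemma smult_density_of_index:
  "v \<in> carrier_vec d \<Longrightarrow> i < d \<Longrightarrow> j < d \<Longrightarrow> (c \<cdot>\<^sub>m density_of v) $$ (i, j) = c * (v $ i * cnj (v $ j))"
  by (auto simp: density_of_def)

lemma hermitian_smult_density:
  assumes "v \<in> carrier_vec d"
  shows "hermitian_mat d (complex_of_real c \<cdot>\<^sub>m density_of v)"
  using assms by (auto simp: hermitian_mat_def smult_density_of_index mult.commute simp del: index_smult_mat)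

lemma positive_smult_density:
  assumes v: "v \<in> carrier_vec d" and c: "0 \<le> c"
  shows "positive_mat d (complex_of_real c \<cdot>\<^sub>m density_of v)"
  unfolding positive_mat_iff
proof (intro conjI allI)
  fix f
  have "ip d (app d (entries (complex_of_real c \<cdot>\<^sub>m density_of v)) f) f
      = ip d (app d (\<lambda>k l. \<Sum>i\<in>{0::nat}. of_real c * v $ k * cnj (v $ l)) f) f"
    using v by (intro ip_cong app_cong refl) (auto simp: smult_density_of_index simp del: index_smult_mat)
  also have "\<dots> = of_real (\<Sum>i\<in>{0::nat}. c * (cmod (ip d f (($) v)))\<^sup>2)"
    by (rule ip_rank_one_sum)
  finally show "0 \<le> ip d (app d (entries (complex_of_real c \<cdot>\<^sub>m density_of v)) f) f"
    by (simp only: complex_of_real_nonneg_iff) (use c in simp)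
qed (use v in auto)

lemma density_of_sandwich:
  assumes v: "v \<in> carrier_vec d" and A: "A \<in> carrier_mat d d"
  shows "density_of v * (A * density_of v) = ip d (app d (entries A) (($) v)) (($) v) \<cdot>\<^sub>m density_of v"
proof (rule eq_matI)
  fix i j assume "i < dim_row (ip d (app d (entries A) (($) v)) (($) v) \<cdot>\<^sub>m density_of v)"
    "j < dim_col (ip d (app d (entries A) (($) v)) (($) v) \<cdot>\<^sub>m density_of v)"
  then have ij: "i < d" "j < d" using v by (auto simp: density_of_def)
  have D: "density_of v \<in> carrier_mat d d" using v by simp
  have "(density_of v * (A * density_of v)) $$ (i, j)
      = (\<Sum>k<d. v $ i * cnj (v $ k) * (\<Sum>l<d. A $$ (k, l) * (v $ l * cnj (v $ j))))"
    using ij v mat_mult_index [OF A D]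
    by (subst mat_mult_index [OF D mult_carrier_mat [OF A D]])
      (auto simp: density_of_index simp del: index_mult_mat intro!: sum.cong)
  also have "\<dots> = ip d (app d (entries A) (($) v)) (($) v) * (v $ i * cnj (v $ j))"
    by (simp add: ip_def app_def sum_distrib_left sum_distrib_right mult_ac)
  finally show "(density_of v * (A * density_of v)) $$ (i, j)
      = (ip d (app d (entries A) (($) v)) (($) v) \<cdot>\<^sub>m density_of v) $$ (i, j)"
    using ij v by (simp add: smult_density_of_index del: index_mult_mat index_smult_mat)
qed (use assms in auto)

lemma density_of_idem:
  assumes v: "v \<in> carrier_vec d" and norm: "nsq d (($) v) = 1"
  shows "density_of v * density_of v = density_of v"
proof -
  have "density_of v * density_of v = density_of v * (1\<^sub>m d * density_of v)"
    using v by (simp add: left_mult_one_mat [of _ d d])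
  also have "\<dots> = ip d (app d (entries (1\<^sub>m d)) (($) v)) (($) v) \<cdot>\<^sub>m density_of v"
    by (rule density_of_sandwich [OF v]) simp
  also have "ip d (app d (entries (1\<^sub>m d)) (($) v)) (($) v) = ip d (($) v) (($) v)"
  proof (rule ip_cong)
    fix k assume "k < d"
    then show "app d (entries (1\<^sub>m d)) (($) v) k = v $ k"
      by (simp add: app_def if_distrib [of "\<lambda>x. x * _"] cong: if_cong)
  qed simp
  finally show ?thesis by (simp add: ip_self norm one_smult_mat)
qed

text \<open>A projector is its own square root, so the modulus in the fidelity is the root of
  \<open>\<rho>\<close> sandwiched between projectors, that is, of a multiple of the projector. Its
  root is explicit.\<close>

lemma fidelity_pure:
  assumes \<rho>: "hermitian_mat d \<rho>" "positive_mat d \<rho>"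
    and v: "v \<in> carrier_vec d" and norm: "nsq d (($) v) = 1"
  shows "fidelity \<rho> (density_of v) = sqrt (Re (ip d (app d (entries \<rho>) (($) v)) (($) v)))"
proof -
  let ?D = "density_of v"
  have D: "?D \<in> carrier_mat d d" using v by simp
  have \<rho>': "\<rho> \<in> carrier_mat d d" using hermitian_mat_carrier [OF \<rho>(1)] .
  have hD: "hermitian_mat d ?D" "positive_mat d ?D"
    using hermitian_smult_density [OF v, of 1] positive_smult_density [OF v, of 1]
    by (simp_all add: one_smult_mat)
  have sD: "mat_sqrt ?D = ?D"
    by (rule mat_sqrt_eqI [OF hD hD(2)]) (rule density_of_idem [OF v norm])
  define R where "R = mat_sqrt \<rho>"
  have R: "hermitian_mat d R" "R * R = \<rho>" using mat_sqrt [OF \<rho>] by (simp_all add: R_def)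
  have R': "R \<in> carrier_mat d d" using hermitian_mat_carrier [OF R(1)] .
  define c where "c = Re (ip d (app d (entries \<rho>) (($) v)) (($) v))"
  have "0 \<le> ip d (app d (entries \<rho>) (($) v)) (($) v)" using \<rho>(2) by (simp add: positive_mat_iff)
  then have c: "0 \<le> c" "ip d (app d (entries \<rho>) (($) v)) (($) v) = of_real c"
    by (auto simp: c_def less_eq_complex_def complex_eq_iff)
  have "mat_adjoint (R * ?D) * (R * ?D) = (?D * R) * (R * ?D)"
    by (simp add: mat_adjoint_mult [OF R' D] hermitian_mat_adjoint [OF R(1)] hermitian_mat_adjoint [OF hD(1)])
  also have "\<dots> = ?D * (R * (R * ?D))"
    by (rule assoc_mult_mat [of _ d d _ d _ d]) (use D R' in auto)
  also have "R * (R * ?D) = \<rho> * ?D"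
    by (subst assoc_mult_mat [of _ d d _ d _ d, symmetric]) (use D R' R(2) in auto)
  also have "?D * (\<rho> * ?D) = of_real c \<cdot>\<^sub>m ?D"
    unfolding density_of_sandwich [OF v \<rho>'] c(2) ..
  finally have MM: "mat_adjoint (R * ?D) * (R * ?D) = of_real c \<cdot>\<^sub>m ?D" .
  have "mat_abs (R * ?D) = of_real (sqrt c) \<cdot>\<^sub>m ?D"
    unfolding mat_abs_def MM
  proof (rule mat_sqrt_eqI [where d = d])
    have "(complex_of_real (sqrt c) \<cdot>\<^sub>m ?D) * (complex_of_real (sqrt c) \<cdot>\<^sub>m ?D)
        = (complex_of_real (sqrt c) * complex_of_real (sqrt c)) \<cdot>\<^sub>m (?D * ?D)"
      using D by (simp add: mult_smult_distrib [of _ d d _ d] mult_smult_assoc_mat [of _ d d _ d] smult_smult_mat)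
    then show "(complex_of_real (sqrt c) \<cdot>\<^sub>m ?D) * (complex_of_real (sqrt c) \<cdot>\<^sub>m ?D) = of_real c \<cdot>\<^sub>m ?D"
      using c(1) by (simp add: density_of_idem [OF v norm] flip: of_real_mult)
  qed (use c(1) v in \<open>simp_all add: hermitian_smult_density positive_smult_density\<close>)
  then have "fidelity \<rho> ?D = Re (mat_trace (of_real (sqrt c) \<cdot>\<^sub>m ?D))"
    by (simp add: fidelity_def sD R_def)
  also have "mat_trace (of_real (sqrt c) \<cdot>\<^sub>m ?D) = of_real (sqrt c) * ip d (($) v) (($) v)"
    using v carrier_matD [OF D]
    by (simp add: mat_trace_def ip_def smult_density_of_index sum_distrib_left del: index_smult_mat(1))
  finally show ?thesis by (simp add: ip_self norm c_def)
qed

section \<open>Ensembles of pure states\<close>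

lemma mat_sum_carrier [simp]: "set As \<subseteq> carrier_mat d d \<Longrightarrow> mat_sum d As \<in> carrier_mat d d"
  by (induction As) (auto simp: mat_sum_def)

lemma mat_sum_index:
  "set As \<subseteq> carrier_mat d d \<Longrightarrow> i < d \<Longrightarrow> j < d \<Longrightarrow> mat_sum d As $$ (i, j) = (\<Sum>A\<leftarrow>As. A $$ (i, j))"
proof (induction As)
  case (Cons A As)
  have "mat_sum d As \<in> carrier_mat d d" using Cons.prems(1) by simp
  then show ?case using Cons by (simp add: mat_sum_def)
qed (simp add: mat_sum_def)

lemma sum_list_sum_swap:
  fixes f :: "'a \<Rightarrow> 'b \<Rightarrow> 'c :: comm_monoid_add"
  shows "(\<Sum>x\<leftarrow>xs. \<Sum>k\<in>A. f x k) = (\<Sum>k\<in>A. \<Sum>x\<leftarrow>xs. f x k)"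
  by (induction xs) (simp_all add: sum.distrib)

text \<open>The vectors are unnormalised, their square norms being the probabilities, so branches of
  probability zero need no special treatment.\<close>

definition mixture :: "nat \<Rightarrow> complex vec list \<Rightarrow> complex mat" where
  "mixture d xs = mat_sum d (map density_of xs)"

lemma mixture_carrier [simp]: "set xs \<subseteq> carrier_vec d \<Longrightarrow> mixture d xs \<in> carrier_mat d d"
  unfolding mixture_def by (intro mat_sum_carrier) auto

lemma mixture_index:
  assumes "set xs \<subseteq> carrier_vec d" "i < d" "j < d"
  shows "mixture d xs $$ (i, j) = (\<Sum>x\<leftarrow>xs. x $ i * cnj (x $ j))"
proof -
  have "mixture d xs $$ (i, j) = (\<Sum>x\<leftarrow>xs. density_of x $$ (i, j))"
    unfolding mixture_def using assms by (subst mat_sum_index) (auto simp: o_def)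
  also have "\<dots> = (\<Sum>x\<leftarrow>xs. x $ i * cnj (x $ j))"
    using assms by (intro arg_cong [where f = sum_list] map_cong refl) (auto simp: density_of_index)
  finally show ?thesis .
qed

lemma mixture_single: "x \<in> carrier_vec d \<Longrightarrow> mixture d [x] = density_of x"
  by (simp add: mixture_def mat_sum_def)

lemma ip_mixture:
  assumes xs: "set xs \<subseteq> carrier_vec d"
  shows "ip d (app d (entries (mixture d xs)) f) f = of_real (\<Sum>x\<leftarrow>xs. (cmod (ip d (($) x) f))\<^sup>2)"
proof -
  have "ip d (app d (entries (mixture d xs)) f) f
      = ip d (app d (\<lambda>k l. \<Sum>i\<in>{..<length xs}. of_real 1 * xs ! i $ k * cnj (xs ! i $ l)) f) f"
    by (intro ip_cong app_cong refl)
      (simp add: mixture_index [OF xs] sum_list_sum_nth atLeast0LessThan)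
  also have "\<dots> = of_real (\<Sum>i\<in>{..<length xs}. 1 * (cmod (ip d f (($) (xs ! i))))\<^sup>2)"
    by (rule ip_rank_one_sum)
  also have "(\<Sum>i\<in>{..<length xs}. 1 * (cmod (ip d f (($) (xs ! i))))\<^sup>2) = (\<Sum>x\<leftarrow>xs. (cmod (ip d (($) x) f))\<^sup>2)"
    by (simp add: sum_list_sum_nth atLeast0LessThan cmod_ip_commute)
  finally show ?thesis .
qed

text \<open>The square of the fidelity with a pure state is linear in the other state, hence a sum
  over the branches of any ensemble for it.\<close>

lemma fidelity_mixture:
  assumes xs: "set xs \<subseteq> carrier_vec d" and v: "v \<in> carrier_vec d" and norm: "nsq d (($) v) = 1"
  shows "fidelity (mixture d xs) (density_of v) = sqrt (\<Sum>x\<leftarrow>xs. (cmod (ip d (($) x) (($) v)))\<^sup>2)"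
proof -
  have "positive_mat d (mixture d xs)"
    unfolding positive_mat_iff ip_mixture [OF xs] using xs
    by (auto simp: complex_of_real_nonneg_iff intro!: sum_list_nonneg)
  moreover have "hermitian_mat d (mixture d xs)"
    unfolding hermitian_mat_def
  proof (intro conjI allI impI)
    fix i j assume "i < d" "j < d"
    then show "mixture d xs $$ (i, j) = cnj (mixture d xs $$ (j, i))"
      by (simp add: mixture_index [OF xs] sum_list_sum_nth mult.commute)
  qed (rule mixture_carrier [OF xs])
  ultimately show ?thesis
    using fidelity_pure [OF _ _ v norm] by (simp add: ip_mixture [OF xs])
qed

section \<open>Kraus operators on pure states\<close>

lemma sum_list_concat: "sum_list (concat xss) = sum_list (map sum_list xss)"
  by (induction xss) simp_all

lemma density_of_conj:
  assumes A: "A \<in> carrier_mat e d" and x: "x \<in> carrier_vec d" and ij: "i < e" "j < e"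
  shows "(\<Sum>k<d. \<Sum>l<d. A $$ (i, k) * (x $ k * cnj (x $ l)) * cnj (A $$ (j, l)))
    = (A *\<^sub>v x) $ i * cnj ((A *\<^sub>v x) $ j)"
  unfolding mult_mat_vec_index [OF A x ij(1)] mult_mat_vec_index [OF A x ij(2)]
  by (simp add: cnj_sum sum_product mult_ac)

lemma kraus_term_index:
  assumes A: "A \<in> carrier_mat e d" and M: "M \<in> carrier_mat d d" and ij: "i < e" "j < e"
  shows "(A * M * mat_adjoint A) $$ (i, j) = (\<Sum>k<d. \<Sum>l<d. A $$ (i, k) * M $$ (k, l) * cnj (A $$ (j, l)))"
proof -
  have "(A * M * mat_adjoint A) $$ (i, j) = (\<Sum>l<d. (\<Sum>k<d. A $$ (i, k) * M $$ (k, l)) * cnj (A $$ (j, l)))"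
    using A M ij
    by (subst mat_mult_index [of _ e d _ e])
      (auto simp: mat_mult_index [OF A M] simp del: index_mult_mat intro!: sum.cong)
  also have "\<dots> = (\<Sum>l<d. \<Sum>k<d. A $$ (i, k) * M $$ (k, l) * cnj (A $$ (j, l)))"
    by (simp add: sum_distrib_right)
  also have "\<dots> = (\<Sum>k<d. \<Sum>l<d. A $$ (i, k) * M $$ (k, l) * cnj (A $$ (j, l)))"
    by (rule sum.swap)
  finally show ?thesis .
qed

text \<open>A Kraus operator splits off a branch of its own even when the outcome does not reveal
  it; only the ensemble is refined, not the state.\<close>

lemma kraus_map_mixture:
  assumes Ks: "set Ks \<subseteq> carrier_mat e d" and xs: "set xs \<subseteq> carrier_vec d"
  shows "kraus_map e Ks (mixture d xs) = mixture e (concat (map (\<lambda>K. map (\<lambda>x. K *\<^sub>v x) xs) Ks))"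
proof (rule eq_matI)
  let ?ys = "concat (map (\<lambda>K. map (\<lambda>x. K *\<^sub>v x) xs) Ks)"
  have ys: "set ?ys \<subseteq> carrier_vec e" using Ks xs by (auto intro: mult_mat_vec_carrier)
  have terms: "set (map (\<lambda>K. K * mixture d xs * mat_adjoint K) Ks) \<subseteq> carrier_mat e e"
  proof -
    have "K * mixture d xs * mat_adjoint K \<in> carrier_mat e e" if "K \<in> set Ks" for K
    proof -
      have "K \<in> carrier_mat e d" using Ks that by auto
      then show ?thesis using xs by (intro mult_carrier_mat [of _ e d] mat_adjoint_carrier mixture_carrier)
    qed
    then show ?thesis by auto
  qed
  show "dim_row (kraus_map e Ks (mixture d xs)) = dim_row (mixture e ?ys)"
    "dim_col (kraus_map e Ks (mixture d xs)) = dim_col (mixture e ?ys)"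
    using mat_sum_carrier [OF terms] mixture_carrier [OF ys] by (auto simp: kraus_map_def)
  fix i j assume "i < dim_row (mixture e ?ys)" "j < dim_col (mixture e ?ys)"
  then have ij: "i < e" "j < e" using mixture_carrier [OF ys] by auto
  have "kraus_map e Ks (mixture d xs) $$ (i, j) = (\<Sum>K\<leftarrow>Ks. (K * mixture d xs * mat_adjoint K) $$ (i, j))"
    unfolding kraus_map_def using ij by (subst mat_sum_index [OF terms]) (simp_all add: o_def)
  also have "\<dots> = (\<Sum>K\<leftarrow>Ks. \<Sum>x\<leftarrow>xs. (K *\<^sub>v x) $ i * cnj ((K *\<^sub>v x) $ j))"
  proof (intro arg_cong [where f = sum_list] map_cong refl)
    fix K assume "K \<in> set Ks"
    then have K: "K \<in> carrier_mat e d" using Ks by auto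
    have "(K * mixture d xs * mat_adjoint K) $$ (i, j)
        = (\<Sum>k<d. \<Sum>l<d. K $$ (i, k) * (\<Sum>x\<leftarrow>xs. x $ k * cnj (x $ l)) * cnj (K $$ (j, l)))"
      unfolding kraus_term_index [OF K mixture_carrier [OF xs] ij]
      by (intro sum.cong refl) (simp add: mixture_index [OF xs])
    also have "\<dots> = (\<Sum>x\<leftarrow>xs. \<Sum>k<d. \<Sum>l<d. K $$ (i, k) * (x $ k * cnj (x $ l)) * cnj (K $$ (j, l)))"
      by (simp add: sum_list_sum_swap sum_list_const_mult [symmetric] sum_list_mult_const [symmetric] o_def)
    also have "\<dots> = (\<Sum>x\<leftarrow>xs. (K *\<^sub>v x) $ i * cnj ((K *\<^sub>v x) $ j))"
      using xs by (intro arg_cong [where f = sum_list] map_cong refl density_of_conj [OF K _ ij]) auto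
    finally show "(K * mixture d xs * mat_adjoint K) $$ (i, j) = (\<Sum>x\<leftarrow>xs. (K *\<^sub>v x) $ i * cnj ((K *\<^sub>v x) $ j))" .
  qed
  also have "\<dots> = (\<Sum>y\<leftarrow>?ys. y $ i * cnj (y $ j))"
    by (simp add: map_concat sum_list_concat o_def)
  also have "\<dots> = mixture e ?ys $$ (i, j)" using mixture_index [OF ys ij] by simp
  finally show "kraus_map e Ks (mixture d xs) $$ (i, j) = mixture e ?ys $$ (i, j)" .
qed

lemma mat_sum_mixture:
  assumes "\<And>i. i \<in> set is \<Longrightarrow> set (f i) \<subseteq> carrier_vec d"
  shows "mat_sum d (map (\<lambda>i. mixture d (f i)) is) = mixture d (concat (map f is))"
proof (rule eq_matI)
  let ?ys = "concat (map f is)"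
  have ys: "set ?ys \<subseteq> carrier_vec d" using assms by auto
  have terms: "set (map (\<lambda>i. mixture d (f i)) is) \<subseteq> carrier_mat d d" using assms by auto
  show "dim_row (mat_sum d (map (\<lambda>i. mixture d (f i)) is)) = dim_row (mixture d ?ys)"
    "dim_col (mat_sum d (map (\<lambda>i. mixture d (f i)) is)) = dim_col (mixture d ?ys)"
    using mat_sum_carrier [OF terms] mixture_carrier [OF ys] by auto
  fix i j assume "i < dim_row (mixture d ?ys)" "j < dim_col (mixture d ?ys)"
  then have ij: "i < d" "j < d" using mixture_carrier [OF ys] by auto
  have "mat_sum d (map (\<lambda>i. mixture d (f i)) is) $$ (i, j) = (\<Sum>a\<leftarrow>is. mixture d (f a) $$ (i, j))"
    using ij by (subst mat_sum_index [OF terms]) (simp_all add: o_def)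
  also have "\<dots> = (\<Sum>a\<leftarrow>is. \<Sum>y\<leftarrow>f a. y $ i * cnj (y $ j))"
    using assms ij by (intro arg_cong [where f = sum_list] map_cong refl mixture_index) auto
  also have "\<dots> = mixture d ?ys $$ (i, j)"
    by (simp add: mixture_index [OF ys ij] map_concat sum_list_concat o_def)
  finally show "mat_sum d (map (\<lambda>i. mixture d (f i)) is) $$ (i, j) = mixture d ?ys $$ (i, j)" .
qed

section \<open>Row-major indices and coefficient matrices\<close>

lemma sum_grid: "(\<Sum>m<a * b. f m) = (\<Sum>k<a. \<Sum>l<b. f (k * b + l :: nat))"
proof -
  have "(\<Sum>m<a * b. f m) = (\<Sum>k<a. sum f {k * b..<k * b + b})" by (rule sum.nat_group [symmetric])
  also have "\<dots> = (\<Sum>k<a. \<Sum>l<b. f (k * b + l))"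
  proof (rule sum.cong [OF refl])
    fix k
    have "sum f {0 + k * b..<b + k * b} = (\<Sum>l\<in>{0..<b}. f (l + k * b))"
      by (rule sum.shift_bounds_nat_ivl)
    then show "sum f {k * b..<k * b + b} = (\<Sum>l<b. f (k * b + l))"
      by (simp add: add.commute atLeast0LessThan)
  qed
  finally show ?thesis .
qed

lemma grid_less: "k < a \<Longrightarrow> l < b \<Longrightarrow> k * b + l < a * (b::nat)"
proof -
  assume "k < a" "l < b"
  then have "k * b + l < Suc k * b" by simp
  also have "\<dots> \<le> a * b" using \<open>k < a\<close> by (intro mult_le_mono1) simp
  finally show ?thesis .
qed

lemma grid_cases:
  assumes "m < a * (b::nat)"
  obtains k l where "k < a" "l < b" "m = k * b + l"
proof
  show "m div b < a" using assms by (simp add: less_mult_imp_div_less)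
  show "m mod b < b" using assms by (cases "b = 0") auto
qed simp

definition coef :: "nat \<Rightarrow> complex vec \<Rightarrow> nat \<Rightarrow> nat \<Rightarrow> complex" where
  "coef b x k l = x $ (k * b + l)"

lemma ip_coef: "ip (a * b) (($) x) (($) y) = (\<Sum>k<a. \<Sum>l<b. coef b x k l * cnj (coef b y k l))"
  by (simp add: ip_def coef_def sum_grid)

lemma nsq_coef: "nsq (a * b) (($) x) = (\<Sum>k<a. \<Sum>l<b. (cmod (coef b x k l))\<^sup>2)"
  by (simp add: nsq_def coef_def sum_grid)

lemma vec_eq_if_coef_eq:
  assumes "x \<in> carrier_vec (a * b)" "y \<in> carrier_vec (a * b)"
    and "\<And>k l. k < a \<Longrightarrow> l < b \<Longrightarrow> coef b x k l = coef b y k l"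
  shows "x = y"
proof (rule eq_vecI)
  fix m assume "m < dim_vec y"
  then have "m < a * b" using assms by auto
  then obtain k l where "k < a" "l < b" "m = k * b + l" by (rule grid_cases)
  then show "x $ m = y $ m" using assms(3) [of k l] by (simp add: coef_def)
qed (use assms in auto)

lemma mat_tensor_carrier [simp]:
  "A \<in> carrier_mat a b \<Longrightarrow> B \<in> carrier_mat c d \<Longrightarrow> mat_tensor A B \<in> carrier_mat (a * c) (b * d)"
  by (auto simp: mat_tensor_def)

lemma mat_tensor_index:
  assumes "A \<in> carrier_mat a b" "B \<in> carrier_mat c d" "i < a" "j < b" "k < c" "l < d"
  shows "mat_tensor A B $$ (i * c + k, j * d + l) = A $$ (i, j) * B $$ (k, l)"
  using assms grid_less [of i a k c] grid_less [of j b l d] by (auto simp: mat_tensor_def)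

lemma coef_tensor:
  assumes A: "A \<in> carrier_mat a' a" and B: "B \<in> carrier_mat b' b" and x: "x \<in> carrier_vec (a * b)"
    and kl: "k < a'" "l < b'"
  shows "coef b' (mat_tensor A B *\<^sub>v x) k l = (\<Sum>i<a. \<Sum>j<b. A $$ (k, i) * B $$ (l, j) * coef b x i j)"
  unfolding coef_def mult_mat_vec_index [OF mat_tensor_carrier [OF A B] x grid_less [OF kl]] sum_grid
  using mat_tensor_index [OF A B kl(1) _ kl(2)] by simp

lemma coef_tensor_A:
  assumes A: "A \<in> carrier_mat a' a" and x: "x \<in> carrier_vec (a * b)" and kl: "k < a'" "l < b"
  shows "coef b (mat_tensor A (1\<^sub>m b) *\<^sub>v x) k l = (\<Sum>i<a. A $$ (k, i) * coef b x i l)"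
  unfolding coef_tensor [OF A one_carrier_mat x kl] using kl(2)
  by (intro sum.cong refl) (simp add: if_distrib [of "\<lambda>x. _ * x"] if_distrib [of "\<lambda>x. x * _"] cong: if_cong)

lemma coef_tensor_B:
  assumes B: "B \<in> carrier_mat b' b" and x: "x \<in> carrier_vec (a * b)" and kl: "k < a" "l < b'"
  shows "coef b' (mat_tensor (1\<^sub>m a) B *\<^sub>v x) k l = (\<Sum>j<b. B $$ (l, j) * coef b x k j)"
proof -
  have "(\<Sum>i<a. \<Sum>j<b. (1\<^sub>m a :: complex mat) $$ (k, i) * B $$ (l, j) * coef b x i j)
      = (\<Sum>i<a. if k = i then \<Sum>j<b. B $$ (l, j) * coef b x i j else 0)"
    using kl(1) by (intro sum.cong refl) auto
  then show ?thesis unfolding coef_tensor [OF one_carrier_mat B x kl] using kl(1) by simp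
qed

section \<open>Monotonicity under LOCC\<close>

text \<open>The choice in \<open>sv\<close> depends only on the entries inside the dimensions, since
  the predicate it chooses from does.\<close>

lemma sv_cong:
  assumes "\<And>k l. k < a \<Longrightarrow> l < b \<Longrightarrow> X k l = Y k l"
  shows "sv a b X = sv a b Y"
proof -
  have "schmidt a b X m p u v = schmidt a b Y m p u v" for m p u v
    unfolding schmidt_def using assms by simp
  then show ?thesis by (simp add: sv_def)
qed

text \<open>
  The index \<open>Some n\<close> yields the sum of the \<open>n\<close> largest Schmidt values and \<open>None\<close> the negated norm;
  monotonicity of both together forces the norm to be preserved.
\<close>

definition ky_fan :: "nat \<times> nat \<Rightarrow> nat option \<Rightarrow> complex vec \<Rightarrow> real" where
  "ky_fan D t x = (case t of
     None \<Rightarrow> - nsq (fst D * snd D) (($) x)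
   | Some n \<Rightarrow> \<Sum>i<n. sv (fst D) (snd D) (coef (snd D) x) i)"

definition ensemble_monotone ::
  "nat \<times> nat \<Rightarrow> nat \<times> nat \<Rightarrow> (complex mat \<Rightarrow> complex mat) \<Rightarrow> bool" where
  "ensemble_monotone D D' \<Lambda> \<longleftrightarrow>
     (\<forall>xs. set xs \<subseteq> carrier_vec (fst D * snd D) \<longrightarrow>
       (\<exists>ys. set ys \<subseteq> carrier_vec (fst D' * snd D') \<and>
         \<Lambda> (mixture (fst D * snd D) xs) = mixture (fst D' * snd D') ys \<and>
         (\<forall>t. (\<Sum>x\<leftarrow>xs. ky_fan D t x) \<le> (\<Sum>y\<leftarrow>ys. ky_fan D' t y))))"

lemma sum_list_swap:
  fixes f :: "'a \<Rightarrow> 'b \<Rightarrow> 'c :: comm_monoid_add"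
  shows "(\<Sum>x\<leftarrow>xs. \<Sum>y\<leftarrow>ys. f x y) = (\<Sum>y\<leftarrow>ys. \<Sum>x\<leftarrow>xs. f x y)"
  by (induction xs) (simp_all add: sum_list_addf)

text \<open>Treats a round of either party: \<open>E i\<close> gives the dimensions that outcome
  \<open>i\<close> leaves, and \<open>L\<close> stands for the extension of a local operator by the
  identity of the other party.\<close>

lemma ensemble_monotone_round:
  fixes L :: "complex mat \<Rightarrow> complex mat" and I :: instrument
  assumes L: "\<And>i K. i < length I \<Longrightarrow> K \<in> set (snd (I ! i)) \<Longrightarrow>
      L K \<in> carrier_mat (fst (E i) * snd (E i)) (fst D * snd D)"
    and \<Lambda>: "\<And>i. i < length I \<Longrightarrow> ensemble_monotone (E i) D' (\<Lambda> i)"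
    and mono: "\<And>t x. x \<in> carrier_vec (fst D * snd D) \<Longrightarrow> ky_fan D t x \<le>
      (\<Sum>i\<leftarrow>[0..<length I]. \<Sum>K\<leftarrow>snd (I ! i). ky_fan (E i) t (L K *\<^sub>v x))"
  shows "ensemble_monotone D D' (\<lambda>\<rho>. mat_sum (fst D' * snd D')
    (map (\<lambda>i. \<Lambda> i (kraus_map (fst (E i) * snd (E i)) (map L (snd (I ! i))) \<rho>)) [0..<length I]))"
  unfolding ensemble_monotone_def
proof (intro allI impI)
  fix xs :: "complex vec list" assume xs: "set xs \<subseteq> carrier_vec (fst D * snd D)"
  let ?d' = "fst D' * snd D'"
  define xs' where "xs' i = concat (map (\<lambda>K. map (\<lambda>x. K *\<^sub>v x) xs) (map L (snd (I ! i))))" for i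
  have xs': "set (xs' i) \<subseteq> carrier_vec (fst (E i) * snd (E i))"
    and kraus: "kraus_map (fst (E i) * snd (E i)) (map L (snd (I ! i))) (mixture (fst D * snd D) xs)
      = mixture (fst (E i) * snd (E i)) (xs' i)" if i: "i < length I" for i
  proof -
    have Ls: "set (map L (snd (I ! i))) \<subseteq> carrier_mat (fst (E i) * snd (E i)) (fst D * snd D)"
      using L [OF i] by auto
    show "set (xs' i) \<subseteq> carrier_vec (fst (E i) * snd (E i))"
      using xs L [OF i] unfolding xs'_def by (auto intro!: mult_mat_vec_carrier)
    show "kraus_map (fst (E i) * snd (E i)) (map L (snd (I ! i))) (mixture (fst D * snd D) xs)
      = mixture (fst (E i) * snd (E i)) (xs' i)"
      unfolding xs'_def by (rule kraus_map_mixture [OF Ls xs])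
  qed
  have "\<exists>ys. set ys \<subseteq> carrier_vec ?d' \<and> \<Lambda> i (mixture (fst (E i) * snd (E i)) (xs' i)) = mixture ?d' ys \<and>
      (\<forall>t. (\<Sum>x\<leftarrow>xs' i. ky_fan (E i) t x) \<le> (\<Sum>y\<leftarrow>ys. ky_fan D' t y))" if "i < length I" for i
    using \<Lambda> [OF that] xs' [OF that] unfolding ensemble_monotone_def by blast
  then obtain ys where ys: "\<And>i. i < length I \<Longrightarrow> set (ys i) \<subseteq> carrier_vec ?d'"
      "\<And>i. i < length I \<Longrightarrow> \<Lambda> i (mixture (fst (E i) * snd (E i)) (xs' i)) = mixture ?d' (ys i)"
      "\<And>i t. i < length I \<Longrightarrow> (\<Sum>x\<leftarrow>xs' i. ky_fan (E i) t x) \<le> (\<Sum>y\<leftarrow>ys i. ky_fan D' t y)"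
    by metis
  let ?ys = "concat (map ys [0..<length I])"
  have "mat_sum ?d' (map (\<lambda>i. \<Lambda> i (kraus_map (fst (E i) * snd (E i)) (map L (snd (I ! i)))
      (mixture (fst D * snd D) xs))) [0..<length I])
      = mat_sum ?d' (map (\<lambda>i. mixture ?d' (ys i)) [0..<length I])"
    by (intro arg_cong [where f = "mat_sum ?d'"] map_cong refl) (simp add: kraus ys(2))
  also have "\<dots> = mixture ?d' ?ys" by (rule mat_sum_mixture) (use ys(1) in auto)
  finally have out: "mat_sum ?d' (map (\<lambda>i. \<Lambda> i (kraus_map (fst (E i) * snd (E i)) (map L (snd (I ! i)))
      (mixture (fst D * snd D) xs))) [0..<length I]) = mixture ?d' ?ys" .
  have "(\<Sum>x\<leftarrow>xs. ky_fan D t x) \<le> (\<Sum>y\<leftarrow>?ys. ky_fan D' t y)" for t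
  proof -
    have "(\<Sum>x\<leftarrow>xs. ky_fan D t x)
        \<le> (\<Sum>x\<leftarrow>xs. \<Sum>i\<leftarrow>[0..<length I]. \<Sum>K\<leftarrow>snd (I ! i). ky_fan (E i) t (L K *\<^sub>v x))"
      using xs by (intro sum_list_mono mono) auto
    also have "\<dots> = (\<Sum>i\<leftarrow>[0..<length I]. \<Sum>x\<leftarrow>xs. \<Sum>K\<leftarrow>snd (I ! i). ky_fan (E i) t (L K *\<^sub>v x))"
      by (rule sum_list_swap)
    also have "\<dots> = (\<Sum>i\<leftarrow>[0..<length I]. \<Sum>K\<leftarrow>snd (I ! i). \<Sum>x\<leftarrow>xs. ky_fan (E i) t (L K *\<^sub>v x))"
      by (subst sum_list_swap) (rule refl)
    also have "\<dots> = (\<Sum>i\<leftarrow>[0..<length I]. \<Sum>x\<leftarrow>xs' i. ky_fan (E i) t x)"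
      by (simp add: xs'_def map_concat sum_list_concat o_def)
    also have "\<dots> \<le> (\<Sum>i\<leftarrow>[0..<length I]. \<Sum>y\<leftarrow>ys i. ky_fan D' t y)"
      by (rule sum_list_mono) (use ys(3) in auto)
    finally show ?thesis by (simp add: map_concat sum_list_concat o_def)
  qed
  moreover have "set ?ys \<subseteq> carrier_vec ?d'" using ys(1) by fastforce
  ultimately show "\<exists>ys. set ys \<subseteq> carrier_vec ?d' \<and>
      mat_sum ?d' (map (\<lambda>i. \<Lambda> i (kraus_map (fst (E i) * snd (E i)) (map L (snd (I ! i)))
        (mixture (fst D * snd D) xs))) [0..<length I]) = mixture ?d' ys \<and>
      (\<forall>t. (\<Sum>x\<leftarrow>xs. ky_fan D t x) \<le> (\<Sum>y\<leftarrow>ys. ky_fan D' t y))"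
    using out by blast
qed

text \<open>Outcomes and their operators become one flat family. Each operator carries its output
  dimension, since outcomes may leave systems of different sizes.\<close>

definition all_kraus :: "instrument \<Rightarrow> (nat \<times> complex mat) list" where
  "all_kraus I = concat (map (\<lambda>(e, Ks). map (Pair e) Ks) I)"

lemma all_kraus_carrier:
  "is_instrument d I \<Longrightarrow> z \<in> set (all_kraus I) \<Longrightarrow> snd z \<in> carrier_mat (fst z) d"
  unfolding is_instrument_def all_kraus_def by fastforce

lemma mat_adjoint_mult_self_index:
  assumes K: "K \<in> carrier_mat e d" and ij: "i < d" "j < d"
  shows "(mat_adjoint K * K) $$ (i, j) = (\<Sum>k<e. cnj (K $$ (k, i)) * K $$ (k, j))"
  unfolding mat_mult_index [OF mat_adjoint_carrier [OF K] K ij] using K ij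
  by (intro sum.cong refl) auto

lemma instrument_kraus_complete:
  assumes I: "is_instrument d I"
  shows "kraus_complete d {..<length (all_kraus I)} (\<lambda>z. fst (all_kraus I ! z))
    (\<lambda>z. entries (snd (all_kraus I ! z)))"
proof -
  have "map snd (all_kraus I) = concat (map snd I)"
    by (simp add: all_kraus_def map_concat o_def case_prod_unfold)
  then have one: "mat_sum d (map (\<lambda>z. mat_adjoint (snd z) * snd z) (all_kraus I)) = 1\<^sub>m d"
    using I unfolding is_instrument_def by (metis (mono_tags, lifting) map_map comp_apply map_eq_conv)
  have "(\<Sum>z<length (all_kraus I). \<Sum>k<fst (all_kraus I ! z).
      cnj (snd (all_kraus I ! z) $$ (k, i)) * snd (all_kraus I ! z) $$ (k, j)) = (if i = j then 1 else 0)"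
    if ij: "i < d" "j < d" for i j
  proof -
    have "set (map (\<lambda>z. mat_adjoint (snd z) * snd z) (all_kraus I)) \<subseteq> carrier_mat d d"
      using all_kraus_carrier [OF I] by fastforce
    from mat_sum_index [OF this ij]
    have "1\<^sub>m d $$ (i, j) = (\<Sum>z\<leftarrow>all_kraus I. (mat_adjoint (snd z) * snd z) $$ (i, j))"
      unfolding one by (simp add: o_def del: index_mult_mat)
    also have "\<dots> = (\<Sum>z\<leftarrow>all_kraus I. \<Sum>k<fst z. cnj (snd z $$ (k, i)) * snd z $$ (k, j))"
      by (intro arg_cong [where f = sum_list] map_cong refl mat_adjoint_mult_self_index [where d = d]
          all_kraus_carrier [OF I] ij)
    finally show ?thesis using ij by (simp add: sum_list_sum_nth atLeast0LessThan)
  qed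
  then show ?thesis by (simp add: kraus_complete_def)
qed

lemma sum_all_kraus:
  "(\<Sum>z<length (all_kraus I). f (fst (all_kraus I ! z)) (snd (all_kraus I ! z)))
    = (\<Sum>i\<leftarrow>[0..<length I]. \<Sum>K\<leftarrow>snd (I ! i). f (fst (I ! i)) K)"
proof -
  have "(\<Sum>z<length (all_kraus I). f (fst (all_kraus I ! z)) (snd (all_kraus I ! z)))
      = (\<Sum>z\<leftarrow>all_kraus I. f (fst z) (snd z))"
    by (simp add: sum_list_sum_nth atLeast0LessThan)
  also have "\<dots> = (\<Sum>i\<leftarrow>I. \<Sum>K\<leftarrow>snd i. f (fst i) K)"
    by (simp add: all_kraus_def map_concat sum_list_concat o_def case_prod_unfold)
  also have "\<dots> = sum_list (map (\<lambda>i. \<Sum>K\<leftarrow>snd i. f (fst i) K) (map ((!) I) [0..<length I]))"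
    by (simp only: map_nth)
  finally show ?thesis by (simp add: o_def)
qed

lemma ky_fan_instrument_A:
  assumes I: "is_instrument a I" and x: "x \<in> carrier_vec (a * b)"
  shows "ky_fan (a, b) t x \<le> (\<Sum>i\<leftarrow>[0..<length I]. \<Sum>K\<leftarrow>snd (I ! i).
    ky_fan (fst (I ! i), b) t (mat_tensor K (1\<^sub>m b) *\<^sub>v x))"
proof -
  let ?Z = "{..<length (all_kraus I)}"
  let ?e = "\<lambda>z. fst (all_kraus I ! z)"
  let ?K = "\<lambda>z. snd (all_kraus I ! z)"
  let ?X = "\<lambda>z k l. \<Sum>i<a. ?K z $$ (k, i) * coef b x i l"
  note complete = instrument_kraus_complete [OF I]
  have coef: "coef b (mat_tensor (?K z) (1\<^sub>m b) *\<^sub>v x) k l = ?X z k l"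
    if "z \<in> ?Z" "k < ?e z" "l < b" for z k l
    by (rule coef_tensor_A [OF all_kraus_carrier [OF I nth_mem] x]) (use that in auto)
  have "ky_fan (a, b) t x \<le> (\<Sum>z\<in>?Z. ky_fan (?e z, b) t (mat_tensor (?K z) (1\<^sub>m b) *\<^sub>v x))"
  proof (cases t)
    case None
    \<comment> \<open>Each column of the coefficient matrix is transformed separately, so
      completeness conserves its norm.\<close>
    have "(\<Sum>z\<in>?Z. nsq (?e z * b) (($) (mat_tensor (?K z) (1\<^sub>m b) *\<^sub>v x)))
        = (\<Sum>z\<in>?Z. \<Sum>l<b. nsq (?e z) (\<lambda>k. ?X z k l))"
      unfolding nsq_coef unfolding nsq_def by (subst (2) sum.swap) (simp add: coef)
    also have "\<dots> = (\<Sum>l<b. \<Sum>z\<in>?Z. nsq (?e z) (\<lambda>k. ?X z k l))" by (rule sum.swap)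
    also have "\<dots> = (\<Sum>l<b. nsq a (\<lambda>i. coef b x i l))"
      by (simp only: kraus_complete_nsq [OF complete])
    also have "\<dots> = nsq (a * b) (($) x)"
      unfolding nsq_coef unfolding nsq_def by (rule sum.swap)
    finally show ?thesis using None by (simp add: ky_fan_def sum_negf)
  next
    case (Some n)
    have sv_eq: "sv (?e z) b (?X z) = sv (?e z) b (coef b (mat_tensor (?K z) (1\<^sub>m b) *\<^sub>v x))" if "z \<in> ?Z" for z
      by (rule sv_cong) (rule coef [OF that, symmetric])
    have "(\<Sum>i<n. sv a b (coef b x) i) \<le> (\<Sum>z\<in>?Z. \<Sum>i<n. sv (?e z) b (?X z) i)"
      by (rule sv_majorized_kraus_A [OF complete])
    also have "\<dots> = (\<Sum>z\<in>?Z. \<Sum>i<n. sv (?e z) b (coef b (mat_tensor (?K z) (1\<^sub>m b) *\<^sub>v x)) i)"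
      by (rule sum.cong [OF refl]) (simp only: sv_eq)
    finally show ?thesis using Some by (simp add: ky_fan_def)
  qed
  then show ?thesis
    by (simp only: sum_all_kraus [of "\<lambda>e K. ky_fan (e, b) t (mat_tensor K (1\<^sub>m b) *\<^sub>v x)"])
qed

lemma ky_fan_instrument_B:
  assumes I: "is_instrument b I" and x: "x \<in> carrier_vec (a * b)"
  shows "ky_fan (a, b) t x \<le> (\<Sum>i\<leftarrow>[0..<length I]. \<Sum>K\<leftarrow>snd (I ! i).
    ky_fan (a, fst (I ! i)) t (mat_tensor (1\<^sub>m a) K *\<^sub>v x))"
proof -
  let ?Z = "{..<length (all_kraus I)}"
  let ?e = "\<lambda>z. fst (all_kraus I ! z)"
  let ?K = "\<lambda>z. snd (all_kraus I ! z)"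
  let ?X = "\<lambda>z k l. \<Sum>i<b. ?K z $$ (l, i) * coef b x k i"
  note complete = instrument_kraus_complete [OF I]
  have coef: "coef (?e z) (mat_tensor (1\<^sub>m a) (?K z) *\<^sub>v x) k l = ?X z k l"
    if "z \<in> ?Z" "k < a" "l < ?e z" for z k l
    by (rule coef_tensor_B [OF all_kraus_carrier [OF I nth_mem] x]) (use that in auto)
  have "ky_fan (a, b) t x \<le> (\<Sum>z\<in>?Z. ky_fan (a, ?e z) t (mat_tensor (1\<^sub>m a) (?K z) *\<^sub>v x))"
  proof (cases t)
    case None
    have "(\<Sum>z\<in>?Z. nsq (a * ?e z) (($) (mat_tensor (1\<^sub>m a) (?K z) *\<^sub>v x)))
        = (\<Sum>z\<in>?Z. \<Sum>k<a. nsq (?e z) (\<lambda>l. ?X z k l))"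
      unfolding nsq_coef unfolding nsq_def by (simp add: coef)
    also have "\<dots> = (\<Sum>k<a. \<Sum>z\<in>?Z. nsq (?e z) (\<lambda>l. ?X z k l))" by (rule sum.swap)
    also have "\<dots> = (\<Sum>k<a. nsq b (coef b x k))"
      by (simp only: kraus_complete_nsq [OF complete])
    also have "\<dots> = nsq (a * b) (($) x)"
      unfolding nsq_coef unfolding nsq_def ..
    finally show ?thesis using None by (simp add: ky_fan_def sum_negf)
  next
    case (Some n)
    have sv_eq: "sv a (?e z) (?X z) = sv a (?e z) (coef (?e z) (mat_tensor (1\<^sub>m a) (?K z) *\<^sub>v x))" if "z \<in> ?Z" for z
      by (rule sv_cong) (rule coef [OF that, symmetric])
    have "(\<Sum>i<n. sv a b (coef b x) i) \<le> (\<Sum>z\<in>?Z. \<Sum>i<n. sv a (?e z) (?X z) i)"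
      by (rule sv_majorized_kraus_B [OF complete])
    also have "\<dots> = (\<Sum>z\<in>?Z. \<Sum>i<n. sv a (?e z) (coef (?e z) (mat_tensor (1\<^sub>m a) (?K z) *\<^sub>v x)) i)"
      by (rule sum.cong [OF refl]) (simp only: sv_eq)
    finally show ?thesis using Some by (simp add: ky_fan_def)
  qed
  then show ?thesis
    by (simp only: sum_all_kraus [of "\<lambda>e K. ky_fan (a, e) t (mat_tensor (1\<^sub>m a) K *\<^sub>v x)"])
qed

lemma locc_ensemble_monotone: "locc D D' \<Lambda> \<Longrightarrow> ensemble_monotone D D' \<Lambda>"
proof (induction rule: locc.induct)
  case (locc_id D)
  show ?case unfolding ensemble_monotone_def by auto
next
  case (locc_A dA I dB dA' dB' \<Lambda>)
  have K: "K \<in> carrier_mat (fst (I ! i)) dA" if "i < length I" "K \<in> set (snd (I ! i))" for i K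
    using locc_A(1) nth_mem [OF that(1)] that(2) unfolding is_instrument_def by fastforce
  have "ensemble_monotone (dA, dB) (dA', dB') (\<lambda>\<rho>. mat_sum (fst (dA', dB') * snd (dA', dB'))
    (map (\<lambda>i. \<Lambda> i (kraus_map (fst (fst (I ! i), dB) * snd (fst (I ! i), dB))
      (map (\<lambda>K. mat_tensor K (1\<^sub>m dB)) (snd (I ! i))) \<rho>)) [0..<length I]))"
    by (rule ensemble_monotone_round)
      (use locc_A K ky_fan_instrument_A [OF locc_A(1)] in \<open>auto intro!: mat_tensor_carrier\<close>)
  then show ?case by simp
next
  case (locc_B dB I dA dA' dB' \<Lambda>)
  have K: "K \<in> carrier_mat (fst (I ! i)) dB" if "i < length I" "K \<in> set (snd (I ! i))" for i K
    using locc_B(1) nth_mem [OF that(1)] that(2) unfolding is_instrument_def by fastforce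
  have "ensemble_monotone (dA, dB) (dA', dB') (\<lambda>\<rho>. mat_sum (fst (dA', dB') * snd (dA', dB'))
    (map (\<lambda>i. \<Lambda> i (kraus_map (fst (dA, fst (I ! i)) * snd (dA, fst (I ! i)))
      (map (\<lambda>K. mat_tensor (1\<^sub>m dA) K) (snd (I ! i))) \<rho>)) [0..<length I]))"
    by (rule ensemble_monotone_round)
      (use locc_B K ky_fan_instrument_B [OF locc_B(1)] in \<open>auto intro!: mat_tensor_carrier\<close>)
  then show ?case by simp
qed

section \<open>Nielsen's protocol\<close>

text \<open>Index set and order are free, so that a tensor power fits with words as indices; sorting
  happens only where spectra are compared.\<close>

definition schmidt_vec :: "nat \<Rightarrow> nat \<Rightarrow> 'i set \<Rightarrow> ('i \<Rightarrow> real) \<Rightarrow>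
    ('i \<Rightarrow> nat \<Rightarrow> complex) \<Rightarrow> ('i \<Rightarrow> nat \<Rightarrow> complex) \<Rightarrow> complex vec" where
  "schmidt_vec dA dB I p a b =
     vec (dA * dB) (\<lambda>m. \<Sum>i\<in>I. of_real (sqrt (p i)) * a i (m div dB) * b i (m mod dB))"

lemma schmidt_vec_carrier [simp]: "schmidt_vec dA dB I p a b \<in> carrier_vec (dA * dB)"
  by (simp add: schmidt_vec_def)

lemma dim_schmidt_vec [simp]: "dim_vec (schmidt_vec dA dB I p a b) = dA * dB"
  by (simp add: schmidt_vec_def)

lemma dim_density_of [simp]: "dim_row (density_of v) = dim_vec v" "dim_col (density_of v) = dim_vec v"
  by (simp_all add: density_of_def)

lemma coef_schmidt_vec:
  "k < dA \<Longrightarrow> l < dB \<Longrightarrow>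
    coef dB (schmidt_vec dA dB I p a b) k l = (\<Sum>i\<in>I. of_real (sqrt (p i)) * a i k * b i l)"
  using grid_less [of k dA l dB] by (simp add: schmidt_vec_def coef_def)

lemma mat_sum_adjoint_eq_one:
  assumes Ks: "set Ks \<subseteq> carrier_mat e d"
    and one: "\<And>i j. i < d \<Longrightarrow> j < d \<Longrightarrow>
      (\<Sum>K\<leftarrow>Ks. \<Sum>k<e. cnj (K $$ (k, i)) * K $$ (k, j)) = (if i = j then 1 else 0)"
  shows "mat_sum d (map (\<lambda>K. mat_adjoint K * K) Ks) = 1\<^sub>m d"
proof (rule eq_matI)
  have terms: "set (map (\<lambda>K. mat_adjoint K * K) Ks) \<subseteq> carrier_mat d d"
    using Ks by fastforce
  show "dim_row (mat_sum d (map (\<lambda>K. mat_adjoint K * K) Ks)) = dim_row (1\<^sub>m d)"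
    "dim_col (mat_sum d (map (\<lambda>K. mat_adjoint K * K) Ks)) = dim_col (1\<^sub>m d)"
    using mat_sum_carrier [OF terms] by auto
  fix i j assume "i < dim_row (1\<^sub>m d :: complex mat)" "j < dim_col (1\<^sub>m d :: complex mat)"
  then have ij: "i < d" "j < d" by simp_all
  have "mat_sum d (map (\<lambda>K. mat_adjoint K * K) Ks) $$ (i, j) = (\<Sum>K\<leftarrow>Ks. (mat_adjoint K * K) $$ (i, j))"
    by (simp add: mat_sum_index [OF terms ij] o_def del: index_mult_mat)
  also have "\<dots> = (\<Sum>K\<leftarrow>Ks. \<Sum>k<e. cnj (K $$ (k, i)) * K $$ (k, j))"
    using Ks ij
    by (intro arg_cong [where f = sum_list] map_cong refl mat_adjoint_mult_self_index) auto
  finally show "mat_sum d (map (\<lambda>K. mat_adjoint K * K) Ks) $$ (i, j) = 1\<^sub>m d $$ (i, j)"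
    using one ij by simp
qed

text \<open>One-way communication: outcome \<open>s\<close> of the first party bundles the operators
  \<open>Ks s\<close>, and the second party answers with the channel \<open>Vs s\<close>. Bundling
  lets completing operators accompany a main one in the same outcome.\<close>

lemma locc_two_rounds:
  assumes dims: "0 < dA'" "0 < dB'" and x: "x \<in> carrier_vec (dA * dB)"
    and Ks: "\<And>s. s \<in> set ss \<Longrightarrow> set (Ks s) \<subseteq> carrier_mat dA' dA"
    and Vs: "\<And>s. s \<in> set ss \<Longrightarrow> set (Vs s) \<subseteq> carrier_mat dB' dB"
    and Ks_one: "\<And>i j. i < dA \<Longrightarrow> j < dA \<Longrightarrow>
      (\<Sum>s\<leftarrow>ss. \<Sum>K\<leftarrow>Ks s. \<Sum>k<dA'. cnj (K $$ (k, i)) * K $$ (k, j)) = (if i = j then 1 else 0)"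
    and Vs_one: "\<And>s i j. s \<in> set ss \<Longrightarrow> i < dB \<Longrightarrow> j < dB \<Longrightarrow>
      (\<Sum>V\<leftarrow>Vs s. \<Sum>k<dB'. cnj (V $$ (k, i)) * V $$ (k, j)) = (if i = j then 1 else 0)"
  shows "\<exists>\<Lambda>. locc (dA, dB) (dA', dB') \<Lambda> \<and> \<Lambda> (density_of x) = mixture (dA' * dB')
    (concat (map (\<lambda>s. concat (map (\<lambda>V. map (\<lambda>K.
      mat_tensor (1\<^sub>m dA') V *\<^sub>v (mat_tensor K (1\<^sub>m dB) *\<^sub>v x)) (Ks s)) (Vs s))) ss))"
proof -
  let ?d' = "dA' * dB'"
  define I where "I = map (\<lambda>s. (dA', Ks s)) ss"
  define J where "J s = [(dB', Vs s)]" for s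
  have I: "is_instrument dA I"
    unfolding is_instrument_def
  proof
    show "\<forall>(e, Ks)\<in>set I. 0 < e \<and> set Ks \<subseteq> carrier_mat e dA" using dims Ks by (auto simp: I_def)
    have "concat (map snd I) = concat (map Ks ss)" by (simp add: I_def o_def)
    moreover have "mat_sum dA (map (\<lambda>K. mat_adjoint K * K) (concat (map Ks ss))) = 1\<^sub>m dA"
    proof (rule mat_sum_adjoint_eq_one)
      show "set (concat (map Ks ss)) \<subseteq> carrier_mat dA' dA" using Ks by auto
      show "(\<Sum>K\<leftarrow>concat (map Ks ss). \<Sum>k<dA'. cnj (K $$ (k, i)) * K $$ (k, j)) = (if i = j then 1 else 0)"
        if "i < dA" "j < dA" for i j
        using Ks_one [OF that] by (simp add: map_concat sum_list_concat o_def)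
    qed
    ultimately show "mat_sum dA (map (\<lambda>K. mat_adjoint K * K) (concat (map snd I))) = 1\<^sub>m dA"
      by (simp only:)
  qed
  have J: "is_instrument dB (J s)" if s: "s \<in> set ss" for s
  proof -
    have "mat_sum dB (map (\<lambda>K. mat_adjoint K * K) (Vs s)) = 1\<^sub>m dB"
      by (rule mat_sum_adjoint_eq_one [OF Vs [OF s] Vs_one [OF s]])
    then show ?thesis unfolding is_instrument_def using dims Vs [OF s] by (simp add: J_def)
  qed
  define \<Lambda>B where "\<Lambda>B s = (\<lambda>\<rho>. mat_sum ?d'
    (map (\<lambda>i. (\<lambda>\<rho>. \<rho>) (kraus_map (dA' * fst (J s ! i)) (map (\<lambda>K. mat_tensor (1\<^sub>m dA') K) (snd (J s ! i))) \<rho>))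
      [0..<length (J s)]))" for s
  have loccB: "locc (dA', dB) (dA', dB') (\<Lambda>B s)" if "s \<in> set ss" for s
    unfolding \<Lambda>B_def
  proof (rule locc_B [OF J [OF that]])
    show "\<forall>i<length (J s). locc (dA', fst (J s ! i)) (dA', dB') (\<lambda>\<rho>. \<rho>)"
      by (simp add: J_def locc_id)
  qed
  define \<Lambda> where "\<Lambda> = (\<lambda>\<rho>. mat_sum ?d'
    (map (\<lambda>i. \<Lambda>B (ss ! i) (kraus_map (fst (I ! i) * dB) (map (\<lambda>K. mat_tensor K (1\<^sub>m dB)) (snd (I ! i))) \<rho>))
      [0..<length I]))"
  have "locc (dA, dB) (dA', dB') \<Lambda>"
    unfolding \<Lambda>_def
  proof (rule locc_A [OF I])
    show "\<forall>i<length I. locc (fst (I ! i), dB) (dA', dB') (\<Lambda>B (ss ! i))"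
      using loccB by (simp add: I_def)
  qed
  define xs where "xs s = map (\<lambda>K. mat_tensor K (1\<^sub>m dB) *\<^sub>v x) (Ks s)" for s
  define ys where "ys s = concat (map (\<lambda>V. map (\<lambda>K.
      mat_tensor (1\<^sub>m dA') V *\<^sub>v (mat_tensor K (1\<^sub>m dB) *\<^sub>v x)) (Ks s)) (Vs s))" for s
  have xs: "set (xs s) \<subseteq> carrier_vec (dA' * dB)" if "s \<in> set ss" for s
    using Ks [OF that] x unfolding xs_def by (auto intro!: mult_mat_vec_carrier mat_tensor_carrier)
  have A: "kraus_map (dA' * dB) (map (\<lambda>K. mat_tensor K (1\<^sub>m dB)) (Ks s)) (density_of x)
      = mixture (dA' * dB) (xs s)" if "s \<in> set ss" for s
  proof -
    have "set (map (\<lambda>K. mat_tensor K (1\<^sub>m dB)) (Ks s)) \<subseteq> carrier_mat (dA' * dB) (dA * dB)"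
      using Ks [OF that] by (auto intro!: mat_tensor_carrier)
    from kraus_map_mixture [OF this, of "[x]"] x show ?thesis
      by (simp add: mixture_single xs_def o_def)
  qed
  have ys: "set (ys s) \<subseteq> carrier_vec ?d'"
    and B: "\<Lambda>B s (mixture (dA' * dB) (xs s)) = mixture ?d' (ys s)" if s: "s \<in> set ss" for s
  proof -
    have 1: "set (map (\<lambda>K. mat_tensor (1\<^sub>m dA') K) (Vs s)) \<subseteq> carrier_mat (dA' * dB') (dA' * dB)"
      using Vs [OF s] by (auto intro!: mat_tensor_carrier)
    have "mat_tensor (1\<^sub>m dA') W *\<^sub>v v \<in> carrier_vec ?d'" if "W \<in> set (Vs s)" "v \<in> set (xs s)" for W v
      by (rule mult_mat_vec_carrier [of _ _ "dA' * dB"]) (use 1 xs [OF s] that in auto)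
    then show ys: "set (ys s) \<subseteq> carrier_vec ?d'"
      unfolding ys_def by (auto simp: xs_def)
    have "kraus_map ?d' (map (\<lambda>K. mat_tensor (1\<^sub>m dA') K) (Vs s)) (mixture (dA' * dB) (xs s)) = mixture ?d' (ys s)"
      using kraus_map_mixture [OF 1 xs [OF s]] by (simp add: ys_def xs_def o_def)
    then show "\<Lambda>B s (mixture (dA' * dB) (xs s)) = mixture ?d' (ys s)"
      using mixture_carrier [OF ys] by (simp add: \<Lambda>B_def J_def mat_sum_def)
  qed
  have "\<Lambda> (density_of x) = mat_sum ?d' (map (\<lambda>i. mixture ?d' (ys (ss ! i))) [0..<length ss])"
    unfolding \<Lambda>_def
    by (intro arg_cong [where f = "mat_sum ?d'"] map_cong) (simp_all add: I_def A B)
  also have "map (\<lambda>i. mixture ?d' (ys (ss ! i))) [0..<length ss] = map (\<lambda>s. mixture ?d' (ys s)) (map ((!) ss) [0..<length ss])"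
    by simp
  also have "map ((!) ss) [0..<length ss] = ss" by (rule map_nth)
  also have "mat_sum ?d' (map (\<lambda>s. mixture ?d' (ys s)) ss) = mixture ?d' (concat (map ys ss))"
    by (rule mat_sum_mixture) (rule ys)
  finally show ?thesis using \<open>locc (dA, dB) (dA', dB') \<Lambda>\<close> unfolding ys_def by blast
qed

text \<open>Orthonormality of \<open>e\<close> collapses the double sum. With suitable weights
  \<open>s\<close> this serves the measurement of the first party, with weights 1 the isometry of
  the second.\<close>

lemma partial_isometry_gram:
  assumes e: "onf d' J e" and J: "finite J"
  shows "(\<Sum>k<d'. cnj (\<Sum>m\<in>J. s m * e m k * cnj (a m i)) * (\<Sum>m\<in>J. s m * e m k * cnj (a m j)))
    = (\<Sum>m\<in>J. of_real ((cmod (s m))\<^sup>2) * (a m i * cnj (a m j)))"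
proof -
  have "(\<Sum>k<d'. cnj (\<Sum>m\<in>J. s m * e m k * cnj (a m i)) * (\<Sum>m\<in>J. s m * e m k * cnj (a m j)))
      = ip d' (\<lambda>k. \<Sum>m\<in>J. (s m * cnj (a m j)) * e m k) (\<lambda>k. \<Sum>m\<in>J. (s m * cnj (a m i)) * e m k)"
    by (simp add: ip_def mult_ac)
  also have "\<dots> = (\<Sum>m\<in>J. cnj (s m * cnj (a m i)) * (s m * cnj (a m j)))"
    unfolding ip_sum_right by (simp add: onf_coeff [OF e J])
  also have "\<dots> = (\<Sum>m\<in>J. of_real ((cmod (s m))\<^sup>2) * (a m i * cnj (a m j)))"
    by (simp only: complex_norm_square complex_cnj_mult complex_cnj_cnj mult_ac)
  finally show ?thesis .
qed

text \<open>
  The first party applies the Kraus operators \<open>M \<pi>\<close>, one for each permutation \<open>\<pi>\<close> in a convex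
  combination that expresses \<open>p\<close> by \<open>q\<close>, the second party the partial isometry \<open>V \<pi>\<close>. The operators
  \<open>T\<close> and \<open>U\<close> annihilate the state and only complete the instruments.
\<close>

lemma nielsen:
  fixes c c' :: nat
  assumes dims: "0 < dA'" "0 < dB'"
    and a: "onf dA {..<c} a" and b: "onf dB {..<c} b"
    and e: "onf dA' {..<c'} e" and f: "onf dB' {..<c'} f"
    and p: "antimono p" "\<And>i. i < c \<Longrightarrow> 0 < p i" "\<And>i. c \<le> i \<Longrightarrow> p i = 0"
    and q: "antimono q" "\<And>i. 0 \<le> q i" "\<And>i. c' \<le> i \<Longrightarrow> q i = 0"
    and maj: "\<And>l. (\<Sum>i<l. p i) \<le> (\<Sum>i<l. q i)" and total: "(\<Sum>i<c. p i) = (\<Sum>i<c'. q i)"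
  shows "\<exists>\<Lambda>. locc (dA, dB) (dA', dB') \<Lambda> \<and>
    \<Lambda> (density_of (schmidt_vec dA dB {..<c} p a b)) = density_of (schmidt_vec dA' dB' {..<c'} q e f)"
proof -
  let ?x = "schmidt_vec dA dB {..<c} p a b"
  let ?y = "schmidt_vec dA' dB' {..<c'} q e f"
  have q_less: "j < c'" if "q j \<noteq> 0" for j using q(3) that by (meson not_less)
  \<comment> \<open>Zeros pad both spectra to a common length, on which permutations can
    act.\<close>
  define R where "R = max c c'"
  have "(\<Sum>i<R. p i) = (\<Sum>i<c. p i)"
    by (rule sum.mono_neutral_right) (use p(3) in \<open>auto simp: R_def\<close>)
  moreover have "(\<Sum>i<R. q i) = (\<Sum>i<c'. q i)"
    by (rule sum.mono_neutral_right) (use q(3) in \<open>auto simp: R_def\<close>)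
  ultimately have total': "(\<Sum>i<R. p i) = (\<Sum>i<R. q i)" using total by simp
  have "\<exists>w. (\<forall>\<pi>. 0 \<le> w \<pi>) \<and> (\<Sum>\<pi> | \<pi> permutes {..<R}. w \<pi>) = 1 \<and>
      (\<forall>i<R. p i = (\<Sum>\<pi> | \<pi> permutes {..<R}. w \<pi> * q (\<pi> i)))"
    by (rule majorization_imp_convex_permutations) (use p(1) q(1) maj total' in \<open>auto dest: antimonoD\<close>)
  then obtain w where "(\<forall>\<pi>. 0 \<le> w \<pi>) \<and> (\<Sum>\<pi> | \<pi> permutes {..<R}. w \<pi>) = 1 \<and>
      (\<forall>i<R. p i = (\<Sum>\<pi> | \<pi> permutes {..<R}. w \<pi> * q (\<pi> i)))" ..
  then have w: "\<And>\<pi>. 0 \<le> w \<pi>" "(\<Sum>\<pi> | \<pi> permutes {..<R}. w \<pi>) = 1"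
      "\<And>i. i < R \<Longrightarrow> p i = (\<Sum>\<pi> | \<pi> permutes {..<R}. w \<pi> * q (\<pi> i))"
    by simp_all
  have sqrt_w: "complex_of_real (sqrt (w \<pi>)) * of_real (sqrt (w \<pi>)) = of_real (w \<pi>)" for \<pi>
    using w(1) [of \<pi>] by (simp flip: of_real_mult)
  have fin: "finite {\<pi>. \<pi> permutes {..<R}}" by (simp add: finite_permutations)
  then obtain ss where ss: "set ss = {\<pi>. \<pi> permutes {..<R}}" "distinct ss"
    using finite_distinct_list by blast
  have sum_ss: "(\<Sum>\<pi>\<leftarrow>ss. g \<pi>) = (\<Sum>\<pi> | \<pi> permutes {..<R}. g \<pi>)" for g :: "(nat \<Rightarrow> nat) \<Rightarrow> complex"
    using sum_list_distinct_conv_sum_set [OF ss(2), of g] ss(1) by simp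
  \<comment> \<open>The places where a source vector \<open>a m\<close> meets an existing target
    vector \<open>e (\<pi> m)\<close>.\<close>
  define J where "J \<pi> = {m. m < c \<and> \<pi> m < c'}" for \<pi> :: "nat \<Rightarrow> nat"
  have J: "finite (J \<pi>)" "J \<pi> \<subseteq> {..<c}" for \<pi> by (auto simp: J_def)
  have e\<pi>: "onf dA' (J \<pi>) (\<lambda>m. e (\<pi> m))" and f\<pi>: "onf dB' (J \<pi>) (\<lambda>m. f (\<pi> m))"
    if "\<pi> permutes {..<R}" for \<pi>
    using permutes_inj_on [OF that] by (auto simp: J_def intro!: onf_reindex [OF e] onf_reindex [OF f])
  have a\<pi>: "onf dA (J \<pi>) a" and b\<pi>: "onf dB (J \<pi>) b" for \<pi>
    using onf_subset [OF a] onf_subset [OF b] J by auto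
  from onf_complement [OF a finite_lessThan]
  obtain na :: nat where "\<exists>ca. (\<forall>i\<in>{..<c}. \<forall>j<na. ip dA (a i) (ca j) = 0) \<and> (\<forall>m<dA. \<forall>k<dA.
    (\<Sum>i<c. cnj (a i m) * a i k) + (\<Sum>j<na. cnj (ca j m) * ca j k) = (if k = m then 1 else 0))" ..
  then obtain ca where "(\<forall>i\<in>{..<c}. \<forall>j<na. ip dA (a i) (ca j) = 0) \<and> (\<forall>m<dA. \<forall>k<dA.
    (\<Sum>i<c. cnj (a i m) * a i k) + (\<Sum>j<na. cnj (ca j m) * ca j k) = (if k = m then 1 else 0))" ..
  then have ca: "\<And>i j. i < c \<Longrightarrow> j < na \<Longrightarrow> ip dA (a i) (ca j) = 0"
    "\<And>m k. m < dA \<Longrightarrow> k < dA \<Longrightarrow>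
      (\<Sum>i<c. cnj (a i m) * a i k) + (\<Sum>j<na. cnj (ca j m) * ca j k) = (if k = m then 1 else 0)"
    by simp_all
  \<comment> \<open>\<open>V \<pi>\<close> starts from the span of \<open>b\<close> over
    \<open>J \<pi>\<close>, so its completion depends on \<open>\<pi>\<close>, unlike that of the
    first party.\<close>
  have "\<forall>\<pi>. \<exists>n::nat. \<exists>cb. (\<forall>i\<in>J \<pi>. \<forall>j<n. ip dB (b i) (cb j) = 0) \<and> (\<forall>m<dB. \<forall>k<dB.
    (\<Sum>i\<in>J \<pi>. cnj (b i m) * b i k) + (\<Sum>j<n. cnj (cb j m) * cb j k) = (if k = m then 1 else 0))"
    using onf_complement [OF b\<pi> J(1)] by (intro allI)
  from choice [OF this] obtain nb :: "(nat \<Rightarrow> nat) \<Rightarrow> nat" where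
    "\<forall>\<pi>. \<exists>cb. (\<forall>i\<in>J \<pi>. \<forall>j<nb \<pi>. ip dB (b i) (cb j) = 0) \<and> (\<forall>m<dB. \<forall>k<dB.
      (\<Sum>i\<in>J \<pi>. cnj (b i m) * b i k) + (\<Sum>j<nb \<pi>. cnj (cb j m) * cb j k) = (if k = m then 1 else 0))" ..
  from choice [OF this] obtain cb where
    "\<forall>\<pi>. (\<forall>i\<in>J \<pi>. \<forall>j<nb \<pi>. ip dB (b i) (cb \<pi> j) = 0) \<and> (\<forall>m<dB. \<forall>k<dB.
      (\<Sum>i\<in>J \<pi>. cnj (b i m) * b i k) + (\<Sum>j<nb \<pi>. cnj (cb \<pi> j m) * cb \<pi> j k) = (if k = m then 1 else 0))" ..
  then have cb: "\<And>\<pi> i j. i \<in> J \<pi> \<Longrightarrow> j < nb \<pi> \<Longrightarrow> ip dB (b i) (cb \<pi> j) = 0"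
    "\<And>\<pi> m k. m < dB \<Longrightarrow> k < dB \<Longrightarrow>
      (\<Sum>i\<in>J \<pi>. cnj (b i m) * b i k) + (\<Sum>j<nb \<pi>. cnj (cb \<pi> j m) * cb \<pi> j k) = (if k = m then 1 else 0)"
    by simp_all
  \<comment> \<open>Chosen so that the Schmidt coefficient \<open>sqrt (p m)\<close> becomes
    \<open>sqrt (q (\<pi> m))\<close>, up to the branch amplitude
    \<open>sqrt (w \<pi>)\<close>.\<close>
  define s where "s \<pi> m = complex_of_real (sqrt (w \<pi> * q (\<pi> m) / p m))" for \<pi> m
  define M where "M \<pi> = mat dA' dA (\<lambda>(k, i). \<Sum>m\<in>J \<pi>. s \<pi> m * e (\<pi> m) k * cnj (a m i))" for \<pi>
  \<comment> \<open>The output vector is arbitrary; index 0 exists because the dimension is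
    positive. The factor \<open>sqrt (w \<pi>)\<close> spreads one completion over all permutations,
    whose weights sum to 1.\<close>
  define T where "T \<pi> t = mat dA' dA (\<lambda>(k, i). of_real (sqrt (w \<pi>)) * (unit_fun 0 k * cnj (ca t i)))" for \<pi> t
  define V where "V \<pi> = mat dB' dB (\<lambda>(k, i). \<Sum>m\<in>J \<pi>. 1 * f (\<pi> m) k * cnj (b m i))" for \<pi>
  define U where "U \<pi> t = mat dB' dB (\<lambda>(k, i). unit_fun 0 k * cnj (cb \<pi> t i))" for \<pi> t
  define Ks where "Ks \<pi> = M \<pi> # map (T \<pi>) [0..<na]" for \<pi>
  define Vs where "Vs \<pi> = V \<pi> # map (U \<pi>) [0..<nb \<pi>]" for \<pi>
  have Ks: "set (Ks \<pi>) \<subseteq> carrier_mat dA' dA" and Vs: "set (Vs \<pi>) \<subseteq> carrier_mat dB' dB" for \<pi>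
    by (auto simp: Ks_def Vs_def M_def T_def V_def U_def)
  have unit_gram: "(\<Sum>k<d. cnj (z * (unit_fun 0 k * cnj u)) * (z * (unit_fun 0 k * cnj v)))
      = z * cnj z * (u * cnj v)" if "0 < d" for d z u v
  proof -
    have "(\<Sum>k<d. cnj (z * (unit_fun 0 k * cnj u)) * (z * (unit_fun 0 k * cnj v)))
        = z * cnj z * (u * cnj v) * ip d (unit_fun 0) (unit_fun 0)"
      by (simp add: ip_def sum_distrib_left mult_ac)
    then show ?thesis using that by (simp add: ip_self nsq_unit_fun)
  qed
  have Ks_one: "(\<Sum>\<pi>\<leftarrow>ss. \<Sum>K\<leftarrow>Ks \<pi>. \<Sum>k<dA'. cnj (K $$ (k, i)) * K $$ (k, j)) = (if i = j then 1 else 0)"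
    if ij: "i < dA" "j < dA" for i j
  proof -
    have "(\<Sum>K\<leftarrow>Ks \<pi>. \<Sum>k<dA'. cnj (K $$ (k, i)) * K $$ (k, j))
        = (\<Sum>m<c. of_real (w \<pi> * q (\<pi> m) / p m) * (a m i * cnj (a m j)))
          + of_real (w \<pi>) * (\<Sum>t<na. ca t i * cnj (ca t j))" if \<pi>: "\<pi> permutes {..<R}" for \<pi>
    proof -
      have "(\<Sum>k<dA'. cnj (M \<pi> $$ (k, i)) * M \<pi> $$ (k, j))
          = (\<Sum>k<dA'. cnj (\<Sum>m\<in>J \<pi>. s \<pi> m * e (\<pi> m) k * cnj (a m i)) * (\<Sum>m\<in>J \<pi>. s \<pi> m * e (\<pi> m) k * cnj (a m j)))"
        using ij by (simp add: M_def)
      also have "\<dots> = (\<Sum>m\<in>J \<pi>. of_real ((cmod (s \<pi> m))\<^sup>2) * (a m i * cnj (a m j)))"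
        by (rule partial_isometry_gram [OF e\<pi> [OF \<pi>] J(1)])
      also have "\<dots> = (\<Sum>m\<in>J \<pi>. of_real (w \<pi> * q (\<pi> m) / p m) * (a m i * cnj (a m j)))"
      proof (rule sum.cong [OF refl])
        fix m assume "m \<in> J \<pi>"
        then have "0 \<le> w \<pi> * q (\<pi> m) / p m" using w(1) q(2) p(2) [of m] by (simp add: J_def)
        then show "of_real ((cmod (s \<pi> m))\<^sup>2) * (a m i * cnj (a m j)) = of_real (w \<pi> * q (\<pi> m) / p m) * (a m i * cnj (a m j))"
          by (simp only: s_def norm_of_real power2_abs real_sqrt_pow2)
      qed
      \<comment> \<open>Outside \<open>J \<pi>\<close> the value \<open>q (\<pi> m)\<close> is zero.
        The range of \<open>m\<close> thereby becomes independent of \<open>\<pi>\<close>, so that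
        the sums can be exchanged later.\<close>
      also have "\<dots> = (\<Sum>m<c. of_real (w \<pi> * q (\<pi> m) / p m) * (a m i * cnj (a m j)))"
        by (rule sum.mono_neutral_left) (use q_less in \<open>auto simp: J_def\<close>)
      finally have 1: "(\<Sum>k<dA'. cnj (M \<pi> $$ (k, i)) * M \<pi> $$ (k, j)) = \<dots>" .
      have 2: "(\<Sum>k<dA'. cnj (T \<pi> t $$ (k, i)) * T \<pi> t $$ (k, j)) = of_real (w \<pi>) * (ca t i * cnj (ca t j))" for t
      proof -
        have "(\<Sum>k<dA'. cnj (T \<pi> t $$ (k, i)) * T \<pi> t $$ (k, j))
            = (\<Sum>k<dA'. cnj (of_real (sqrt (w \<pi>)) * (unit_fun 0 k * cnj (ca t i))) *
                (of_real (sqrt (w \<pi>)) * (unit_fun 0 k * cnj (ca t j))))"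
          using ij by (intro sum.cong refl) (simp add: T_def)
        also have "\<dots> = of_real (w \<pi>) * (ca t i * cnj (ca t j))"
          unfolding unit_gram [OF dims(1)] by (simp add: sqrt_w)
        finally show ?thesis .
      qed
      show ?thesis
        by (simp only: Ks_def list.map sum_list.Cons map_map o_def 1 2 interv_sum_list_conv_sum_set_nat
            sum_distrib_left atLeast0LessThan set_upt)
    qed
    then have "(\<Sum>\<pi>\<leftarrow>ss. \<Sum>K\<leftarrow>Ks \<pi>. \<Sum>k<dA'. cnj (K $$ (k, i)) * K $$ (k, j))
        = (\<Sum>\<pi> | \<pi> permutes {..<R}. \<Sum>m<c. of_real (w \<pi> * q (\<pi> m) / p m) * (a m i * cnj (a m j)))
          + (\<Sum>\<pi> | \<pi> permutes {..<R}. of_real (w \<pi>) * (\<Sum>t<na. ca t i * cnj (ca t j)))"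
      unfolding sum_ss by (simp add: sum.distrib)
    also have "(\<Sum>\<pi> | \<pi> permutes {..<R}. of_real (w \<pi>) * (\<Sum>t<na. ca t i * cnj (ca t j))) = (\<Sum>t<na. ca t i * cnj (ca t j))"
      unfolding sum_distrib_right [symmetric] of_real_sum [symmetric] w(2) by simp
    also have "(\<Sum>\<pi> | \<pi> permutes {..<R}. \<Sum>m<c. of_real (w \<pi> * q (\<pi> m) / p m) * (a m i * cnj (a m j)))
        = (\<Sum>m<c. \<Sum>\<pi> | \<pi> permutes {..<R}. of_real (w \<pi> * q (\<pi> m) / p m) * (a m i * cnj (a m j)))"
      by (rule sum.swap)
    \<comment> \<open>The convex combination reproduces \<open>p m\<close>, which cancels against
      the denominator in \<open>s\<close>.\<close>
    also have "\<dots> = (\<Sum>m<c. a m i * cnj (a m j))"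
    proof (rule sum.cong [OF refl])
      fix m assume m: "m \<in> {..<c}"
      have "(\<Sum>\<pi> | \<pi> permutes {..<R}. complex_of_real (w \<pi> * q (\<pi> m) / p m) * (a m i * cnj (a m j)))
          = of_real ((\<Sum>\<pi> | \<pi> permutes {..<R}. w \<pi> * q (\<pi> m)) / p m) * (a m i * cnj (a m j))"
        by (simp only: sum_distrib_right sum_divide_distrib of_real_sum)
      also have "(\<Sum>\<pi> | \<pi> permutes {..<R}. w \<pi> * q (\<pi> m)) = p m"
        using w(3) [of m] m by (simp add: R_def)
      finally show "(\<Sum>\<pi> | \<pi> permutes {..<R}. complex_of_real (w \<pi> * q (\<pi> m) / p m) * (a m i * cnj (a m j)))
          = a m i * cnj (a m j)"
        using p(2) [of m] m by simp
    qed
    finally show ?thesis using ca(2) [OF ij(2,1)] by (simp add: mult.commute)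
  qed
  have Vs_one: "(\<Sum>K\<leftarrow>Vs \<pi>. \<Sum>k<dB'. cnj (K $$ (k, i)) * K $$ (k, j)) = (if i = j then 1 else 0)"
    if \<pi>: "\<pi> \<in> set ss" and ij: "i < dB" "j < dB" for \<pi> i j
  proof -
    have "(\<Sum>k<dB'. cnj (V \<pi> $$ (k, i)) * V \<pi> $$ (k, j))
        = (\<Sum>k<dB'. cnj (\<Sum>m\<in>J \<pi>. 1 * f (\<pi> m) k * cnj (b m i)) * (\<Sum>m\<in>J \<pi>. 1 * f (\<pi> m) k * cnj (b m j)))"
      using ij by (simp add: V_def)
    also have "\<dots> = (\<Sum>m\<in>J \<pi>. of_real ((cmod 1)\<^sup>2) * (b m i * cnj (b m j)))"
      by (rule partial_isometry_gram [OF f\<pi> J(1)]) (use \<pi> ss in simp)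
    finally have 1: "(\<Sum>k<dB'. cnj (V \<pi> $$ (k, i)) * V \<pi> $$ (k, j)) = (\<Sum>m\<in>J \<pi>. b m i * cnj (b m j))" by simp
    have 2: "(\<Sum>k<dB'. cnj (U \<pi> t $$ (k, i)) * U \<pi> t $$ (k, j)) = cb \<pi> t i * cnj (cb \<pi> t j)" for t
      using unit_gram [OF dims(2), of 1 "cb \<pi> t i" "cb \<pi> t j"] ij by (simp add: U_def)
    have "(\<Sum>K\<leftarrow>Vs \<pi>. \<Sum>k<dB'. cnj (K $$ (k, i)) * K $$ (k, j))
        = (\<Sum>m\<in>J \<pi>. b m i * cnj (b m j)) + (\<Sum>t<nb \<pi>. cb \<pi> t i * cnj (cb \<pi> t j))"
      by (simp only: Vs_def list.map sum_list.Cons map_map o_def 1 2 interv_sum_list_conv_sum_set_nat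
          atLeast0LessThan set_upt)
    then show ?thesis using cb(2) [OF ij(2,1), of \<pi>] by (simp add: mult.commute)
  qed
  have Mx: "coef dB (mat_tensor (M \<pi>) (1\<^sub>m dB) *\<^sub>v ?x) k l
      = of_real (sqrt (w \<pi>)) * (\<Sum>m\<in>J \<pi>. of_real (sqrt (q (\<pi> m))) * e (\<pi> m) k * b m l)"
    if kl: "k < dA'" "l < dB" for \<pi> k l
  proof -
    have M: "M \<pi> \<in> carrier_mat dA' dA" by (simp add: M_def)
    have "coef dB (mat_tensor (M \<pi>) (1\<^sub>m dB) *\<^sub>v ?x) k l
        = (\<Sum>i<dA. (\<Sum>m\<in>J \<pi>. s \<pi> m * e (\<pi> m) k * cnj (a m i)) * (\<Sum>n<c. of_real (sqrt (p n)) * a n i * b n l))"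
      unfolding coef_tensor_A [OF M schmidt_vec_carrier kl] using kl
      by (intro sum.cong refl) (simp add: M_def coef_schmidt_vec)
    also have "\<dots> = ip dA (\<lambda>i. \<Sum>n<c. (of_real (sqrt (p n)) * b n l) * a n i)
        (\<lambda>i. \<Sum>m\<in>J \<pi>. cnj (s \<pi> m * e (\<pi> m) k) * a m i)"
      by (simp add: ip_def mult_ac)
    also have "\<dots> = (\<Sum>m\<in>J \<pi>. (s \<pi> m * e (\<pi> m) k) * (of_real (sqrt (p m)) * b m l))"
      unfolding ip_sum_right using J(2)
      by (intro sum.cong refl) (simp add: onf_coeff [OF a finite_lessThan] subset_iff)
    also have "\<dots> = (\<Sum>m\<in>J \<pi>. of_real (sqrt (w \<pi>)) * (of_real (sqrt (q (\<pi> m))) * e (\<pi> m) k * b m l))"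
    proof (rule sum.cong [OF refl])
      fix m assume "m \<in> J \<pi>"
      then have "sqrt (w \<pi> * q (\<pi> m) / p m) * sqrt (p m) = sqrt (w \<pi>) * sqrt (q (\<pi> m))"
        using p(2) [of m] by (simp add: J_def real_sqrt_mult real_sqrt_divide)
      then have "s \<pi> m * of_real (sqrt (p m)) = of_real (sqrt (w \<pi>)) * of_real (sqrt (q (\<pi> m)))"
        unfolding s_def of_real_mult [symmetric] by (simp only:)
      then show "(s \<pi> m * e (\<pi> m) k) * (of_real (sqrt (p m)) * b m l)
          = of_real (sqrt (w \<pi>)) * (of_real (sqrt (q (\<pi> m))) * e (\<pi> m) k * b m l)"
        by (metis mult.assoc mult.left_commute)
    qed
    finally show ?thesis by (simp add: sum_distrib_left)
  qed
  have Tx: "mat_tensor (T \<pi> t) (1\<^sub>m dB) *\<^sub>v ?x = 0\<^sub>v (dA' * dB)" if t: "t < na" for \<pi> t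
  proof (rule vec_eq_if_coef_eq)
    have T: "T \<pi> t \<in> carrier_mat dA' dA" by (simp add: T_def)
    show "mat_tensor (T \<pi> t) (1\<^sub>m dB) *\<^sub>v ?x \<in> carrier_vec (dA' * dB)"
      by (rule mult_mat_vec_carrier [OF mat_tensor_carrier [OF T] schmidt_vec_carrier]) simp
    fix k l assume kl: "k < dA'" "l < dB"
    have "coef dB (mat_tensor (T \<pi> t) (1\<^sub>m dB) *\<^sub>v ?x) k l
        = (\<Sum>i<dA. (of_real (sqrt (w \<pi>)) * (unit_fun 0 k * cnj (ca t i))) * (\<Sum>n<c. of_real (sqrt (p n)) * a n i * b n l))"
      unfolding coef_tensor_A [OF T schmidt_vec_carrier kl] using kl
      by (intro sum.cong refl) (simp add: T_def coef_schmidt_vec)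
    also have "\<dots> = of_real (sqrt (w \<pi>)) * unit_fun 0 k * ip dA (\<lambda>i. \<Sum>n<c. (of_real (sqrt (p n)) * b n l) * a n i) (ca t)"
      by (simp add: ip_def sum_distrib_left mult_ac)
    also have "\<dots> = 0" unfolding ip_sum_left using ca(1) [OF _ t] by simp
    finally show "coef dB (mat_tensor (T \<pi> t) (1\<^sub>m dB) *\<^sub>v ?x) k l = coef dB (0\<^sub>v (dA' * dB)) k l"
      using grid_less [OF kl] by (simp add: coef_def)
  qed simp
  let ?z = "\<lambda>V K. mat_tensor (1\<^sub>m dA') V *\<^sub>v (mat_tensor K (1\<^sub>m dB) *\<^sub>v ?x)"
  have Mx_carrier: "mat_tensor (M \<pi>) (1\<^sub>m dB) *\<^sub>v ?x \<in> carrier_vec (dA' * dB)" for \<pi>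
    by (rule mult_mat_vec_carrier [OF mat_tensor_carrier schmidt_vec_carrier]) (simp_all add: M_def)
  have VMx: "?z (V \<pi>) (M \<pi>) = of_real (sqrt (w \<pi>)) \<cdot>\<^sub>v ?y" if \<pi>: "\<pi> permutes {..<R}" for \<pi>
  proof (rule vec_eq_if_coef_eq)
    have V: "V \<pi> \<in> carrier_mat dB' dB" by (simp add: V_def)
    show "?z (V \<pi>) (M \<pi>) \<in> carrier_vec (dA' * dB')"
      by (rule mult_mat_vec_carrier [OF mat_tensor_carrier [OF _ V] Mx_carrier]) simp
    fix k l assume kl: "k < dA'" "l < dB'"
    have "coef dB' (?z (V \<pi>) (M \<pi>)) k l
        = (\<Sum>i<dB. (\<Sum>m\<in>J \<pi>. 1 * f (\<pi> m) l * cnj (b m i)) *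
            (of_real (sqrt (w \<pi>)) * (\<Sum>m\<in>J \<pi>. of_real (sqrt (q (\<pi> m))) * e (\<pi> m) k * b m i)))"
      unfolding coef_tensor_B [OF V Mx_carrier kl] using kl
      by (intro sum.cong refl) (simp add: V_def Mx)
    also have "\<dots> = of_real (sqrt (w \<pi>)) * ip dB (\<lambda>i. \<Sum>m\<in>J \<pi>. (of_real (sqrt (q (\<pi> m))) * e (\<pi> m) k) * b m i)
        (\<lambda>i. \<Sum>m\<in>J \<pi>. cnj (f (\<pi> m) l) * b m i)"
      by (simp add: ip_def sum_distrib_left mult_ac)
    also have "\<dots> = of_real (sqrt (w \<pi>)) * (\<Sum>m\<in>J \<pi>. f (\<pi> m) l * (of_real (sqrt (q (\<pi> m))) * e (\<pi> m) k))"
      unfolding ip_sum_right by (simp add: onf_coeff [OF b\<pi> J(1)])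
    also have "\<dots> = of_real (sqrt (w \<pi>)) * (\<Sum>m\<in>J \<pi>. of_real (sqrt (q (\<pi> m))) * e (\<pi> m) k * f (\<pi> m) l)"
      by (simp add: mult_ac)
    also have "\<dots> = of_real (sqrt (w \<pi>)) * (\<Sum>j<c'. of_real (sqrt (q j)) * e j k * f j l)"
    proof (cases "w \<pi> = 0")
      case False
      define g where "g j = (if j < c' then complex_of_real (sqrt (q j)) * e j k * f j l else 0)" for j
      \<comment> \<open>A permutation of positive weight cannot reach a nonzero value of
        \<open>q\<close> from a place \<open>m \<ge> c\<close>, because there \<open>p m = 0\<close>
        is a sum of nonnegative terms. So no part of the target is lost.\<close>
      have less_c: "m < c" if "m < R" "q (\<pi> m) \<noteq> 0" for m
      proof (rule ccontr)
        assume "\<not> m < c"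
        then have "(\<Sum>\<pi> | \<pi> permutes {..<R}. w \<pi> * q (\<pi> m)) = 0" using w(3) [of m] p(3) that by simp
        then have "w \<pi> * q (\<pi> m) = 0" using \<pi> fin w(1) q(2)
          by (subst (asm) sum_nonneg_eq_0_iff) auto
        then show False using \<open>w \<pi> \<noteq> 0\<close> that by simp
      qed
      have "(\<Sum>m\<in>J \<pi>. of_real (sqrt (q (\<pi> m))) * e (\<pi> m) k * f (\<pi> m) l) = (\<Sum>m\<in>J \<pi>. g (\<pi> m))"
        by (intro sum.cong) (auto simp: g_def J_def)
      also have "\<dots> = (\<Sum>m<R. g (\<pi> m))"
        by (rule sum.mono_neutral_left) (use less_c in \<open>auto simp: J_def R_def g_def\<close>)
      also have "\<dots> = (\<Sum>m<R. g m)" using sum.permute [OF \<pi>, of g] by (simp add: o_def)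
      also have "\<dots> = (\<Sum>j<c'. g j)" by (rule sum.mono_neutral_right) (auto simp: R_def g_def)
      finally show ?thesis by (simp add: g_def)
    qed simp
    also have "\<dots> = coef dB' (of_real (sqrt (w \<pi>)) \<cdot>\<^sub>v ?y) k l"
      using coef_schmidt_vec [OF kl, of "{..<c'}" q e f] grid_less [OF kl]
      by (simp add: coef_def)
    finally show "coef dB' (?z (V \<pi>) (M \<pi>)) k l = coef dB' (of_real (sqrt (w \<pi>)) \<cdot>\<^sub>v ?y) k l" .
  qed simp
  have UMx: "?z (U \<pi> t) (M \<pi>) = 0\<^sub>v (dA' * dB')" if t: "t < nb \<pi>" for \<pi> t
  proof (rule vec_eq_if_coef_eq)
    have U: "U \<pi> t \<in> carrier_mat dB' dB" by (simp add: U_def)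
    show "?z (U \<pi> t) (M \<pi>) \<in> carrier_vec (dA' * dB')"
      by (rule mult_mat_vec_carrier [OF mat_tensor_carrier [OF _ U] Mx_carrier]) simp
    fix k l assume kl: "k < dA'" "l < dB'"
    have "coef dB' (?z (U \<pi> t) (M \<pi>)) k l
        = (\<Sum>i<dB. (unit_fun 0 l * cnj (cb \<pi> t i)) *
            (of_real (sqrt (w \<pi>)) * (\<Sum>m\<in>J \<pi>. of_real (sqrt (q (\<pi> m))) * e (\<pi> m) k * b m i)))"
      unfolding coef_tensor_B [OF U Mx_carrier kl] using kl
      by (intro sum.cong refl) (simp add: U_def Mx)
    also have "\<dots> = of_real (sqrt (w \<pi>)) * unit_fun 0 l *
        ip dB (\<lambda>i. \<Sum>m\<in>J \<pi>. (of_real (sqrt (q (\<pi> m))) * e (\<pi> m) k) * b m i) (cb \<pi> t)"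
      by (simp add: ip_def sum_distrib_left mult_ac)
    also have "\<dots> = 0" unfolding ip_sum_left using cb(1) [OF _ t] by simp
    finally show "coef dB' (?z (U \<pi> t) (M \<pi>)) k l = coef dB' (0\<^sub>v (dA' * dB')) k l"
      using grid_less [OF kl] by (simp add: coef_def)
  qed simp
  have zero: "mat_tensor (1\<^sub>m dA') W *\<^sub>v 0\<^sub>v (dA' * dB) = 0\<^sub>v (dA' * dB')"
    if "W \<in> carrier_mat dB' dB" for W
    by (rule eq_vecI) (use mat_tensor_carrier [OF one_carrier_mat that, of dA'] in auto)
  have "\<exists>\<Lambda>. locc (dA, dB) (dA', dB') \<Lambda> \<and> \<Lambda> (density_of ?x) = mixture (dA' * dB')
      (concat (map (\<lambda>\<pi>. concat (map (\<lambda>V. map (\<lambda>K. ?z V K) (Ks \<pi>)) (Vs \<pi>))) ss))"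
    by (rule locc_two_rounds [OF dims schmidt_vec_carrier Ks Vs]) (rule Ks_one Vs_one; assumption)+
  then obtain \<Lambda> where "locc (dA, dB) (dA', dB') \<Lambda> \<and> \<Lambda> (density_of ?x) = mixture (dA' * dB')
      (concat (map (\<lambda>\<pi>. concat (map (\<lambda>V. map (\<lambda>K. ?z V K) (Ks \<pi>)) (Vs \<pi>))) ss))" ..
  then have \<Lambda>: "locc (dA, dB) (dA', dB') \<Lambda>" "\<Lambda> (density_of ?x) = mixture (dA' * dB')
      (concat (map (\<lambda>\<pi>. concat (map (\<lambda>V. map (\<lambda>K. ?z V K) (Ks \<pi>)) (Vs \<pi>))) ss))"
    by simp_all
  have "\<Lambda> (density_of ?x) = density_of ?y"
  proof -
    let ?zs = "concat (map (\<lambda>\<pi>. concat (map (\<lambda>V. map (\<lambda>K. ?z V K) (Ks \<pi>)) (Vs \<pi>))) ss)"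
    have z_carrier: "?z W K \<in> carrier_vec (dA' * dB')" if "K \<in> set (Ks \<pi>)" "W \<in> set (Vs \<pi>)" for W K \<pi>
    proof -
      have K: "K \<in> carrier_mat dA' dA" and W: "W \<in> carrier_mat dB' dB" using that Ks Vs by blast+
      have "mat_tensor K (1\<^sub>m dB) *\<^sub>v ?x \<in> carrier_vec (dA' * dB)"
        by (rule mult_mat_vec_carrier [OF mat_tensor_carrier [OF K one_carrier_mat] schmidt_vec_carrier])
      then show ?thesis
        by (rule mult_mat_vec_carrier [OF mat_tensor_carrier [OF one_carrier_mat W]])
    qed
    then have zs: "set ?zs \<subseteq> carrier_vec (dA' * dB')" by auto
    have "mixture (dA' * dB') ?zs = density_of ?y"
    proof (rule eq_matI)
      show "dim_row (mixture (dA' * dB') ?zs) = dim_row (density_of ?y)"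
        "dim_col (mixture (dA' * dB') ?zs) = dim_col (density_of ?y)"
        using carrier_matD [OF mixture_carrier [OF zs]] by simp_all
      fix i j assume "i < dim_row (density_of ?y)" "j < dim_col (density_of ?y)"
      then have ij: "i < dA' * dB'" "j < dA' * dB'" by simp_all
      let ?g = "\<lambda>v. v $ i * cnj (v $ j) :: complex"
      \<comment> \<open>Only the pair \<open>M \<pi>\<close>, \<open>V \<pi>\<close> contributes;
        every other pair annihilates the state.\<close>
      have branch: "(\<Sum>W\<leftarrow>Vs \<pi>. \<Sum>K\<leftarrow>Ks \<pi>. ?g (?z W K)) = of_real (w \<pi>) * ?g ?y"
        if \<pi>: "\<pi> permutes {..<R}" for \<pi>
      proof -
        have inner: "(\<Sum>K\<leftarrow>Ks \<pi>. ?g (?z W K)) = ?g (?z W (M \<pi>))" if W: "W \<in> set (Vs \<pi>)" for W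
        proof -
          have "?z W (T \<pi> t) = 0\<^sub>v (dA' * dB')" if "t < na" for t
            using zero [of W] W Vs unfolding Tx [OF that] by blast
          then have "(\<Sum>t\<leftarrow>[0..<na]. ?g (?z W (T \<pi> t))) = (\<Sum>t\<leftarrow>[0..<na]. 0)"
            using ij by (intro arg_cong [where f = sum_list] map_cong refl) simp
          then show ?thesis by (simp add: Ks_def o_def)
        qed
        have "(\<Sum>W\<leftarrow>Vs \<pi>. \<Sum>K\<leftarrow>Ks \<pi>. ?g (?z W K)) = (\<Sum>W\<leftarrow>Vs \<pi>. ?g (?z W (M \<pi>)))"
          by (intro arg_cong [where f = sum_list] map_cong refl inner)
        also have "\<dots> = ?g (?z (V \<pi>) (M \<pi>)) + (\<Sum>t\<leftarrow>[0..<nb \<pi>]. ?g (?z (U \<pi> t) (M \<pi>)))"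
          by (simp add: Vs_def o_def)
        also have "(\<Sum>t\<leftarrow>[0..<nb \<pi>]. ?g (?z (U \<pi> t) (M \<pi>))) = (\<Sum>t\<leftarrow>[0..<nb \<pi>]. 0)"
          using ij by (intro arg_cong [where f = sum_list] map_cong refl) (simp add: UMx)
        also have "?g (?z (V \<pi>) (M \<pi>)) = of_real (sqrt (w \<pi>)) * of_real (sqrt (w \<pi>)) * ?g ?y"
          unfolding VMx [OF \<pi>] using ij by simp
        finally show ?thesis by (simp add: sqrt_w)
      qed
      have "mixture (dA' * dB') ?zs $$ (i, j) = (\<Sum>\<pi>\<leftarrow>ss. \<Sum>W\<leftarrow>Vs \<pi>. \<Sum>K\<leftarrow>Ks \<pi>. ?g (?z W K))"
        unfolding mixture_index [OF zs ij] by (simp add: map_concat sum_list_concat o_def)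
      also have "\<dots> = (\<Sum>\<pi> | \<pi> permutes {..<R}. of_real (w \<pi>) * ?g ?y)"
        unfolding sum_ss by (intro sum.cong refl) (simp only: mem_Collect_eq branch)
      also have "\<dots> = ?g ?y"
        unfolding sum_distrib_right [symmetric] of_real_sum [symmetric] w(2) by simp
      finally show "mixture (dA' * dB') ?zs $$ (i, j) = density_of ?y $$ (i, j)"
        by (simp add: density_of_index [OF schmidt_vec_carrier ij])
    qed
    then show ?thesis unfolding \<Lambda>(2) .
  qed
  with \<Lambda>(1) show ?thesis by blast
qed

section \<open>Decreasing values and majorization\<close>

lemma decreasing_value_eq_support:
  fixes p :: "'a pmf"
  assumes h: "bij_betw h {..<c} (set_pmf p)"
    and dec: "\<And>i j. i \<le> j \<Longrightarrow> j < c \<Longrightarrow> pmf p (h j) \<le> pmf p (h i)"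
  shows "decreasing_value p i = (if i < c then pmf p (h i) else 0)"
proof -
  define ys where "ys = map (\<lambda>i. pmf p (h i)) [0..<c]"
  have inj: "inj_on h {..<c}" and img: "h ` {..<c} = set_pmf p" using h by (auto simp: bij_betw_def)
  have "mset_set (set_pmf p) = mset (map h [0..<c])"
    using mset_set_set [of "map h [0..<c]"] inj img
    by (simp add: distinct_map atLeast0LessThan)
  then have "image_mset (pmf p) (mset_set (set_pmf p)) = mset (rev ys)"
    by (simp add: ys_def flip: image_mset.compositionality mset_map) (simp add: o_def)
  moreover have "sorted (rev ys)"
    unfolding sorted_iff_nth_mono using dec by (auto simp: ys_def rev_nth)
  ultimately have "sorted_list_of_multiset (image_mset (pmf p) (mset_set (set_pmf p))) = rev ys"
    by (simp only: sorted_list_of_multiset_mset sorted_sort_id)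
  then show ?thesis by (simp add: decreasing_value_def Let_def ys_def)
qed

text \<open>The definition of \<open>decreasing_value\<close> lists the support only. In a
  decreasing enumeration of a larger set the zeros form a tail, which is cut off.\<close>

lemma decreasing_value_eq:
  fixes p :: "'a pmf"
  assumes h: "bij_betw h {..<c::nat} J" and J: "set_pmf p \<subseteq> J"
    and dec: "\<And>i j. i \<le> j \<Longrightarrow> j < c \<Longrightarrow> pmf p (h j) \<le> pmf p (h i)"
  shows "decreasing_value p i = (if i < c then pmf p (h i) else 0)"
proof -
  have inj: "inj_on h {..<c}" and img: "h ` {..<c} = J" using h by (auto simp: bij_betw_def)
  \<comment> \<open>The disjunct \<open>c \<le> i\<close> makes the minimum exist and gives
    \<open>m = c\<close> if all values are positive.\<close>
  define m where "m = (LEAST i. c \<le> i \<or> pmf p (h i) = 0)"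
  have m: "c \<le> m \<or> pmf p (h m) = 0" unfolding m_def by (rule LeastI [of _ c]) simp
  have less_m: "i < c \<and> pmf p (h i) \<noteq> 0" if "i < m" for i
    using not_less_Least [of i "\<lambda>i. c \<le> i \<or> pmf p (h i) = 0"] that by (simp add: m_def not_le)
  have "m \<le> c" unfolding m_def by (rule Least_le) simp
  have ge_m: "pmf p (h i) = 0" if "m \<le> i" "i < c" for i
    using m dec [OF that] that pmf_nonneg [of p "h i"] by (auto simp: antisym)
  have "h ` {..<m} = set_pmf p"
  proof
    show "h ` {..<m} \<subseteq> set_pmf p" using less_m by (auto simp: set_pmf_iff)
    show "set_pmf p \<subseteq> h ` {..<m}"
    proof
      fix y assume y: "y \<in> set_pmf p"
      then obtain i where i: "i < c" "y = h i" using J img by blast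
      then have "i < m" using y ge_m [of i] by (auto simp: set_pmf_iff not_less [symmetric])
      then show "y \<in> h ` {..<m}" using i by blast
    qed
  qed
  moreover have "inj_on h {..<m}" by (rule inj_on_subset [OF inj]) (use \<open>m \<le> c\<close> in auto)
  ultimately have "bij_betw h {..<m} (set_pmf p)" by (simp add: bij_betw_def)
  then have "decreasing_value p i = (if i < m then pmf p (h i) else 0)"
    by (rule decreasing_value_eq_support) (use dec \<open>m \<le> c\<close> in auto)
  then show ?thesis using ge_m [of i] \<open>m \<le> c\<close> by (auto simp: not_less)
qed

lemma sum_pmf_bij_betw:
  assumes "bij_betw h {..<c::nat} J" "set_pmf p \<subseteq> J"
  shows "(\<Sum>i<c. pmf p (h i)) = 1"
proof -
  have "finite J" using bij_betw_finite [OF assms(1)] by simp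
  then show ?thesis unfolding sum.reindex_bij_betw [OF assms(1)]
    using sum_pmf_eq_1 [of J p] assms(2) by simp
qed

lemma decreasing_value_enumeration:
  fixes p :: "'a pmf"
  assumes J: "finite J" "set_pmf p \<subseteq> J"
  obtains h where "bij_betw h {..<card J} J"
    "\<And>i. i < card J \<Longrightarrow> decreasing_value p i = pmf p (h i)"
    "\<And>i. card J \<le> i \<Longrightarrow> decreasing_value p i = 0"
    "\<And>i j. i \<le> j \<Longrightarrow> j < card J \<Longrightarrow> pmf p (h j) \<le> pmf p (h i)"
proof (rule decreasing_enumeration [OF J(1), of "pmf p"])
  fix h assume h: "bij_betw h {..<card J} J" "\<And>i j. i \<le> j \<Longrightarrow> j < card J \<Longrightarrow> pmf p (h j) \<le> pmf p (h i)"
  show thesis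
    by (rule that [OF h(1)]) (simp_all add: decreasing_value_eq [OF h(1) J(2) h(2)] h(2))
qed

lemma decreasing_value_props:
  fixes p :: "'a pmf"
  assumes J: "finite J" "set_pmf p \<subseteq> J"
  shows "antimono (decreasing_value p)" "0 \<le> decreasing_value p i"
    "(\<Sum>i<card J. decreasing_value p i) = 1" "(\<Sum>i<l. decreasing_value p i) \<le> 1"
proof -
  obtain h where h: "bij_betw h {..<card J} J"
    "\<And>i. i < card J \<Longrightarrow> decreasing_value p i = pmf p (h i)"
    "\<And>i. card J \<le> i \<Longrightarrow> decreasing_value p i = 0"
    "\<And>i j. i \<le> j \<Longrightarrow> j < card J \<Longrightarrow> pmf p (h j) \<le> pmf p (h i)"
    by (rule decreasing_value_enumeration [OF J]) (rule that)
  show nonneg: "0 \<le> decreasing_value p i" for i using h(2,3) [of i] by (cases "i < card J") auto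
  show "antimono (decreasing_value p)"
  proof (rule antimonoI)
    fix i j :: nat assume "i \<le> j"
    then show "decreasing_value p j \<le> decreasing_value p i"
      using h(2) [of i] h(2) [of j] h(3) [of j] h(4) [of i j] nonneg [of i] by (cases "j < card J") auto
  qed
  show one: "(\<Sum>i<card J. decreasing_value p i) = 1"
    using sum_pmf_bij_betw [OF h(1) J(2)] h(2) by simp
  have "(\<Sum>i<l. decreasing_value p i) \<le> (\<Sum>i<max l (card J). decreasing_value p i)"
    using nonneg by (intro sum_mono2) auto
  also have "\<dots> = (\<Sum>i<card J. decreasing_value p i)"
    by (rule sum.mono_neutral_right) (use h(3) in auto)
  finally show "(\<Sum>i<l. decreasing_value p i) \<le> 1" using one by simp
qed

section \<open>The quantum and the classical fidelity agree\<close>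

lemma schmidt_vec_reindex:
  assumes "bij_betw h J I"
  shows "schmidt_vec dA dB I p a b = schmidt_vec dA dB J (\<lambda>i. p (h i)) (\<lambda>i. a (h i)) (\<lambda>i. b (h i))"
  unfolding schmidt_vec_def by (simp add: sum.reindex_bij_betw [OF assms, symmetric])

lemma schmidt_vec_cong:
  assumes "\<And>i. i \<in> I \<Longrightarrow> p i = q i"
  shows "schmidt_vec dA dB I p a b = schmidt_vec dA dB I q a b"
  unfolding schmidt_vec_def using assms by simp

lemma schmidt_vec_mono:
  assumes "finite I" "J \<subseteq> I" "\<And>i. i \<in> I - J \<Longrightarrow> p i = 0"
  shows "schmidt_vec dA dB I p a b = schmidt_vec dA dB J p a b"
proof -
  have "(\<Sum>i\<in>I. of_real (sqrt (p i)) * a i k * b i l) = (\<Sum>i\<in>J. of_real (sqrt (p i)) * a i k * b i l)" for k l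
    by (rule sum.mono_neutral_right) (use assms in auto)
  then show ?thesis by (simp add: schmidt_vec_def)
qed

lemma ip_schmidt_vec:
  assumes I: "finite I" and a: "onf dA I a" and b: "onf dB I b"
  shows "ip (dA * dB) (($) (schmidt_vec dA dB I p a b)) (($) (schmidt_vec dA dB I q a b))
    = of_real (\<Sum>i\<in>I. sqrt (p i) * sqrt (q i))"
proof -
  have "ip (dA * dB) (($) (schmidt_vec dA dB I p a b)) (($) (schmidt_vec dA dB I q a b))
      = (\<Sum>k<dA. ip dB (\<lambda>l. \<Sum>i\<in>I. (of_real (sqrt (p i)) * a i k) * b i l)
          (\<lambda>l. \<Sum>i\<in>I. (of_real (sqrt (q i)) * a i k) * b i l))"
    unfolding ip_coef unfolding ip_def by (intro sum.cong refl) (simp add: coef_schmidt_vec)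
  also have "\<dots> = (\<Sum>k<dA. \<Sum>i\<in>I. cnj (of_real (sqrt (q i)) * a i k) * (of_real (sqrt (p i)) * a i k))"
    unfolding ip_sum_right by (simp add: onf_coeff [OF b I])
  also have "\<dots> = (\<Sum>i\<in>I. \<Sum>k<dA. cnj (of_real (sqrt (q i)) * a i k) * (of_real (sqrt (p i)) * a i k))"
    by (rule sum.swap)
  also have "\<dots> = (\<Sum>i\<in>I. of_real (sqrt (p i) * sqrt (q i)) * ip dA (a i) (a i))"
    by (simp add: ip_def sum_distrib_left mult_ac)
  also have "\<dots> = (\<Sum>i\<in>I. of_real (sqrt (p i) * sqrt (q i)))"
    using a by (simp add: onf_def)
  finally show ?thesis by simp
qed

lemma nsq_schmidt_vec_pmf:
  assumes "finite I" "set_pmf p \<subseteq> I" "onf dA I a" "onf dB I b"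
  shows "nsq (dA * dB) (($) (schmidt_vec dA dB I (pmf p) a b)) = 1"
  using ip_schmidt_vec [OF assms(1,3,4), of "pmf p" "pmf p"] sum_pmf_eq_1 [OF assms(1,2)]
  by (simp add: ip_self)

lemma schmidt_vec_sorted:
  assumes I: "finite I" "set_pmf p \<subseteq> I" and a: "onf dA I a" and b: "onf dB I b"
  obtains u v where "onf dA {..<card I} u" "onf dB {..<card I} v"
    "schmidt_vec dA dB I (pmf p) a b = schmidt_vec dA dB {..<card I} (decreasing_value p) u v"
proof (rule decreasing_value_enumeration [OF I])
  fix h assume h: "bij_betw h {..<card I} I" "\<And>i. i < card I \<Longrightarrow> decreasing_value p i = pmf p (h i)"
  show thesis
  proof (rule that)
    show "onf dA {..<card I} (\<lambda>i. a (h i))" "onf dB {..<card I} (\<lambda>i. b (h i))"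
      by (rule onf_reindex [OF a] onf_reindex [OF b]; use h(1) in \<open>simp add: bij_betw_def\<close>)+
    show "schmidt_vec dA dB I (pmf p) a b
        = schmidt_vec dA dB {..<card I} (decreasing_value p) (\<lambda>i. a (h i)) (\<lambda>i. b (h i))"
      unfolding schmidt_vec_reindex [OF h(1)] by (rule schmidt_vec_cong) (simp add: h(2))
  qed
qed

lemma schmidt_schmidt_vec:
  assumes I: "finite I" "set_pmf p \<subseteq> I" and u: "onf dA {..<card I} u" and v: "onf dB {..<card I} v"
  shows "schmidt dA dB (coef dB (schmidt_vec dA dB {..<card I} (decreasing_value p) u v))
    (card I) (decreasing_value p) u v"
proof -
  have "decreasing_value p i = 0" if "card I \<le> i" for i
    using decreasing_value_enumeration [OF I] that by metis
  then show ?thesis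
    using u v decreasing_value_props(1,2) [OF I] by (simp add: schmidt_def coef_schmidt_vec)
qed

lemma nielsen_pmf:
  assumes dims: "0 < dA'" "0 < dB'"
    and I: "finite I" "set_pmf p \<subseteq> I" and a: "onf dA I a" and b: "onf dB I b"
    and J: "finite J" "set_pmf q \<subseteq> J" and e: "onf dA' J e" and f: "onf dB' J f"
    and maj: "majorized_by p q"
  shows "\<exists>\<Lambda>. locc (dA, dB) (dA', dB') \<Lambda> \<and>
    \<Lambda> (density_of (schmidt_vec dA dB I (pmf p) a b)) = density_of (schmidt_vec dA' dB' J (pmf q) e f)"
proof -
  \<comment> \<open>The source is restricted to its support because Nielsen's measurement divides by
    its Schmidt values; the target may keep zeros.\<close>
  let ?I = "set_pmf p"
  have fin: "finite ?I" using I finite_subset by blast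
  have I': "schmidt_vec dA dB I (pmf p) a b = schmidt_vec dA dB ?I (pmf p) a b"
    by (rule schmidt_vec_mono [OF I]) (auto simp: set_pmf_iff)
  obtain h where h: "bij_betw h {..<card ?I} ?I"
    "\<And>i. i < card ?I \<Longrightarrow> decreasing_value p i = pmf p (h i)"
    "\<And>i. card ?I \<le> i \<Longrightarrow> decreasing_value p i = 0"
    by (rule decreasing_value_enumeration [OF fin order_refl]) blast
  obtain u v where u: "onf dA {..<card ?I} u" and v: "onf dB {..<card ?I} v"
    and x: "schmidt_vec dA dB ?I (pmf p) a b = schmidt_vec dA dB {..<card ?I} (decreasing_value p) u v"
    by (rule schmidt_vec_sorted [OF fin order_refl onf_subset [OF a I(2)] onf_subset [OF b I(2)]]) blast
  obtain u' v' where u': "onf dA' {..<card J} u'" and v': "onf dB' {..<card J} v'"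
    and y: "schmidt_vec dA' dB' J (pmf q) e f = schmidt_vec dA' dB' {..<card J} (decreasing_value q) u' v'"
    by (rule schmidt_vec_sorted [OF J e f]) blast
  have q0: "decreasing_value q i = 0" if "card J \<le> i" for i
    using decreasing_value_enumeration [OF J] that by metis
  have ppos: "0 < decreasing_value p i" if "i < card ?I" for i
    using h(2) [OF that] bij_betwE [OF h(1)] that by (simp add: pmf_positive)
  show ?thesis
    unfolding I' x y
    by (rule nielsen [OF dims u v u' v' decreasing_value_props(1) [OF fin order_refl] ppos h(3)
          decreasing_value_props(1,2) [OF J] q0])
      (use maj decreasing_value_props(3) [OF fin order_refl] decreasing_value_props(3) [OF J]
        in \<open>simp_all add: majorized_by_def\<close>)
qed

section \<open>Fidelity bounds for LOCC maps\<close>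

lemma fidelity_schmidt_vec:
  assumes J: "finite J" "set_pmf q \<subseteq> J" "set_pmf p'' \<subseteq> J" and e: "onf dA J e" and f: "onf dB J f"
  shows "fidelity (density_of (schmidt_vec dA dB J (pmf p'') e f)) (density_of (schmidt_vec dA dB J (pmf q) e f))
    = classical_fidelity J p'' q"
proof -
  have "fidelity (mixture (dA * dB) [schmidt_vec dA dB J (pmf p'') e f])
      (density_of (schmidt_vec dA dB J (pmf q) e f)) = \<bar>\<Sum>i\<in>J. sqrt (pmf p'' i) * sqrt (pmf q i)\<bar>"
    using nsq_schmidt_vec_pmf [OF J(1,2) e f]
    by (subst fidelity_mixture) (simp_all add: ip_schmidt_vec [OF J(1) e f] del: of_real_sum)
  then show ?thesis
    by (simp add: mixture_single [OF schmidt_vec_carrier] classical_fidelity_def real_sqrt_mult sum_nonneg)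
qed

lemma sum_sv_ge:
  assumes "a \<le> n"
  shows "(\<Sum>i<n. sv a b (coef b x) i) = nsq (a * b) (($) x)"
proof -
  have "(\<Sum>i<n. sv a b (coef b x) i) = (\<Sum>i<a. sv a b (coef b x) i)"
    by (rule sum.mono_neutral_right) (use assms in \<open>auto intro: sv_eq_0\<close>)
  then show ?thesis by (simp add: sv_sum nsq_coef)
qed

lemma ky_fan_sums_preserve_norm:
  assumes mono: "\<And>t. (\<Sum>x\<leftarrow>xs. ky_fan (a, b) t x) \<le> (\<Sum>y\<leftarrow>ys. ky_fan (a', b') t y)"
  shows "(\<Sum>y\<leftarrow>ys. nsq (a' * b') (($) y)) = (\<Sum>x\<leftarrow>xs. nsq (a * b) (($) x))"
proof (rule antisym)
  show "(\<Sum>y\<leftarrow>ys. nsq (a' * b') (($) y)) \<le> (\<Sum>x\<leftarrow>xs. nsq (a * b) (($) x))"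
    using mono [of None] by (simp add: ky_fan_def sum_list_sum_nth sum_negf)
  \<comment> \<open>Partial sums of length \<open>max a a'\<close> contain all Schmidt values on
    both sides and hence equal the square norms.\<close>
  show "(\<Sum>x\<leftarrow>xs. nsq (a * b) (($) x)) \<le> (\<Sum>y\<leftarrow>ys. nsq (a' * b') (($) y))"
    using mono [of "Some (max a a')"] by (simp add: ky_fan_def sum_sv_ge)
qed

text \<open>
  The weight of the Schmidt values beyond the size of the target alphabet is added to the largest
  value, which only helps.
\<close>

lemma locc_fidelity_le:
  assumes I: "finite I" "set_pmf p \<subseteq> I" and a: "onf dA I a" and b: "onf dB I b"
    and J: "finite J" "set_pmf q \<subseteq> J" and e: "onf dA' J e" and f: "onf dB' J f"
    and \<Gamma>: "locc (dA, dB) (K, K) \<Gamma>" and \<Gamma>': "locc (K, K) (dA', dB') \<Gamma>'"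
  shows "\<exists>p'' :: 'b pmf. set_pmf p'' \<subseteq> J \<and>
    (\<exists>p' :: nat pmf. set_pmf p' \<subseteq> {..<K} \<and> majorized_by p p' \<and> majorized_by p' p'') \<and>
    fidelity (\<Gamma>' (\<Gamma> (density_of (schmidt_vec dA dB I (pmf p) a b))))
      (density_of (schmidt_vec dA' dB' J (pmf q) e f)) \<le> classical_fidelity J p'' q"
proof -
  let ?x = "schmidt_vec dA dB I (pmf p) a b"
  let ?y = "schmidt_vec dA' dB' J (pmf q) e f"
  have nx: "nsq (dA * dB) (($) ?x) = 1" by (rule nsq_schmidt_vec_pmf [OF I a b])
  have ny: "nsq (dA' * dB') (($) ?y) = 1" by (rule nsq_schmidt_vec_pmf [OF J e f])
  obtain ws where ws: "set ws \<subseteq> carrier_vec (K * K)" "\<Gamma> (density_of ?x) = mixture (K * K) ws"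
    and ws_mono: "\<And>t. (\<Sum>x\<leftarrow>[?x]. ky_fan (dA, dB) t x) \<le> (\<Sum>w\<leftarrow>ws. ky_fan (K, K) t w)"
    using locc_ensemble_monotone [OF \<Gamma>] unfolding ensemble_monotone_def
    by (elim allE [of _ "[?x]"]) (auto simp: mixture_single [OF schmidt_vec_carrier])
  obtain zs where zs: "set zs \<subseteq> carrier_vec (dA' * dB')" "\<Gamma>' (mixture (K * K) ws) = mixture (dA' * dB') zs"
    and zs_mono: "\<And>t. (\<Sum>w\<leftarrow>ws. ky_fan (K, K) t w) \<le> (\<Sum>z\<leftarrow>zs. ky_fan (dA', dB') t z)"
    using locc_ensemble_monotone [OF \<Gamma>'] ws(1) unfolding ensemble_monotone_def
    by (elim allE [of _ ws]) auto
  have nws: "(\<Sum>w\<leftarrow>ws. nsq (K * K) (($) w)) = 1"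
    using ky_fan_sums_preserve_norm [OF ws_mono] nx by simp
  have nzs: "(\<Sum>z\<leftarrow>zs. nsq (dA' * dB') (($) z)) = 1"
    using ky_fan_sums_preserve_norm [OF zs_mono] nws by simp
  \<comment> \<open>The probabilities sit in the norms of the branches, so plain sums are the
    averages.\<close>
  define P1 where "P1 i = (\<Sum>w\<leftarrow>ws. sv K K (coef K w) i)" for i
  define P2 where "P2 i = (\<Sum>z\<leftarrow>zs. sv dA' dB' (coef dB' z) i)" for i
  have sum_P1: "(\<Sum>i<l. P1 i) = (\<Sum>w\<leftarrow>ws. ky_fan (K, K) (Some l) w)" for l
    by (simp add: P1_def ky_fan_def sum_list_sum_swap)
  have sum_P2: "(\<Sum>i<l. P2 i) = (\<Sum>z\<leftarrow>zs. ky_fan (dA', dB') (Some l) z)" for l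
    by (simp add: P2_def ky_fan_def sum_list_sum_swap)
  have P1_nonneg: "0 \<le> P1 i" and P2_nonneg: "0 \<le> P2 i" for i
    by (auto simp: P1_def P2_def sv_nonneg intro!: sum_list_nonneg)
  have P1_dec: "P1 j \<le> P1 i" and P2_dec: "P2 j \<le> P2 i" if "i \<le> j" for i j
    using antimonoD [OF sv_antimono that] by (auto simp: P1_def P2_def intro!: sum_list_mono)
  have P1_one: "(\<Sum>i<l. P1 i) = 1" if "K \<le> l" for l
    using nws that by (simp add: sum_P1 ky_fan_def sum_sv_ge)
  have P2_one: "(\<Sum>i<l. P2 i) = 1" if "dA' \<le> l" for l
    using nzs that by (simp add: sum_P2 ky_fan_def sum_sv_ge)
  have P2_le: "(\<Sum>i<l. P2 i) \<le> 1" for l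
    using sum_mono2 [of "{..<max l dA'}" "{..<l}" P2] P2_nonneg P2_one [of "max l dA'"] by auto
  obtain p' where p': "set_pmf p' \<subseteq> {..<K}" "\<And>i. i \<in> {..<K} \<Longrightarrow> pmf p' i = P1 i"
    by (rule ex_pmf_finite [of "{..<K}" P1]) (use P1_nonneg P1_one in auto)
  have dv_p': "decreasing_value p' i = P1 i" for i
  proof -
    have "decreasing_value p' i = (if i < K then pmf p' (id i) else 0)"
      by (rule decreasing_value_eq [OF bij_betw_id p'(1)]) (use p'(2) P1_dec in auto)
    moreover have "P1 i = 0" if "K \<le> i"
      using that by (simp add: P1_def sv_eq_0)
    ultimately show ?thesis using p'(2) by auto
  qed
  have maj1: "majorized_by p p'"
    unfolding majorized_by_def
  proof
    fix l
    obtain u v where u: "onf dA {..<card I} u" and v: "onf dB {..<card I} v"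
      and x: "?x = schmidt_vec dA dB {..<card I} (decreasing_value p) u v"
      by (rule schmidt_vec_sorted [OF I a b]) blast
    have *: "schmidt dA dB (coef dB ?x) (card I) (decreasing_value p) u v"
      unfolding x by (rule schmidt_schmidt_vec [OF I u v])
    \<comment> \<open>The Schmidt vectors of the source form one admissible family in Ky Fan's
      bound, so its partial sums lie below those of \<open>sv\<close>, whichever decomposition
      \<open>sv\<close> has chosen.\<close>
    have "(\<Sum>i<l. decreasing_value p i) \<le> (\<Sum>i<min l (card I). sv dA dB (coef dB ?x) i)"
      unfolding schmidt_partial_sum [OF *] by (rule sv_ky_fan) (rule onf_subset [OF v], auto)
    also have "\<dots> \<le> (\<Sum>i<l. sv dA dB (coef dB ?x) i)"
      by (rule sum_mono2) (auto simp: sv_nonneg)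
    also have "\<dots> = ky_fan (dA, dB) (Some l) ?x" by (simp add: ky_fan_def)
    also have "\<dots> \<le> (\<Sum>i<l. P1 i)"
      using ws_mono [of "Some l"] by (simp only: sum_P1 list.map sum_list.Cons sum_list.Nil add_0_right)
    finally show "(\<Sum>i<l. decreasing_value p i) \<le> (\<Sum>i<l. decreasing_value p' i)"
      by (simp add: dv_p')
  qed
  define c where "c = card J"
  \<comment> \<open>The alphabet has a place 0 that can take up the surplus weight.\<close>
  have "J \<noteq> {}" using J(2) set_pmf_not_empty [of q] by blast
  then have c_pos: "0 < c" using J(1) by (simp add: c_def card_gt_0_iff)
  have c_le: "c \<le> dA'" unfolding c_def by (rule onf_card_le [OF e J(1)])
  obtain h where h: "bij_betw h {..<c} J"
    "\<And>i. i < c \<Longrightarrow> decreasing_value q i = pmf q (h i)"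
    "\<And>i. c \<le> i \<Longrightarrow> decreasing_value q i = 0"
    unfolding c_def by (rule decreasing_value_enumeration [OF J]) blast
  define tail where "tail = (\<Sum>i\<in>{c..<dA'}. P2 i)"
  define G where "G i = P2 i + (if i = 0 then tail else 0)" for i
  have tail: "0 \<le> tail" using P2_nonneg by (simp add: tail_def sum_nonneg)
  have G: "0 \<le> G i" "P2 i \<le> G i" for i using P2_nonneg [of i] tail by (auto simp: G_def)
  have G_dec: "G j \<le> G i" if "i \<le> j" for i j
    using P2_dec [OF that] tail that by (auto simp: G_def)
  have sum_G: "(\<Sum>i<c. G i) = 1"
  proof -
    have "(\<Sum>i<c. G i) = (\<Sum>i<c. P2 i) + tail"
      using c_pos by (simp add: G_def sum.distrib)
    also have "\<dots> = (\<Sum>i\<in>{..<c} \<union> {c..<dA'}. P2 i)"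
      unfolding tail_def by (subst sum.union_disjoint) auto
    also have "{..<c} \<union> {c..<dA'} = {..<dA'}" using c_le by auto
    finally show ?thesis using P2_one by simp
  qed
  \<comment> \<open>\<open>h\<close> enumerates the alphabet by decreasing \<open>q\<close>.
    Carrying \<open>G\<close> over along \<open>h\<close> orders \<open>p''\<close> in the same way,
    so that the fidelity pairs the two spectra rank by rank.\<close>
  have inv_h: "the_inv_into {..<c} h (h i) = i" if "i < c" for i
    using the_inv_into_f_f [OF bij_betw_imp_inj_on [OF h(1)]] that by simp
  have "(\<Sum>y\<in>J. G (the_inv_into {..<c} h y)) = (\<Sum>i<c. G (the_inv_into {..<c} h (h i)))"
    by (rule sum.reindex_bij_betw [OF h(1), symmetric])
  also have "\<dots> = 1" using sum_G by (simp add: inv_h)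
  finally obtain p'' where p'': "set_pmf p'' \<subseteq> J" "\<And>y. y \<in> J \<Longrightarrow> pmf p'' y = G (the_inv_into {..<c} h y)"
    using ex_pmf_finite [OF J(1), of "\<lambda>y. G (the_inv_into {..<c} h y)"] G by metis
  have p''_h: "pmf p'' (h i) = G i" if "i < c" for i
    using p''(2) [of "h i"] bij_betwE [OF h(1)] that by (simp add: inv_h)
  have dv_p'': "decreasing_value p'' i = (if i < c then G i else 0)" for i
  proof -
    have "decreasing_value p'' i = (if i < c then pmf p'' (h i) else 0)"
      by (rule decreasing_value_eq [OF h(1) p''(1)]) (use p''_h G_dec in auto)
    then show ?thesis using p''_h by simp
  qed
  have maj2: "majorized_by p' p''"
    unfolding majorized_by_def
  proof
    fix l
    have "(\<Sum>i<l. P1 i) \<le> (\<Sum>i<l. P2 i)"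
      unfolding sum_P1 sum_P2 by (rule zs_mono)
    also have "\<dots> \<le> (\<Sum>i<l. decreasing_value p'' i)"
    proof (cases "l \<le> c")
      case True
      then show ?thesis using G by (intro sum_mono) (simp add: dv_p'')
    next
      case False
      \<comment> \<open>Beyond the alphabet the right-hand side has already reached 1.\<close>
      then have "(\<Sum>i<l. decreasing_value p'' i) = (\<Sum>i<c. G i)"
        by (intro sum.mono_neutral_cong_right) (auto simp: dv_p'')
      then show ?thesis using P2_le sum_G by simp
    qed
    finally show "(\<Sum>i<l. decreasing_value p' i) \<le> (\<Sum>i<l. decreasing_value p'' i)"
      by (simp add: dv_p')
  qed
  have "(\<Sum>z\<leftarrow>zs. (cmod (ip (dA' * dB') (($) z) (($) ?y)))\<^sup>2) \<le> (classical_fidelity J p'' q)\<^sup>2"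
  proof -
    obtain u v where u: "onf dA' {..<card J} u" and v: "onf dB' {..<card J} v"
      and y: "?y = schmidt_vec dA' dB' {..<card J} (decreasing_value q) u v"
      by (rule schmidt_vec_sorted [OF J e f]) blast
    have *: "schmidt dA' dB' (coef dB' ?y) c (decreasing_value q) u v"
      unfolding y c_def by (rule schmidt_schmidt_vec [OF J u v])
    let ?s = "\<lambda>z i. sv dA' dB' (coef dB' z) i * decreasing_value q i"
    have s_nonneg: "0 \<le> ?s z i" for z i
      using sv_nonneg decreasing_value_props(2) [OF J] by simp
    \<comment> \<open>A single branch: its overlap with the target is bounded by pairing the two
      ordered spectra.\<close>
    have overlap: "(cmod (ip (dA' * dB') (($) z) (($) ?y)))\<^sup>2 \<le> (\<Sum>i<c. sqrt (?s z i))\<^sup>2" for z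
    proof -
      obtain m u' v' where "schmidt dA' dB' (coef dB' z) m (sv dA' dB' (coef dB' z)) u' v'"
        using schmidt_sv by blast
      from von_neumann_trace_inequality [OF this *] show ?thesis
        unfolding ip_coef by (intro power_mono) auto
    qed
    have "(\<Sum>z\<leftarrow>zs. (cmod (ip (dA' * dB') (($) z) (($) ?y)))\<^sup>2) \<le> (\<Sum>z\<leftarrow>zs. (\<Sum>i<c. sqrt (?s z i))\<^sup>2)"
      by (intro sum_list_mono overlap)
    also have "\<dots> = (\<Sum>t<length zs. (\<Sum>i<c. sqrt (?s (zs ! t) i))\<^sup>2)"
      by (simp add: sum_list_sum_nth atLeast0LessThan)
    also have "\<dots> \<le> (\<Sum>i<c. sqrt (\<Sum>t<length zs. ?s (zs ! t) i))\<^sup>2"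
      by (rule sum_square_sum_sqrt_le) (use s_nonneg in auto)
    also have "\<dots> = (\<Sum>i<c. sqrt (P2 i * decreasing_value q i))\<^sup>2"
      by (simp add: P2_def sum_list_sum_nth atLeast0LessThan sum_distrib_right)
    also have "\<dots> \<le> (\<Sum>i<c. sqrt (G i * decreasing_value q i))\<^sup>2"
      using G P2_nonneg decreasing_value_props(2) [OF J]
      by (intro power_mono sum_mono sum_nonneg) (auto intro!: mult_right_mono)
    also have "(\<Sum>i<c. sqrt (G i * decreasing_value q i)) = (\<Sum>i<c. sqrt (pmf p'' (h i) * pmf q (h i)))"
      using p''_h h(2) by simp
    also have "\<dots> = classical_fidelity J p'' q"
      unfolding classical_fidelity_def by (rule sum.reindex_bij_betw [OF h(1)])
    finally show ?thesis .
  qed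
  then have "fidelity (\<Gamma>' (\<Gamma> (density_of ?x))) (density_of ?y) \<le> classical_fidelity J p'' q"
    unfolding ws(2) zs(2) fidelity_mixture [OF zs(1) schmidt_vec_carrier ny]
    by (intro real_le_lsqrt) (auto simp: classical_fidelity_def sum_nonneg intro!: sum_list_nonneg)
  then show ?thesis using p''(1) p'(1) maj1 maj2 by blast
qed

text \<open>The geometric mean of two probabilities is at most their arithmetic mean. The bound
  makes both suprema exist.\<close>

lemma classical_fidelity_le_1:
  assumes "finite J" "set_pmf p \<subseteq> J" "set_pmf q \<subseteq> J"
  shows "classical_fidelity J p q \<le> 1"
proof -
  have "classical_fidelity J p q \<le> (\<Sum>y\<in>J. (pmf p y + pmf q y) / 2)"
    unfolding classical_fidelity_def by (intro sum_mono arith_geo_mean_sqrt) auto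
  also have "\<dots> = 1"
    using sum_pmf_eq_1 [OF assms(1,2)] sum_pmf_eq_1 [OF assms(1,3)]
    by (simp add: sum.distrib flip: sum_divide_distrib)
  finally show ?thesis .
qed

text \<open>A point mass is the top of the order; this makes the set behind \<open>FM\<close>
  nonempty, as a real supremum demands.\<close>

lemma majorized_by_return_pmf:
  assumes "finite (set_pmf p)"
  shows "majorized_by p (return_pmf z)"
  unfolding majorized_by_def
proof
  fix l
  have z: "finite {z}" "set_pmf (return_pmf z) \<subseteq> {z}" by simp_all
  note dv = decreasing_value_props [OF z]
  show "(\<Sum>i<l. decreasing_value p i) \<le> (\<Sum>i<l. decreasing_value (return_pmf z) i)"
  proof (cases "l = 0")
    case False
    have "(\<Sum>i<l. decreasing_value p i) \<le> 1"
      by (rule decreasing_value_props(4) [OF assms order_refl])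
    also have "\<dots> = (\<Sum>i<1. decreasing_value (return_pmf z) i)" using dv(3) by simp
    also have "\<dots> \<le> (\<Sum>i<l. decreasing_value (return_pmf z) i)"
      using False dv(2) by (intro sum_mono2) auto
    finally show ?thesis .
  qed simp
qed

text \<open>The sets of attainable values are not shown to be equal. Nielsen's protocol realises
  every classical value, and every quantum value is dominated by a classical one; the suprema then
  agree.\<close>

theorem FQ_eq_FM:
  assumes I: "finite I" "set_pmf p \<subseteq> I" and a: "onf dA I a" and b: "onf dB I b"
    and J: "finite J" "set_pmf q \<subseteq> J" and e: "onf dA' J e" and f: "onf dB' J f"
    and N: "0 \<le> N"
  shows "FQ (dA, dB) (density_of (schmidt_vec dA dB I (pmf p) a b))
    (dA', dB') (density_of (schmidt_vec dA' dB' J (pmf q) e f)) N = FM p J q N"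
proof -
  define K where "K = storage_dim N"
  \<comment> \<open>A nonnegative \<open>N\<close> leaves at least one dimension on each side of the
    storage.\<close>
  have "1 \<le> \<lfloor>2 powr N\<rfloor>" using N by (simp add: le_floor_iff ge_one_powr_ge_zero)
  then have K: "0 < K" by (simp add: K_def storage_dim_def)
  obtain j where j: "j \<in> J" using J(2) set_pmf_not_empty [of q] by blast
  then have "0 < card J" using J(1) by (auto simp: card_gt_0_iff)
  then have dims: "0 < dA'" "0 < dB'" using onf_card_le [OF e J(1)] onf_card_le [OF f J(1)] by simp_all
  let ?\<rho> = "density_of (schmidt_vec dA dB I (pmf p) a b)"
  let ?\<sigma> = "density_of (schmidt_vec dA' dB' J (pmf q) e f)"
  let ?Q = "{fidelity (\<Gamma>' (\<Gamma> ?\<rho>)) ?\<sigma> | \<Gamma> \<Gamma>'. locc (dA, dB) (K, K) \<Gamma> \<and> locc (K, K) (dA', dB') \<Gamma>'}"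
  let ?M = "{classical_fidelity J p'' q | p''. set_pmf p'' \<subseteq> J \<and>
    (\<exists>p' :: nat pmf. set_pmf p' \<subseteq> {..<K} \<and> majorized_by p p' \<and> majorized_by p' p'')}"
  have M_Q: "?M \<subseteq> ?Q"
  proof
    fix r assume "r \<in> ?M"
    then obtain p'' and p' :: "nat pmf" where r: "r = classical_fidelity J p'' q" and p'': "set_pmf p'' \<subseteq> J"
      and p': "set_pmf p' \<subseteq> {..<K}" and maj: "majorized_by p p'" "majorized_by p' p''" by blast
    \<comment> \<open>Any Schmidt bases of the storage would do, as long as the recovery starts from
      the state that the first map has produced.\<close>
    have unit: "onf K {..<K} unit_fun" by (rule onf_unit_fun) simp
    obtain \<Gamma> where \<Gamma>: "locc (dA, dB) (K, K) \<Gamma>"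
      "\<Gamma> ?\<rho> = density_of (schmidt_vec K K {..<K} (pmf p') unit_fun unit_fun)"
      using nielsen_pmf [OF K K I a b _ p' unit unit maj(1)] by auto
    obtain \<Gamma>' where \<Gamma>': "locc (K, K) (dA', dB') \<Gamma>'"
      "\<Gamma>' (density_of (schmidt_vec K K {..<K} (pmf p') unit_fun unit_fun))
        = density_of (schmidt_vec dA' dB' J (pmf p'') e f)"
      using nielsen_pmf [OF dims _ p' unit unit J(1) p'' e f maj(2)] by auto
    have "r = fidelity (\<Gamma>' (\<Gamma> ?\<rho>)) ?\<sigma>"
      unfolding r \<Gamma>(2) \<Gamma>'(2) by (rule fidelity_schmidt_vec [OF J p'' e f, symmetric])
    then show "r \<in> ?Q" using \<Gamma>(1) \<Gamma>'(1) by blast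
  qed
  have Q_M: "\<exists>r'\<in>?M. r \<le> r'" if "r \<in> ?Q" for r
  proof -
    obtain \<Gamma> \<Gamma>' where r: "r = fidelity (\<Gamma>' (\<Gamma> ?\<rho>)) ?\<sigma>"
      and \<Gamma>: "locc (dA, dB) (K, K) \<Gamma>" "locc (K, K) (dA', dB') \<Gamma>'" using \<open>r \<in> ?Q\<close> by blast
    from locc_fidelity_le [OF I a b J e f \<Gamma>] show ?thesis unfolding r by blast
  qed
  have "classical_fidelity J (return_pmf j) q \<in> ?M"
  proof -
    have "majorized_by p (return_pmf (0::nat))"
      by (rule majorized_by_return_pmf) (use I finite_subset in blast)
    moreover have "majorized_by (return_pmf (0::nat)) (return_pmf j)"
      by (rule majorized_by_return_pmf) simp
    ultimately show ?thesis using j K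
      by (intro CollectI exI [of _ "return_pmf j"] conjI refl exI [of _ "return_pmf (0::nat)"]) auto
  qed
  then have ne: "?M \<noteq> {}" by blast
  have bdd: "bdd_above ?M" using classical_fidelity_le_1 [OF J(1) _ J(2)] by (intro bdd_aboveI [of _ 1]) auto
  have bdd': "bdd_above ?Q"
  proof (rule bdd_aboveI [of _ 1])
    fix r assume "r \<in> ?Q"
    then obtain r' where "r' \<in> ?M" "r \<le> r'" using Q_M by blast
    then show "r \<le> 1" using classical_fidelity_le_1 [OF J(1) _ J(2)] by force
  qed
  have "Sup ?Q = Sup ?M"
  proof (rule antisym)
    show "Sup ?Q \<le> Sup ?M"
    proof (rule cSup_mono [OF _ bdd])
      show "?Q \<noteq> {}" using ne M_Q by blast
    qed (rule Q_M)
    show "Sup ?M \<le> Sup ?Q" by (rule cSup_subset_mono [OF ne bdd' M_Q])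
  qed
  then show ?thesis by (simp add: FQ_def FM_def K_def)
qed

section \<open>Tensor powers\<close>

abbreviation words :: "'a set \<Rightarrow> nat \<Rightarrow> 'a list set" where
  "words A n \<equiv> {ys. set ys \<subseteq> A \<and> length ys = n}"

text \<open>Distributivity: choosing one summand from each factor is choosing a word.\<close>

lemma prod_sum_words:
  fixes F :: "nat \<Rightarrow> 'a \<Rightarrow> 'b :: comm_semiring_1"
  assumes "finite A"
  shows "(\<Prod>l<n. \<Sum>i\<in>A. F l i) = (\<Sum>ys\<in>words A n. \<Prod>l<n. F l (ys ! l))"
proof (induction n arbitrary: F)
  case 0
  have "words A 0 = {[]}" by auto
  then show ?case by simp
next
  case (Suc n)
  have bij: "bij_betw (\<lambda>(i, ys). i # ys) (A \<times> words A n) (words A (Suc n))"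
    by (rule bij_betw_byWitness [where f' = "\<lambda>ys. (hd ys, tl ys)"]) (auto simp: length_Suc_conv)
  have "(\<Prod>l<Suc n. \<Sum>i\<in>A. F l i) = (\<Sum>i\<in>A. F 0 i) * (\<Prod>l<n. \<Sum>i\<in>A. F (Suc l) i)"
    by (rule prod.lessThan_Suc_shift)
  also have "\<dots> = (\<Sum>i\<in>A. \<Sum>ys\<in>words A n. F 0 i * (\<Prod>l<n. F (Suc l) (ys ! l)))"
    unfolding Suc.IH [of "\<lambda>l. F (Suc l)"] by (rule sum_product)
  also have "\<dots> = (\<Sum>(i, ys)\<in>A \<times> words A n. \<Prod>l<Suc n. F l ((i # ys) ! l))"
    by (simp add: sum.cartesian_product prod.lessThan_Suc_shift del: prod.lessThan_Suc)
  also have "\<dots> = (\<Sum>ys\<in>words A (Suc n). \<Prod>l<Suc n. F l (ys ! l))"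
    using sum.reindex_bij_betw [OF bij, of "\<lambda>ys. \<Prod>l<Suc n. F l (ys ! l)"]
    by (simp add: case_prod_unfold)
  finally show ?case .
qed

lemma pmf_replicate_pmf:
  "length ys = n \<Longrightarrow> pmf (replicate_pmf n p) ys = (\<Prod>l<n. pmf p (ys ! l))"
proof (induction n arbitrary: ys)
  case (Suc n)
  then obtain y zs where ys: "ys = y # zs" "length zs = n" by (auto simp: length_Suc_conv)
  have "replicate_pmf (Suc n) p = map_pmf (\<lambda>(x, xs). x # xs) (pair_pmf p (replicate_pmf n p))"
    by (simp add: map_pmf_def pair_pmf_def bind_assoc_pmf bind_return_pmf)
  moreover have "inj (\<lambda>(x :: 'a, xs). x # xs)" by (auto simp: inj_def)
  ultimately have "pmf (replicate_pmf (Suc n) p) ((\<lambda>(x, xs). x # xs) (y, zs)) = pmf p y * pmf (replicate_pmf n p) zs"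
    by (simp only: pmf_map_inj' pmf_pair)
  then show ?case using Suc.IH [OF ys(2)]
    by (simp add: ys prod.lessThan_Suc_shift del: prod.lessThan_Suc replicate_pmf.simps)
qed simp

lemma digit_less: "0 < d \<Longrightarrow> digit d l k < d"
  by (simp add: digit_def)

text \<open>The numbers below \<open>d ^ n\<close> are the words of \<open>n\<close> digits. The
  induction splits off the lowest digit, which is the one at position 0.\<close>

lemma sum_digits:
  fixes G :: "nat \<Rightarrow> nat \<Rightarrow> complex"
  shows "(\<Sum>k<d ^ n. \<Prod>l<n. G l (digit d l k)) = (\<Prod>l<n. \<Sum>j<d. G l j)"
proof (induction n arbitrary: G)
  case (Suc n)
  have 0: "digit d 0 (k * d + j) = j" if "j < d" for k j
    using that by (simp add: digit_def)
  have S: "digit d (Suc l) (k * d + j) = digit d l k" if "j < d" for k j l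
    using that by (simp add: digit_def div_mult2_eq)
  have "(\<Sum>k<d ^ Suc n. \<Prod>l<Suc n. G l (digit d l k))
      = (\<Sum>k<d ^ n. \<Sum>j<d. \<Prod>l<Suc n. G l (digit d l (k * d + j)))"
    using sum_grid [of _ "d ^ n" d] by (simp add: mult.commute del: prod.lessThan_Suc)
  also have "\<dots> = (\<Sum>k<d ^ n. \<Sum>j<d. G 0 j * (\<Prod>l<n. G (Suc l) (digit d l k)))"
    by (intro sum.cong refl) (simp add: prod.lessThan_Suc_shift 0 S del: prod.lessThan_Suc)
  also have "\<dots> = (\<Sum>j<d. G 0 j) * (\<Sum>k<d ^ n. \<Prod>l<n. G (Suc l) (digit d l k))"
    by (subst sum.swap) (simp add: sum_product)
  also have "\<dots> = (\<Prod>l<Suc n. \<Sum>j<d. G l j)"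
    unfolding Suc.IH [of "\<lambda>l. G (Suc l)"] by (rule prod.lessThan_Suc_shift [symmetric])
  finally show ?case .
qed simp

text \<open>The product vector named by a word, in the digit numbering of
  \<open>tensor_power\<close>.\<close>

definition word_fun :: "nat \<Rightarrow> ('i \<Rightarrow> nat \<Rightarrow> complex) \<Rightarrow> nat \<Rightarrow> 'i list \<Rightarrow> nat \<Rightarrow> complex" where
  "word_fun d a n ys k = (\<Prod>l<n. a (ys ! l) (digit d l k))"

lemma onf_word_fun:
  assumes a: "onf d I a"
  shows "onf (d ^ n) (words I n) (word_fun d a n)"
  unfolding onf_def
proof (intro ballI)
  fix ys zs assume ys: "ys \<in> words I n" and zs: "zs \<in> words I n"
  have "ip (d ^ n) (word_fun d a n ys) (word_fun d a n zs)
      = (\<Sum>k<d ^ n. \<Prod>l<n. (\<lambda>j. a (ys ! l) j * cnj (a (zs ! l) j)) (digit d l k))"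
    by (simp add: ip_def word_fun_def prod.distrib)
  also have "\<dots> = (\<Prod>l<n. ip d (a (ys ! l)) (a (zs ! l)))"
    unfolding ip_def by (rule sum_digits)
  also have "\<dots> = (\<Prod>l<n. if ys ! l = zs ! l then 1 else 0)"
    using a ys zs by (intro prod.cong refl) (auto simp: onf_def subset_iff)
  also have "\<dots> = (if ys = zs then 1 else 0)"
  proof (cases "ys = zs")
    case False
    then obtain l where "l < n" "ys ! l \<noteq> zs ! l" using ys zs by (auto simp: list_eq_iff_nth_eq)
    then have "(\<Prod>l<n. if ys ! l = zs ! l then 1 else 0 :: complex) = 0"
      by (intro prod_zero) auto
    then show ?thesis using False by simp
  qed simp
  finally show "ip (d ^ n) (word_fun d a n ys) (word_fun d a n zs) = (if ys = zs then 1 else 0)" .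
qed

text \<open>Expanding the product of Schmidt sums gives one term per word, and its coefficient is
  the root of the i.i.d. probability of the word. Thus the product bases are Schmidt bases of the
  power.\<close>

lemma tensor_power_schmidt_vec:
  assumes I: "finite I" and d: "0 < dA" "0 < dB"
  shows "tensor_power dA dB (schmidt_vec dA dB I (pmf p) a b) n
    = schmidt_vec (dA ^ n) (dB ^ n) (words I n) (pmf (replicate_pmf n p)) (word_fun dA a n) (word_fun dB b n)"
proof (rule eq_vecI)
  have sqrt_prod: "complex_of_real (sqrt (\<Prod>l<m. f l)) = (\<Prod>l<m. of_real (sqrt (f l)))"
    for m and f :: "nat \<Rightarrow> real"
    by (induction m) (simp_all add: real_sqrt_mult)
  fix m assume "m < dim_vec (schmidt_vec (dA ^ n) (dB ^ n) (words I n) (pmf (replicate_pmf n p))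
    (word_fun dA a n) (word_fun dB b n))"
  then have m: "m < dA ^ n * dB ^ n" by simp
  define k where "k = m div dB ^ n"
  define k' where "k' = m mod dB ^ n"
  have "tensor_power dA dB (schmidt_vec dA dB I (pmf p) a b) n $ m
      = (\<Prod>l<n. coef dB (schmidt_vec dA dB I (pmf p) a b) (digit dA l k) (digit dB l k'))"
    using m by (simp add: tensor_power_def coef_def k_def k'_def)
  also have "\<dots> = (\<Prod>l<n. \<Sum>i\<in>I. of_real (sqrt (pmf p i)) * a i (digit dA l k) * b i (digit dB l k'))"
    using digit_less d by (simp add: coef_schmidt_vec)
  also have "\<dots> = (\<Sum>ys\<in>words I n. \<Prod>l<n. of_real (sqrt (pmf p (ys ! l))) *
      a (ys ! l) (digit dA l k) * b (ys ! l) (digit dB l k'))"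
    by (rule prod_sum_words [OF I])
  also have "\<dots> = (\<Sum>ys\<in>words I n. of_real (sqrt (pmf (replicate_pmf n p) ys)) *
      word_fun dA a n ys k * word_fun dB b n ys k')"
    by (intro sum.cong refl) (simp add: pmf_replicate_pmf sqrt_prod word_fun_def prod.distrib)
  also have "\<dots> = schmidt_vec (dA ^ n) (dB ^ n) (words I n) (pmf (replicate_pmf n p))
      (word_fun dA a n) (word_fun dB b n) $ m"
    using m by (simp add: schmidt_vec_def k_def k'_def)
  finally show "tensor_power dA dB (schmidt_vec dA dB I (pmf p) a b) n $ m
    = schmidt_vec (dA ^ n) (dB ^ n) (words I n) (pmf (replicate_pmf n p)) (word_fun dA a n) (word_fun dB b n) $ m" .
qed (simp add: tensor_power_def)

lemma schmidt_distribution_schmidt_vec: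
  assumes "schmidt_distribution dA dB \<psi> r p"
  obtains a b where "set_pmf p \<subseteq> {..<r}" "onf dA {..<r} a" "onf dB {..<r} b"
    "\<psi> = schmidt_vec dA dB {..<r} (pmf p) a b" "0 < dA" "0 < dB"
proof -
  obtain a b where p: "set_pmf p \<subseteq> {..<r}" and a: "orthonormal_family dA r a" and b: "orthonormal_family dB r b"
    and \<psi>: "\<psi> = vec (dA * dB) (\<lambda>k. \<Sum>i<r. complex_of_real (sqrt (pmf p i)) * vec_tensor (a i) (b i) $ k)"
    using assms unfolding schmidt_distribution_def by blast
  have onf: "onf d {..<r} (\<lambda>i k. e i $ k)" if "orthonormal_family d r e" for d e
    using that unfolding onf_def orthonormal_family_def by (simp add: inner_eq_ip [symmetric])
  show ?thesis
  proof
    show "\<psi> = schmidt_vec dA dB {..<r} (pmf p) (\<lambda>i k. a i $ k) (\<lambda>i k. b i $ k)"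
    proof (rule eq_vecI)
      fix m assume "m < dim_vec (schmidt_vec dA dB {..<r} (pmf p) (\<lambda>i k. a i $ k) (\<lambda>i k. b i $ k))"
      then have m: "m < dA * dB" by simp
      have "vec_tensor (a i) (b i) $ m = a i $ (m div dB) * b i $ (m mod dB)" if "i < r" for i
      proof -
        have "dim_vec (a i) = dA" "dim_vec (b i) = dB"
          using a b that by (auto simp: orthonormal_family_def)
        then show ?thesis using m by (simp add: vec_tensor_def)
      qed
      then show "\<psi> $ m = schmidt_vec dA dB {..<r} (pmf p) (\<lambda>i k. a i $ k) (\<lambda>i k. b i $ k) $ m"
        using m by (simp add: \<psi> schmidt_vec_def mult.assoc)
    qed (simp add: \<psi>)
    \<comment> \<open>The support is nonempty, so each side holds at least one Schmidt vector. The
      dimensions are then positive, which keeps the digits of the tensor power in range.\<close>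
    have "0 < r" using p set_pmf_not_empty [of p] by (cases r) auto
    then show "0 < dA" "0 < dB" using onf_card_le [OF onf [OF a]] onf_card_le [OF onf [OF b]] by simp_all
  qed (use p onf [OF a] onf [OF b] in auto)
qed

lemma finite_words: "finite A \<Longrightarrow> finite (words A n)"
  by (rule finite_lists_length_eq)

lemma set_replicate_pmf_subset: "set_pmf p \<subseteq> A \<Longrightarrow> set_pmf (replicate_pmf n p) \<subseteq> words A n"
  by (auto simp: set_replicate_pmf)

theorem FQ_tensor_power_eq_FM:
  assumes \<psi>: "schmidt_distribution dA dB \<psi> r P\<psi>" and \<phi>: "schmidt_distribution dA' dB' \<phi> r' P\<phi>"
    and N: "0 \<le> N"
  shows "FQ (dA ^ n, dB ^ n) (density_of (tensor_power dA dB \<psi> n))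
      (dA' ^ m, dB' ^ m) (density_of (tensor_power dA' dB' \<phi> m)) N
    = FM (replicate_pmf n P\<psi>) (words {..<r'} m) (replicate_pmf m P\<phi>) N"
proof -
  obtain a b where a: "set_pmf P\<psi> \<subseteq> {..<r}" "onf dA {..<r} a" "onf dB {..<r} b"
    "\<psi> = schmidt_vec dA dB {..<r} (pmf P\<psi>) a b" "0 < dA" "0 < dB"
    by (rule schmidt_distribution_schmidt_vec [OF \<psi>])
  obtain e f where e: "set_pmf P\<phi> \<subseteq> {..<r'}" "onf dA' {..<r'} e" "onf dB' {..<r'} f"
    "\<phi> = schmidt_vec dA' dB' {..<r'} (pmf P\<phi>) e f" "0 < dA'" "0 < dB'"
    by (rule schmidt_distribution_schmidt_vec [OF \<phi>])
  show ?thesis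
    unfolding a(4) e(4) tensor_power_schmidt_vec [OF finite_lessThan a(5,6)]
      tensor_power_schmidt_vec [OF finite_lessThan e(5,6)]
    by (intro FQ_eq_FM finite_words finite_lessThan set_replicate_pmf_subset onf_word_fun a e N)
qed

theorem proposition33:
  fixes \<psi> \<phi> :: "complex vec" and dA dB dA' dB' r r' :: nat
    and P\<psi> P\<phi> :: "nat pmf" and \<nu> :: real
  assumes "pure_state dA dB \<psi>" and "entangled dA dB \<psi>"
    and "pure_state dA' dB' \<phi>" and "entangled dA' dB' \<phi>"
    and "schmidt_distribution dA dB \<psi> r P\<psi>"
    and "schmidt_distribution dA' dB' \<phi> r' P\<phi>"
    and "0 < \<nu>" and "\<nu> < 1"
  shows "RQ dA dB \<psi> dA' dB' \<phi> \<nu> = RM P\<psi> {..<r'} P\<phi> \<nu>"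
proof -
  have eq: "(\<lambda>n. ereal (FQ (dA ^ n, dB ^ n) (density_of (tensor_power dA dB \<psi> n))
        (dA' ^ T n, dB' ^ T n) (density_of (tensor_power dA' dB' \<phi> (T n))) (S n)))
      = (\<lambda>n. ereal (FM (replicate_pmf n P\<psi>) (words {..<r'} (T n)) (replicate_pmf (T n) P\<phi>) (S n)))"
    if "\<forall>n. 0 \<le> S n" for S :: "nat \<Rightarrow> real" and T :: "nat \<Rightarrow> nat"
    using FQ_tensor_power_eq_FM [OF assms(5,6)] that by simp
  \<comment> \<open>Both regions range over the same \<open>S\<close> and \<open>T\<close>, and for
    each pair the sequences under the limes inferior agree termwise. The congruence rule makes
    \<open>0 \<le> S n\<close> available for this.\<close>
  show ?thesis unfolding RQ_def RM_def by (simp add: eq cong: conj_cong)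
qed

end
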